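(* Let $\mathbb{C}$ be a regular category. If $\mathbb{C}$ is a Goursat category, then $\mathrm{Conn}(\mathbb{C})$ is (via the functor forgetting the connector) a full subcategory of $2\text{-}\mathrm{Eq}(\mathbb{C})$ that is closed in $2\text{-}\mathrm{Eq}(\mathbb{C})$ under quotients.
   Context: A category is regular if it is finitely complete, regular epimorphisms are stable under pullbacks, and kernel pairs have coequalisers. A relation from $X$ to $Y$ is a subobject $\langle r_1,r_2\rangle : R \rightarrowtail X\times Y$; in a regular category the composite $SR$ of $R\rightarrowtail X\times Y$ and $S\rightarrowtail Y\times Z$ is the image of $(r_1 p_1, s_2 p_2): R\times_Y S\to X\times Z$, where $R\times_Y S$ (with projections $p_1,p_2$) is the pullback of $r_2$ along $s_1$. An equivalence relation on $X$ is a relation from $X$ to $X$ that is (internally) reflexive, symmetric and transitive. A Goursat category is a regular category in which $RSR=SRS$ for any pair of equivalence relations $R,S$ on the same object. Let $(R,r_1,r_2)$ and $(S,s_1,s_2)$ be equivalence relations on an object $X$, and let $R\times_X S$ be the pullback of $r_2$ along $s_1$ (so its generalized elements are triples $(x,y,z)$ with $xRy$ and $ySz$). A connector between $R$ and $S$ is an arrow $p: R\times_X S\to X$ such that (in terms of generalized elements, whenever each term is defined): (1) $x\,S\,p(x,y,z)\,R\,z$; (2) $p(x,x,y)=y$; (3) $p(x,y,y)=x$; (4) $p(x,y,p(z,u,v))=p(p(x,y,z),u,v)$. In a Goursat category a connector between two given equivalence relations is unique when it exists (known fact), so having a connector is a property of the pair. The category $2\text{-}\mathrm{Eq}(\mathbb{C})$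 has as objects triples $(R,S,X)$ where $R$ and $S$ are equivalence relations on the object $X$ of $\mathbb{C}$; an arrow $(R,S,X)\to(\bar R,\bar S,\bar X)$ is a triple of arrows $f_R:R\to\bar R$, $f_S:S\to\bar S$, $f:X\to\bar X$ in $\mathbb{C}$ with $\bar r_i f_R=f r_i$ and $\bar s_i f_S=f s_i$ for $i=1,2$. The category $\mathrm{Conn}(\mathbb{C})$ has as objects $(R,S,X,p)$ where $(R,S,X)$ is an object of $2\text{-}\mathrm{Eq}(\mathbb{C})$ and $p:R\times_X S\to X$ is a connector between $R$ and $S$; an arrow $(R,S,X,p)\to(\bar R,\bar S,\bar X,\bar p)$ is an arrow $(f_R,f_S,f)$ of $2\text{-}\mathrm{Eq}(\mathbb{C})$ such that $f p=\bar p\,\bar f$, where $\bar f: R\times_X S\to \bar R\times_{\bar X}\bar S$ is the arrow induced by $f_R$ and $f_S$ on the pullbacks. A subcategory $\mathbb{P}$ is closed under quotients in a category $\mathbb{Q}$ if, for any regular epimorphism $A\twoheadrightarrow B$ in $\mathbb{Q}$ with $A\in\mathbb{P}$, also $B\in\mathbb{P}$. An object $(R,S,X)$ of $2\text{-}\mathrm{Eq}(\mathbb{C})$ belongs to $\mathrm{Conn}(\mathbb{C})$ when there is a connector between $R$ and $S$. *)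

theory Defs
  imports Main
begin

section \<open>Categories, functors, finite limits\<close>

record ('o, 'm) cat =
  Obj :: "'o set"
  Arr :: "'m set"
  Dom :: "'m \<Rightarrow> 'o"
  Cod :: "'m \<Rightarrow> 'o"
  Idt :: "'o \<Rightarrow> 'm"
  Comp :: "'m \<Rightarrow> 'm \<Rightarrow> 'm"  (infixr "\<cdot>\<index>" 70)

definition hom :: "('o, 'm) cat \<Rightarrow> 'o \<Rightarrow> 'o \<Rightarrow> 'm set" where
  "hom C X Y = {f \<in> Arr C. Dom C f = X \<and> Cod C f = Y}"

definition category :: "('o, 'm) cat \<Rightarrow> bool" where
  "category C \<longleftrightarrow>
     (\<forall>f \<in> Arr C. Dom C f \<in> Obj C \<and> Cod C f \<in> Obj C) \<and>
     (\<forall>X \<in> Obj C. Idt C X \<in> hom C X X) \<and>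
     (\<forall>f \<in> Arr C. \<forall>g \<in> Arr C. Dom C g = Cod C f \<longrightarrow>
        g \<cdot>\<^bsub>C\<^esub> f \<in> hom C (Dom C f) (Cod C g)) \<and>
     (\<forall>f \<in> Arr C. f \<cdot>\<^bsub>C\<^esub> Idt C (Dom C f) = f \<and> Idt C (Cod C f) \<cdot>\<^bsub>C\<^esub> f = f) \<and>
     (\<forall>f \<in> Arr C. \<forall>g \<in> Arr C. \<forall>h \<in> Arr C. Dom C g = Cod C f \<longrightarrow> Dom C h = Cod C g \<longrightarrow>
        (h \<cdot>\<^bsub>C\<^esub> g) \<cdot>\<^bsub>C\<^esub> f = h \<cdot>\<^bsub>C\<^esub> (g \<cdot>\<^bsub>C\<^esub> f))"

text \<open>A functor is given by its object part \<open>F\<close> and its arrow part \<open>\<phi>\<close>.\<close>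

definition is_functor ::
  "('o, 'm) cat \<Rightarrow> ('p, 'n) cat \<Rightarrow> ('o \<Rightarrow> 'p) \<Rightarrow> ('m \<Rightarrow> 'n) \<Rightarrow> bool" where
  "is_functor A B F \<phi> \<longleftrightarrow> category A \<and> category B \<and>
     (\<forall>X \<in> Obj A. F X \<in> Obj B) \<and>
     (\<forall>f \<in> Arr A. \<phi> f \<in> hom B (F (Dom A f)) (F (Cod A f))) \<and>
     (\<forall>X \<in> Obj A. \<phi> (Idt A X) = Idt B (F X)) \<and>
     (\<forall>f \<in> Arr A. \<forall>g \<in> Arr A. Dom A g = Cod A f \<longrightarrow>
        \<phi> (g \<cdot>\<^bsub>A\<^esub> f) = \<phi> g \<cdot>\<^bsub>B\<^esub> \<phi> f)"

definition is_cone ::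
  "('j, 'k) cat \<Rightarrow> ('o, 'm) cat \<Rightarrow> ('j \<Rightarrow> 'o) \<Rightarrow> ('k \<Rightarrow> 'm) \<Rightarrow> 'o \<Rightarrow> ('j \<Rightarrow> 'm) \<Rightarrow> bool" where
  "is_cone J C F \<phi> T \<mu> \<longleftrightarrow> T \<in> Obj C \<and> (\<forall>j \<in> Obj J. \<mu> j \<in> hom C T (F j)) \<and>
     (\<forall>u \<in> Arr J. \<phi> u \<cdot>\<^bsub>C\<^esub> \<mu> (Dom J u) = \<mu> (Cod J u))"

definition is_limit ::
  "('j, 'k) cat \<Rightarrow> ('o, 'm) cat \<Rightarrow> ('j \<Rightarrow> 'o) \<Rightarrow> ('k \<Rightarrow> 'm) \<Rightarrow> 'o \<Rightarrow> ('j \<Rightarrow> 'm) \<Rightarrow> bool" where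
  "is_limit J C F \<phi> L \<nu> \<longleftrightarrow> is_cone J C F \<phi> L \<nu> \<and>
     (\<forall>T \<mu>. is_cone J C F \<phi> T \<mu> \<longrightarrow>
        (\<exists>!h. h \<in> hom C T L \<and> (\<forall>j \<in> Obj J. \<nu> j \<cdot>\<^bsub>C\<^esub> h = \<mu> j)))"

text \<open>Every finite category is isomorphic to one whose objects and arrows are natural numbers,
  so it suffices to let the index categories range over these.\<close>

definition finitely_complete :: "('o, 'm) cat \<Rightarrow> bool" where
  "finitely_complete C \<longleftrightarrow>
     (\<forall>(J :: (nat, nat) cat) F \<phi>. finite (Obj J) \<and> finite (Arr J) \<and> is_functor J C F \<phi> \<longrightarrow>
        (\<exists>L \<nu>. is_limit J C F \<phi> L \<nu>))"

section \<open>Regular categories\<close>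

definition is_mono :: "('o, 'm) cat \<Rightarrow> 'm \<Rightarrow> bool" where
  "is_mono C m \<longleftrightarrow> m \<in> Arr C \<and>
     (\<forall>T \<in> Obj C. \<forall>a \<in> hom C T (Dom C m). \<forall>b \<in> hom C T (Dom C m).
        m \<cdot>\<^bsub>C\<^esub> a = m \<cdot>\<^bsub>C\<^esub> b \<longrightarrow> a = b)"

definition is_iso :: "('o, 'm) cat \<Rightarrow> 'm \<Rightarrow> bool" where
  "is_iso C f \<longleftrightarrow> f \<in> Arr C \<and>
     (\<exists>g \<in> hom C (Cod C f) (Dom C f).
        g \<cdot>\<^bsub>C\<^esub> f = Idt C (Dom C f) \<and> f \<cdot>\<^bsub>C\<^esub> g = Idt C (Cod C f))"

definition is_coequaliser :: "('o, 'm) cat \<Rightarrow> 'm \<Rightarrow> 'm \<Rightarrow> 'm \<Rightarrow> bool" where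
  "is_coequaliser C u v q \<longleftrightarrow>
     u \<in> Arr C \<and> v \<in> Arr C \<and> q \<in> Arr C \<and> Dom C u = Dom C v \<and> Cod C u = Cod C v \<and>
     Dom C q = Cod C u \<and> q \<cdot>\<^bsub>C\<^esub> u = q \<cdot>\<^bsub>C\<^esub> v \<and>
     (\<forall>h \<in> Arr C. Dom C h = Cod C u \<and> h \<cdot>\<^bsub>C\<^esub> u = h \<cdot>\<^bsub>C\<^esub> v \<longrightarrow>
        (\<exists>!k. k \<in> hom C (Cod C q) (Cod C h) \<and> k \<cdot>\<^bsub>C\<^esub> q = h))"

definition regular_epi :: "('o, 'm) cat \<Rightarrow> 'm \<Rightarrow> bool" where
  "regular_epi C q \<longleftrightarrow> (\<exists>u v. is_coequaliser C u v q)"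

datatype ('o, 'm) span = Span (apex: 'o) (lft: 'm) (rgt: 'm)

definition is_span :: "('o, 'm) cat \<Rightarrow> 'o \<Rightarrow> 'o \<Rightarrow> ('o, 'm) span \<Rightarrow> bool" where
  "is_span C X Y P \<longleftrightarrow> apex P \<in> Obj C \<and> lft P \<in> hom C (apex P) X \<and> rgt P \<in> hom C (apex P) Y"

definition is_product :: "('o, 'm) cat \<Rightarrow> 'o \<Rightarrow> 'o \<Rightarrow> ('o, 'm) span \<Rightarrow> bool" where
  "is_product C X Y P \<longleftrightarrow> X \<in> Obj C \<and> Y \<in> Obj C \<and> is_span C X Y P \<and>
     (\<forall>T \<in> Obj C. \<forall>a \<in> hom C T X. \<forall>b \<in> hom C T Y.
        \<exists>!h. h \<in> hom C T (apex P) \<and> lft P \<cdot>\<^bsub>C\<^esub> h = a \<and> rgt P \<cdot>\<^bsub>C\<^esub> h = b)"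

definition is_pullback :: "('o, 'm) cat \<Rightarrow> 'm \<Rightarrow> 'm \<Rightarrow> ('o, 'm) span \<Rightarrow> bool" where
  "is_pullback C f g P \<longleftrightarrow> f \<in> Arr C \<and> g \<in> Arr C \<and> Cod C f = Cod C g \<and>
     is_span C (Dom C f) (Dom C g) P \<and> f \<cdot>\<^bsub>C\<^esub> lft P = g \<cdot>\<^bsub>C\<^esub> rgt P \<and>
     (\<forall>T \<in> Obj C. \<forall>a \<in> hom C T (Dom C f). \<forall>b \<in> hom C T (Dom C g).
        f \<cdot>\<^bsub>C\<^esub> a = g \<cdot>\<^bsub>C\<^esub> b \<longrightarrow>
          (\<exists>!h. h \<in> hom C T (apex P) \<and> lft P \<cdot>\<^bsub>C\<^esub> h = a \<and> rgt P \<cdot>\<^bsub>C\<^esub> h = b))"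

definition regular_category :: "('o, 'm) cat \<Rightarrow> bool" where
  "regular_category C \<longleftrightarrow> category C \<and> finitely_complete C \<and>
     (\<forall>f g P. is_pullback C f g P \<and> regular_epi C f \<longrightarrow> regular_epi C (rgt P)) \<and>
     (\<forall>f K. is_pullback C f f K \<longrightarrow> (\<exists>q. is_coequaliser C (lft K) (rgt K) q))"

section \<open>Relations\<close>

text \<open>Chosen products, pullbacks and images. They are determined up to isomorphism, and
  exist in every regular category; up to isomorphism nothing below depends on the choice.\<close>

definition prd :: "('o, 'm) cat \<Rightarrow> 'o \<Rightarrow> 'o \<Rightarrow> ('o, 'm) span" where
  "prd C X Y = (SOME P. is_product C X Y P)"

definition pb :: "('o, 'm) cat \<Rightarrow> 'm \<Rightarrow> 'm \<Rightarrow> ('o, 'm) span" where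
  "pb C f g = (SOME P. is_pullback C f g P)"

definition pairing :: "('o, 'm) cat \<Rightarrow> 'm \<Rightarrow> 'm \<Rightarrow> 'm" where
  "pairing C a b = (let P = prd C (Cod C a) (Cod C b) in
     THE h. h \<in> hom C (Dom C a) (apex P) \<and> lft P \<cdot>\<^bsub>C\<^esub> h = a \<and> rgt P \<cdot>\<^bsub>C\<^esub> h = b)"

definition is_image :: "('o, 'm) cat \<Rightarrow> 'm \<Rightarrow> 'm \<Rightarrow> bool" where
  "is_image C f m \<longleftrightarrow> is_mono C m \<and>
     (\<exists>e. regular_epi C e \<and> Cod C e = Dom C m \<and> f = m \<cdot>\<^bsub>C\<^esub> e)"

definition im :: "('o, 'm) cat \<Rightarrow> 'm \<Rightarrow> 'm" where
  "im C f = (SOME m. is_image C f m)"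

text \<open>Subobjects of \<open>X \<times> Y\<close> are handled through representing monomorphisms, so equality of
  relations is the isomorphism \<open>rel_eq\<close> below.\<close>

definition relation :: "('o, 'm) cat \<Rightarrow> 'o \<Rightarrow> 'o \<Rightarrow> ('o, 'm) span \<Rightarrow> bool" where
  "relation C X Y R \<longleftrightarrow> X \<in> Obj C \<and> Y \<in> Obj C \<and> is_span C X Y R \<and>
     is_mono C (pairing C (lft R) (rgt R))"

definition rel_eq :: "('o, 'm) cat \<Rightarrow> ('o, 'm) span \<Rightarrow> ('o, 'm) span \<Rightarrow> bool" where
  "rel_eq C R S \<longleftrightarrow> (\<exists>i \<in> hom C (apex R) (apex S). is_iso C i \<and>
     lft S \<cdot>\<^bsub>C\<^esub> i = lft R \<and> rgt S \<cdot>\<^bsub>C\<^esub> i = rgt R)"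

text \<open>\<open>rel_comp C S R\<close> is the composite \<open>SR\<close>: first \<open>R\<close>, then \<open>S\<close>.\<close>

definition rel_comp :: "('o, 'm) cat \<Rightarrow> ('o, 'm) span \<Rightarrow> ('o, 'm) span \<Rightarrow> ('o, 'm) span" where
  "rel_comp C S R =
     (let P = pb C (rgt R) (lft S);
          Q = prd C (Cod C (lft R)) (Cod C (rgt S));
          m = im C (pairing C (lft R \<cdot>\<^bsub>C\<^esub> lft P) (rgt S \<cdot>\<^bsub>C\<^esub> rgt P))
      in Span (Dom C m) (lft Q \<cdot>\<^bsub>C\<^esub> m) (rgt Q \<cdot>\<^bsub>C\<^esub> m))"

definition internally_reflexive :: "('o, 'm) cat \<Rightarrow> 'o \<Rightarrow> ('o, 'm) span \<Rightarrow> bool" where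
  "internally_reflexive C X R \<longleftrightarrow>
     (\<exists>d \<in> hom C X (apex R). lft R \<cdot>\<^bsub>C\<^esub> d = Idt C X \<and> rgt R \<cdot>\<^bsub>C\<^esub> d = Idt C X)"

definition internally_symmetric :: "('o, 'm) cat \<Rightarrow> ('o, 'm) span \<Rightarrow> bool" where
  "internally_symmetric C R \<longleftrightarrow>
     (\<exists>s \<in> hom C (apex R) (apex R). lft R \<cdot>\<^bsub>C\<^esub> s = rgt R \<and> rgt R \<cdot>\<^bsub>C\<^esub> s = lft R)"

definition internally_transitive :: "('o, 'm) cat \<Rightarrow> ('o, 'm) span \<Rightarrow> bool" where
  "internally_transitive C R \<longleftrightarrow>
     (let P = pb C (rgt R) (lft R) in
      \<exists>t \<in> hom C (apex P) (apex R).
        lft R \<cdot>\<^bsub>C\<^esub> t = lft R \<cdot>\<^bsub>C\<^esub> lft P \<and> rgt R \<cdot>\<^bsub>C\<^esub> t = rgt R \<cdot>\<^bsub>C\<^esub> rgt P)"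

definition equivalence_rel :: "('o, 'm) cat \<Rightarrow> 'o \<Rightarrow> ('o, 'm) span \<Rightarrow> bool" where
  "equivalence_rel C X R \<longleftrightarrow> relation C X X R \<and>
     internally_reflexive C X R \<and> internally_symmetric C R \<and> internally_transitive C R"

definition goursat_category :: "('o, 'm) cat \<Rightarrow> bool" where
  "goursat_category C \<longleftrightarrow> regular_category C \<and>
     (\<forall>X R S. equivalence_rel C X R \<and> equivalence_rel C X S \<longrightarrow>
        rel_eq C (rel_comp C R (rel_comp C S R)) (rel_comp C S (rel_comp C R S)))"

section \<open>Connectors\<close>

text \<open>For generalized elements \<open>x, y : T \<rightarrow> X\<close>, the relation \<open>x R y\<close>.\<close>

definition relates :: "('o, 'm) cat \<Rightarrow> ('o, 'm) span \<Rightarrow> 'm \<Rightarrow> 'm \<Rightarrow> bool" where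
  "relates C R x y \<longleftrightarrow>
     (\<exists>r \<in> hom C (Dom C x) (apex R). lft R \<cdot>\<^bsub>C\<^esub> r = x \<and> rgt R \<cdot>\<^bsub>C\<^esub> r = y)"

text \<open>The pullback \<open>R \<times>\<^sub>X S\<close>, the generalized element \<open>(x, y, z)\<close> of it given by \<open>x R y S z\<close>,
  and the value \<open>p(x, y, z)\<close>, which is only meaningful when \<open>x R y S z\<close>.\<close>

definition rs_pb :: "('o, 'm) cat \<Rightarrow> ('o, 'm) span \<Rightarrow> ('o, 'm) span \<Rightarrow> ('o, 'm) span" where
  "rs_pb C R S = pb C (rgt R) (lft S)"

definition triple ::
  "('o, 'm) cat \<Rightarrow> ('o, 'm) span \<Rightarrow> ('o, 'm) span \<Rightarrow> 'm \<Rightarrow> 'm \<Rightarrow> 'm \<Rightarrow> 'm" where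
  "triple C R S x y z = (let P = rs_pb C R S in
     THE t. t \<in> hom C (Dom C x) (apex P) \<and>
       lft R \<cdot>\<^bsub>C\<^esub> lft P \<cdot>\<^bsub>C\<^esub> t = x \<and> rgt R \<cdot>\<^bsub>C\<^esub> lft P \<cdot>\<^bsub>C\<^esub> t = y \<and>
       lft S \<cdot>\<^bsub>C\<^esub> rgt P \<cdot>\<^bsub>C\<^esub> t = y \<and> rgt S \<cdot>\<^bsub>C\<^esub> rgt P \<cdot>\<^bsub>C\<^esub> t = z)"

definition composable ::
  "('o, 'm) cat \<Rightarrow> ('o, 'm) span \<Rightarrow> ('o, 'm) span \<Rightarrow> 'm \<Rightarrow> 'm \<Rightarrow> 'm \<Rightarrow> bool" where
  "composable C R S x y z \<longleftrightarrow> relates C R x y \<and> relates C S y z"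

definition connector ::
  "('o, 'm) cat \<Rightarrow> 'o \<Rightarrow> ('o, 'm) span \<Rightarrow> ('o, 'm) span \<Rightarrow> 'm \<Rightarrow> bool" where
  "connector C X R S p \<longleftrightarrow> p \<in> hom C (apex (rs_pb C R S)) X \<and>
     (let app = (\<lambda>x y z. p \<cdot>\<^bsub>C\<^esub> triple C R S x y z); ok = composable C R S in
      \<forall>T \<in> Obj C.
        (\<forall>x \<in> hom C T X. \<forall>y \<in> hom C T X. \<forall>z \<in> hom C T X. ok x y z \<longrightarrow>
           relates C S x (app x y z) \<and> relates C R (app x y z) z) \<and>
        (\<forall>x \<in> hom C T X. \<forall>y \<in> hom C T X. ok x x y \<longrightarrow> app x x y = y) \<and>
        (\<forall>x \<in> hom C T X. \<forall>y \<in> hom C T X. ok x y y \<longrightarrow> app x y y = x) \<and>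
        (\<forall>x \<in> hom C T X. \<forall>y \<in> hom C T X. \<forall>z \<in> hom C T X. \<forall>u \<in> hom C T X. \<forall>v \<in> hom C T X.
           ok z u v \<and> ok x y (app z u v) \<and> ok x y z \<and> ok (app x y z) u v \<longrightarrow>
           app x y (app z u v) = app (app x y z) u v))"

section \<open>The categories 2-Eq(C) and Conn(C)\<close>

datatype ('o, 'm) eq2 = Eq2 (rel1: "('o, 'm) span") (rel2: "('o, 'm) span") (base: 'o)

datatype ('o, 'm) conn_obj = ConnObj (pair_of: "('o, 'm) eq2") (conn_of: 'm)

text \<open>A triple \<open>(f\<^sub>R, f\<^sub>S, f)\<close> together with its domain and codomain; \<open>'x\<close> is the type of objects.\<close>

datatype ('x, 'm) tri = Tri (src: 'x) (trg: 'x) (on1: 'm) (on2: 'm) (on_base: 'm)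

definition is_eq2 :: "('o, 'm) cat \<Rightarrow> ('o, 'm) eq2 \<Rightarrow> bool" where
  "is_eq2 C A \<longleftrightarrow> equivalence_rel C (base A) (rel1 A) \<and> equivalence_rel C (base A) (rel2 A)"

definition is_eq2_arrow ::
  "('o, 'm) cat \<Rightarrow> ('o, 'm) eq2 \<Rightarrow> ('o, 'm) eq2 \<Rightarrow> 'm \<Rightarrow> 'm \<Rightarrow> 'm \<Rightarrow> bool" where
  "is_eq2_arrow C A B fR fS f \<longleftrightarrow>
     fR \<in> hom C (apex (rel1 A)) (apex (rel1 B)) \<and>
     fS \<in> hom C (apex (rel2 A)) (apex (rel2 B)) \<and>
     f \<in> hom C (base A) (base B) \<and>
     lft (rel1 B) \<cdot>\<^bsub>C\<^esub> fR = f \<cdot>\<^bsub>C\<^esub> lft (rel1 A) \<and>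
     rgt (rel1 B) \<cdot>\<^bsub>C\<^esub> fR = f \<cdot>\<^bsub>C\<^esub> rgt (rel1 A) \<and>
     lft (rel2 B) \<cdot>\<^bsub>C\<^esub> fS = f \<cdot>\<^bsub>C\<^esub> lft (rel2 A) \<and>
     rgt (rel2 B) \<cdot>\<^bsub>C\<^esub> fS = f \<cdot>\<^bsub>C\<^esub> rgt (rel2 A)"

definition two_Eq :: "('o, 'm) cat \<Rightarrow> (('o, 'm) eq2, (('o, 'm) eq2, 'm) tri) cat" where
  "two_Eq C = \<lparr>
     Obj = {A. is_eq2 C A},
     Arr = {t. is_eq2 C (src t) \<and> is_eq2 C (trg t) \<and>
              is_eq2_arrow C (src t) (trg t) (on1 t) (on2 t) (on_base t)},
     Dom = src,
     Cod = trg,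
     Idt = (\<lambda>A. Tri A A (Idt C (apex (rel1 A))) (Idt C (apex (rel2 A))) (Idt C (base A))),
     Comp = (\<lambda>t s. Tri (src s) (trg t)
       (on1 t \<cdot>\<^bsub>C\<^esub> on1 s) (on2 t \<cdot>\<^bsub>C\<^esub> on2 s) (on_base t \<cdot>\<^bsub>C\<^esub> on_base s)) \<rparr>"

definition induced ::
  "('o, 'm) cat \<Rightarrow> ('o, 'm) eq2 \<Rightarrow> ('o, 'm) eq2 \<Rightarrow> 'm \<Rightarrow> 'm \<Rightarrow> 'm" where
  "induced C A B fR fS =
     (let P = rs_pb C (rel1 A) (rel2 A); Q = rs_pb C (rel1 B) (rel2 B) in
      THE h. h \<in> hom C (apex P) (apex Q) \<and>
        lft Q \<cdot>\<^bsub>C\<^esub> h = fR \<cdot>\<^bsub>C\<^esub> lft P \<and> rgt Q \<cdot>\<^bsub>C\<^esub> h = fS \<cdot>\<^bsub>C\<^esub> rgt P)"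

definition is_conn_obj :: "('o, 'm) cat \<Rightarrow> ('o, 'm) conn_obj \<Rightarrow> bool" where
  "is_conn_obj C A \<longleftrightarrow> is_eq2 C (pair_of A) \<and>
     connector C (base (pair_of A)) (rel1 (pair_of A)) (rel2 (pair_of A)) (conn_of A)"

definition Conn :: "('o, 'm) cat \<Rightarrow> (('o, 'm) conn_obj, (('o, 'm) conn_obj, 'm) tri) cat" where
  "Conn C = \<lparr>
     Obj = {A. is_conn_obj C A},
     Arr = {t. is_conn_obj C (src t) \<and> is_conn_obj C (trg t) \<and>
              is_eq2_arrow C (pair_of (src t)) (pair_of (trg t)) (on1 t) (on2 t) (on_base t) \<and>
              on_base t \<cdot>\<^bsub>C\<^esub> conn_of (src t) =
                conn_of (trg t) \<cdot>\<^bsub>C\<^esub>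
                  induced C (pair_of (src t)) (pair_of (trg t)) (on1 t) (on2 t)},
     Dom = src,
     Cod = trg,
     Idt = (\<lambda>A. Tri A A (Idt C (apex (rel1 (pair_of A)))) (Idt C (apex (rel2 (pair_of A))))
       (Idt C (base (pair_of A)))),
     Comp = (\<lambda>t s. Tri (src s) (trg t)
       (on1 t \<cdot>\<^bsub>C\<^esub> on1 s) (on2 t \<cdot>\<^bsub>C\<^esub> on2 s) (on_base t \<cdot>\<^bsub>C\<^esub> on_base s)) \<rparr>"

text \<open>The functor forgetting the connector is \<open>pair_of\<close> on objects and the following on arrows.\<close>

definition forget_arr :: "(('o, 'm) conn_obj, 'm) tri \<Rightarrow> (('o, 'm) eq2, 'm) tri" where
  "forget_arr t = Tri (pair_of (src t)) (pair_of (trg t)) (on1 t) (on2 t) (on_base t)"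

section \<open>Full subcategories and closure under quotients\<close>

definition full_subcategory_via ::
  "('o, 'm) cat \<Rightarrow> ('p, 'n) cat \<Rightarrow> ('o \<Rightarrow> 'p) \<Rightarrow> ('m \<Rightarrow> 'n) \<Rightarrow> bool" where
  "full_subcategory_via A B F \<phi> \<longleftrightarrow> is_functor A B F \<phi> \<and> inj_on F (Obj A) \<and>
     (\<forall>X \<in> Obj A. \<forall>Y \<in> Obj A. bij_betw \<phi> (hom A X Y) (hom B (F X) (F Y)))"

definition closed_under_quotients :: "('o, 'm) cat \<Rightarrow> 'o set \<Rightarrow> bool" where
  "closed_under_quotients B P \<longleftrightarrow>
     (\<forall>q. regular_epi B q \<and> Dom B q \<in> P \<longrightarrow> Cod B q \<in> P)"

end

theory Submission
  imports Defs
begin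

text \<open>Statements about relations are checked on generalized elements, up to pulling back along regular
  epimorphisms. In this reading 3-permutability yields the Shifting Lemma, and every compatibility of
  connectors needed is an instance of it: morphisms of pairs of equivalence relations preserve
  connectors (whence uniqueness and fullness), and the composite of a connector \<open>p : R \<times>\<^sub>X S \<rightarrow> X\<close>
  with a quotient map \<open>X \<rightarrow> X'\<close> only depends on the image of its argument. It thus descends
  to \<open>R' \<times>\<^sub>X\<^sub>' S'\<close>, because \<open>R \<times>\<^sub>X S \<rightarrow> R' \<times>\<^sub>X\<^sub>' S'\<close> is a regular epimorphism, again by
  3-permutability. The same lifting argument for chains \<open>x R' y S' z R' u S' v\<close> transports
  associativity.\<close>

section \<open>Regular epimorphisms, limits and images\<close>

text \<open>Exchanging relations by 3-permutability only yields elements after a change of base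
  along a regular epimorphism, so every existence statement is local; this is harmless because
  equations and membership in a relation descend along regular epimorphisms. Two obstacles shape the
  rest. Regular epimorphisms \<open>R \<rightarrow> R'\<close> and \<open>S \<rightarrow> S'\<close>
  do not by themselves make the map between the pullbacks one, because separate lifts of
  \<open>x R' y\<close> and \<open>y S' z\<close> have different middle terms. The lifts have to be
  related by \<open>R\<close> from the outset, and a diagonal, serving as a section of a projection
  to \<open>X\<close>, is what brings them within reach of 3-permutability. Moreover, a regular
  epimorphism of pairs is a coequaliser in \<open>two_Eq C\<close>, which says nothing directly
  about its components in \<open>C\<close>. They are reached through a componentwise image
  factorisation, and this lives in \<open>two_Eq C\<close> only because direct images of equivalence
  relations are again transitive, once more by 3-permutability.\<close>

locale cat_struct =
  fixes C :: "('o, 'm) cat" (structure)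
  assumes category: "category C"
begin

abbreviation cover :: "'o \<Rightarrow> 'o \<Rightarrow> 'm set" where
  "cover X Y \<equiv> {e \<in> hom C X Y. regular_epi C e}"

lemma comp_simps [simp]:
  assumes "f \<in> Arr C" "g \<in> Arr C" "Dom C g = Cod C f"
  shows "g \<cdot> f \<in> Arr C" "Dom C (g \<cdot> f) = Dom C f" "Cod C (g \<cdot> f) = Cod C g"
  using category assms unfolding category_def hom_def by auto

lemma assoc [simp]:
  assumes "f \<in> Arr C" "g \<in> Arr C" "h \<in> Arr C" "Dom C g = Cod C f" "Dom C h = Cod C g"
  shows "(h \<cdot> g) \<cdot> f = h \<cdot> (g \<cdot> f)"
  using category assms unfolding category_def by blast

lemma Idt_simps [simp]:
  assumes "X \<in> Obj C"
  shows "Idt C X \<in> Arr C" "Dom C (Idt C X) = X" "Cod C (Idt C X) = X"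
  using category assms unfolding category_def hom_def by auto

lemma comp_Idt [simp]: "f \<in> Arr C \<Longrightarrow> Dom C f = X \<Longrightarrow> f \<cdot> Idt C X = f"
  using category unfolding category_def by blast

lemma Idt_comp [simp]: "f \<in> Arr C \<Longrightarrow> Cod C f = X \<Longrightarrow> Idt C X \<cdot> f = f"
  using category unfolding category_def by blast

lemma comp_hom [intro]: "g \<in> hom C Y Z \<Longrightarrow> f \<in> hom C X Y \<Longrightarrow> g \<cdot> f \<in> hom C X Z"
  by (simp add: hom_def)

lemma Idt_hom [intro]: "X \<in> Obj C \<Longrightarrow> Idt C X \<in> hom C X X"
  by (simp add: hom_def)

lemma hom_Obj:
  assumes "f \<in> hom C X Y"
  shows "X \<in> Obj C" "Y \<in> Obj C"
  using category assms unfolding category_def hom_def by auto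

lemma hom_assoc:
  "f \<in> hom C W X \<Longrightarrow> g \<in> hom C X Y \<Longrightarrow> h \<in> hom C Y Z \<Longrightarrow> (h \<cdot> g) \<cdot> f = h \<cdot> (g \<cdot> f)"
  by (simp add: hom_def)

text \<open>Composites are nested to the right, so an equation \<open>g f = k\<close> does not match
  inside \<open>g (f a)\<close>. This form evaluates the equation at the generalized element
  \<open>a\<close>.\<close>

lemma whisker:
  "g \<cdot> f = k \<Longrightarrow> f \<in> hom C X Y \<Longrightarrow> g \<in> hom C Y Z \<Longrightarrow> a \<in> hom C T X \<Longrightarrow> g \<cdot> (f \<cdot> a) = k \<cdot> a"
  using hom_assoc by metis

section \<open>Regular epimorphisms in an arbitrary category\<close>

lemma coequaliserD:
  assumes "is_coequaliser C u v q" "q \<in> hom C S T"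
  shows "u \<in> hom C (Dom C u) S" "v \<in> hom C (Dom C u) S" "q \<cdot> u = q \<cdot> v"
  using assms unfolding is_coequaliser_def by (auto simp: hom_def)

lemma coequaliser_factor:
  assumes "is_coequaliser C u v q" "q \<in> hom C S T" "h \<in> hom C S X" "h \<cdot> u = h \<cdot> v"
  shows "\<exists>!k. k \<in> hom C T X \<and> k \<cdot> q = h"
proof -
  have "h \<in> Arr C" "Dom C h = Cod C u" "Cod C h = X" "Cod C q = T"
    using assms unfolding is_coequaliser_def by (auto simp: hom_def)
  then show ?thesis using assms(1,4) unfolding is_coequaliser_def by blast
qed

lemma cover_epi:
  assumes "e \<in> cover S T" "x \<in> hom C T X" "y \<in> hom C T X" "x \<cdot> e = y \<cdot> e"
  shows "x = y"
proof -
  obtain u v where uv: "is_coequaliser C u v e"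
    using assms unfolding regular_epi_def by blast
  have e: "e \<in> hom C S T" using assms by simp
  note c = coequaliserD[OF uv e]
  have "(x \<cdot> e) \<cdot> u = (x \<cdot> e) \<cdot> v" using c e assms by (simp add: hom_assoc)
  then have "\<exists>!k. k \<in> hom C T X \<and> k \<cdot> e = x \<cdot> e"
    using coequaliser_factor[OF uv e] e assms by blast
  then show ?thesis using assms by metis
qed

text \<open>The pair coequalised by \<open>e\<close> is one instance of the compatibility
  hypothesis, so testing all pairs identified by \<open>e\<close> replaces the kernel pair. No
  limits are involved, which lets the lemma be applied in \<open>two_Eq C\<close> as well.\<close>

lemma cover_factor:
  assumes "e \<in> cover S T" "h \<in> hom C S X"
    and eq: "\<And>U u v. u \<in> hom C U S \<Longrightarrow> v \<in> hom C U S \<Longrightarrow> e \<cdot> u = e \<cdot> v \<Longrightarrow> h \<cdot> u = h \<cdot> v"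
  obtains k where "k \<in> hom C T X" "k \<cdot> e = h"
proof -
  obtain u v where uv: "is_coequaliser C u v e"
    using assms(1) unfolding regular_epi_def by blast
  have e: "e \<in> hom C S T" using assms by simp
  have "h \<cdot> u = h \<cdot> v" using coequaliserD[OF uv e] by (rule eq)
  then show thesis using coequaliser_factor[OF uv e assms(2)] that by blast
qed

lemma mono_cancel:
  assumes "is_mono C m" "m \<in> hom C X Y" "a \<in> hom C T X" "b \<in> hom C T X" "m \<cdot> a = m \<cdot> b"
  shows "a = b"
proof -
  have "T \<in> Obj C" using assms(3) hom_Obj by blast
  then show ?thesis using assms unfolding is_mono_def hom_def by blast
qed

text \<open>Since \<open>m\<close> is monic, \<open>d\<close> identifies whatever \<open>c\<close>
  identifies and so descends along \<open>c\<close> to some \<open>s\<close>; cancelling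
  \<open>c\<close> in \<open>m s c = c\<close> makes \<open>s\<close> a section of
  \<open>m\<close>.\<close>

lemma cover_through_mono:
  assumes "c \<in> cover T B" "m \<in> hom C I B" "is_mono C m" "d \<in> hom C T I" "m \<cdot> d = c"
  obtains s where "s \<in> hom C B I" "m \<cdot> s = Idt C B"
proof -
  have "d \<cdot> u = d \<cdot> v" if "u \<in> hom C U T" "v \<in> hom C U T" "c \<cdot> u = c \<cdot> v" for U u v
    by (rule mono_cancel[OF assms(3,2)]) (use that assms in \<open>auto simp: whisker\<close>)
  then obtain s where s: "s \<in> hom C B I" "s \<cdot> c = d"
    using cover_factor[OF assms(1,4)] by metis
  have B: "B \<in> Obj C" using assms hom_Obj by blast
  have "m \<cdot> s = Idt C B"
    by (rule cover_epi[OF assms(1)]) (use B s assms in \<open>auto simp: hom_def\<close>)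
  then show thesis using that s by blast
qed

lemma split_mono_iso:
  assumes "m \<in> hom C I B" "is_mono C m" "s \<in> hom C B I" "m \<cdot> s = Idt C B"
  shows "s \<cdot> m = Idt C I"
proof (rule mono_cancel[OF assms(2,1)])
  have "I \<in> Obj C" using assms hom_Obj by blast
  then show "Idt C I \<in> hom C I I" "s \<cdot> m \<in> hom C I I" "m \<cdot> (s \<cdot> m) = m \<cdot> Idt C I"
    using assms whisker[OF assms(4,3,1,1)] by (auto simp: hom_def)
qed

text \<open>A monomorphism with a section is invertible, so \<open>m q\<close> is a coequaliser of
  the same pair as \<open>q\<close>.\<close>

lemma cover_split_mono:
  assumes "q \<in> cover A I" "m \<in> hom C I B" "is_mono C m" "s \<in> hom C B I" "m \<cdot> s = Idt C B"
  shows "m \<cdot> q \<in> cover A B"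
proof -
  have sm: "s \<cdot> m = Idt C I" by (rule split_mono_iso[OF assms(2-5)])
  obtain u v where uv: "is_coequaliser C u v q"
    using assms unfolding regular_epi_def by blast
  have "is_coequaliser C u v (m \<cdot> q)"
    unfolding is_coequaliser_def
  proof (intro conjI ballI impI)
    have u: "u \<in> hom C (Dom C u) A" and v: "v \<in> hom C (Dom C u) A" and quv: "q \<cdot> u = q \<cdot> v"
      using uv assms unfolding is_coequaliser_def by (auto simp: hom_def)
    show "u \<in> Arr C" "v \<in> Arr C" "m \<cdot> q \<in> Arr C" "Dom C u = Dom C v" "Cod C u = Cod C v"
      "Dom C (m \<cdot> q) = Cod C u" "(m \<cdot> q) \<cdot> u = (m \<cdot> q) \<cdot> v"
      using uv assms unfolding is_coequaliser_def by (auto simp: hom_def)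
    fix h assume h: "h \<in> Arr C" "Dom C h = Cod C u \<and> h \<cdot> u = h \<cdot> v"
    define X where "X = Cod C h"
    have hA: "h \<in> hom C A X" using h u by (auto simp: hom_def X_def)
    obtain t where t: "t \<in> hom C I X" "t \<cdot> q = h"
      using coequaliser_factor[OF uv _ hA] h assms(1) by blast
    have ts: "t \<cdot> (s \<cdot> (m \<cdot> q)) = h"
    proof -
      have "s \<cdot> (m \<cdot> q) = q" using whisker[OF sm, of I B I q A] assms by (auto simp: hom_def)
      then show ?thesis using t by simp
    qed
    have "k = t \<cdot> s" if k: "k \<in> hom C B X" "k \<cdot> (m \<cdot> q) = h" for k
    proof -
      have "k \<cdot> m = t"
        by (rule cover_epi[OF assms(1)]) (use k t assms in \<open>auto simp: hom_def\<close>)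
      then have "(k \<cdot> m) \<cdot> s = t \<cdot> s" by simp
      then show ?thesis using k assms by (simp add: hom_def)
    qed
    moreover have "t \<cdot> s \<in> hom C B X" "(t \<cdot> s) \<cdot> (m \<cdot> q) = h" using t ts assms
      by (auto simp: hom_def)
    moreover have "Cod C (m \<cdot> q) = B" using assms by (auto simp: hom_def)
    ultimately show "\<exists>!k. k \<in> hom C (Cod C (m \<cdot> q)) (Cod C h) \<and> k \<cdot> (m \<cdot> q) = h"
      unfolding X_def[symmetric] by metis
  qed
  then show ?thesis using assms unfolding regular_epi_def by auto
qed

end

locale regular_cat = cat_struct C for C :: "('o, 'm) cat" (structure) +
  assumes regular: "regular_category C"
begin

lemma regular_epi_pullback: "is_pullback C f g P \<Longrightarrow> regular_epi C f \<Longrightarrow> regular_epi C (rgt P)"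
  using regular unfolding regular_category_def by (elim conjE) blast

lemma ex_coequaliser_kernel_pair: "is_pullback C f f K \<Longrightarrow> \<exists>q. is_coequaliser C (lft K) (rgt K) q"
  using regular unfolding regular_category_def by (elim conjE) blast

section \<open>Products and pullbacks as finite limits\<close>

lemma ex_product:
  assumes "X \<in> Obj C" "Y \<in> Obj C"
  shows "\<exists>P. is_product C X Y P"
proof -
  \<comment> \<open>The index category is discrete on two objects; every arrow is an identity and
    carries the name of its object.\<close>
  define J :: "(nat, nat) cat" where
    "J = \<lparr>Obj = {0, 1}, Arr = {0, 1}, Dom = id, Cod = id, Idt = id, Comp = (\<lambda>g f. f)\<rparr>"
  define F where "F = (\<lambda>j::nat. if j = 0 then X else Y)"
  have J: "Obj J = {0, 1}" "Arr J = {0, 1}" "Dom J = id" "Cod J = id" by (auto simp: J_def)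
  have "category J" unfolding category_def by (auto simp: J_def hom_def)
  then have "is_functor J C F (\<lambda>j. Idt C (F j))"
    using category assms unfolding is_functor_def by (auto simp: J_def F_def hom_def)
  then obtain L \<nu> where L: "is_limit J C F (\<lambda>j. Idt C (F j)) L \<nu>"
    using regular unfolding regular_category_def finitely_complete_def J
      by (metis J(1,2) finite.simps)
  have cone: "is_cone J C F (\<lambda>j. Idt C (F j)) T \<mu> \<longleftrightarrow> T \<in> Obj C \<and> \<mu> 0 \<in> hom C T X \<and> \<mu> 1 \<in> hom C T Y"
    for T \<mu>
    unfolding is_cone_def J by (auto simp: F_def hom_def)
  have "is_product C X Y (Span L (\<nu> 0) (\<nu> 1))"
    unfolding is_product_def
  proof (intro conjI ballI)
    show "is_span C X Y (Span L (\<nu> 0) (\<nu> 1))"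
      using L cone unfolding is_limit_def is_span_def by auto
    fix T a b assume "T \<in> Obj C" "a \<in> hom C T X" "b \<in> hom C T Y"
    then have "is_cone J C F (\<lambda>j. Idt C (F j)) T (\<lambda>j. if j = 0 then a else b)" by (simp add: cone)
    then have "\<exists>!h. h \<in> hom C T L \<and> (\<forall>j\<in>Obj J. \<nu> j \<cdot> h = (if j = 0 then a else b))"
      using L unfolding is_limit_def by blast
    then show "\<exists>!h. h \<in> hom C T (apex (Span L (\<nu> 0) (\<nu> 1))) \<and> lft (Span L (\<nu> 0) (\<nu> 1)) \<cdot> h = a \<and>
        rgt (Span L (\<nu> 0) (\<nu> 1)) \<cdot> h = b"
      by (simp add: J)
  qed (use assms in auto)
  then show ?thesis by blast
qed

lemma ex_pullback:
  assumes f: "f \<in> hom C X Z" and g: "g \<in> hom C Y Z"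
  shows "\<exists>P. is_pullback C f g P"
proof -
  \<comment> \<open>The cospan with legs 3 (from 0 to 2) and 4 (from 1 to 2); the arrows 0, 1, 2 are
    identities. One factor of a composite is always an identity, hence \<open>Comp\<close> returns
    the later factor if that is a leg and the earlier one otherwise.\<close>
  define J :: "(nat, nat) cat" where
    "J = \<lparr>Obj = {0, 1, 2}, Arr = {0, 1, 2, 3, 4},
      Dom = (\<lambda>u. if u = 3 then 0 else if u = 4 then 1 else u), Cod
        = (\<lambda>u. if u = 3 \<or> u = 4 then 2 else u),
      Idt = id, Comp = (\<lambda>v u. if v = 3 \<or> v = 4 then v else u)\<rparr>"
  define F where "F = (\<lambda>j::nat. if j = 0 then X else if j = 1 then Y else Z)"
  define \<phi> where "\<phi> = (\<lambda>u::nat. if u = 3 then f else if u = 4 then g else Idt C (F u))"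
  have obj: "X \<in> Obj C" "Y \<in> Obj C" "Z \<in> Obj C" using f g hom_Obj by blast+
  have J: "Obj J = {0, 1, 2}" "Arr J = {0, 1, 2, 3, 4}" by (auto simp: J_def)
  have "category J" unfolding category_def by (auto simp: J_def hom_def)
  then have "is_functor J C F \<phi>"
    using category obj f g unfolding is_functor_def by (auto simp: J_def F_def \<phi>_def hom_def)
  moreover have "finite (Obj J)" "finite (Arr J)" by (auto simp: J)
  ultimately obtain L \<nu> where L: "is_limit J C F \<phi> L \<nu>"
    using regular unfolding regular_category_def finitely_complete_def by metis
  \<comment> \<open>The component at 2 is determined by the one at 0, so a cone is the same as a
    commuting square.\<close>
  have cone: "is_cone J C F \<phi> T \<mu> \<longleftrightarrow> T \<in> Obj C \<and> \<mu> 0 \<in> hom C T X \<and> \<mu> 1 \<in> hom C T Y \<and>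
      f \<cdot> \<mu> 0 = \<mu> 2 \<and> g \<cdot> \<mu> 1 = \<mu> 2" for T \<mu>
  proof -
    have "\<mu> 2 \<in> hom C T Z \<and> Idt C Z \<cdot> \<mu> 2 = \<mu> 2" if "\<mu> 0 \<in> hom C T X" "f \<cdot> \<mu> 0 = \<mu> 2"
      using comp_hom[OF f that(1)] that(2) by (auto simp: hom_def)
    then show ?thesis
      unfolding is_cone_def J using f g by (auto simp: J_def F_def \<phi>_def hom_def)
  qed
  let ?P = "Span L (\<nu> 0) (\<nu> 1)"
  have L0: "L \<in> Obj C" "\<nu> 0 \<in> hom C L X" "\<nu> 1 \<in> hom C L Y" "f \<cdot> \<nu> 0 = \<nu> 2" "g \<cdot> \<nu> 1 = \<nu> 2"
    using L cone unfolding is_limit_def by auto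
  have "is_pullback C f g ?P"
    unfolding is_pullback_def
  proof (intro conjI ballI impI)
    show "is_span C (Dom C f) (Dom C g) ?P" "f \<cdot> lft ?P = g \<cdot> rgt ?P"
      using L0 f g unfolding is_span_def by (auto simp: hom_def)
    fix T a b
    assume ab: "T \<in> Obj C" "a \<in> hom C T (Dom C f)" "b \<in> hom C T (Dom C g)" "f \<cdot> a = g \<cdot> b"
    define \<mu> where "\<mu> = (\<lambda>j::nat. if j = 0 then a else if j = 1 then b else f \<cdot> a)"
    have "is_cone J C F \<phi> T \<mu>"
      unfolding cone using ab f g by (auto simp: \<mu>_def hom_def)
    then have "\<exists>!h. h \<in> hom C T L \<and> (\<forall>j\<in>Obj J. \<nu> j \<cdot> h = \<mu> j)"
      using L unfolding is_limit_def by blast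
    moreover have "(\<forall>j\<in>Obj J. \<nu> j \<cdot> h = \<mu> j) \<longleftrightarrow> \<nu> 0 \<cdot> h = a \<and> \<nu> 1 \<cdot> h = b"
      if "h \<in> hom C T L" for h
      using whisker[OF L0(4) L0(2) f that] by (auto simp: J \<mu>_def)
    ultimately show "\<exists>!h. h \<in> hom C T (apex ?P) \<and> lft ?P \<cdot> h = a \<and> rgt ?P \<cdot> h = b"
      by (simp cong: conj_cong)
  qed (use f g in \<open>auto simp: hom_def\<close>)
  then show ?thesis by blast
qed

lemma pb:
  assumes "f \<in> hom C X Z" "g \<in> hom C Y Z"
  shows "is_pullback C f g (pb C f g)"
  unfolding pb_def using ex_pullback[OF assms] by (rule someI_ex)

lemma pb_hom:
  assumes "f \<in> hom C X Z" "g \<in> hom C Y Z"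
  shows "apex (pb C f g) \<in> Obj C" "lft (pb C f g) \<in> hom C (apex (pb C f g)) X"
    "rgt (pb C f g) \<in> hom C (apex (pb C f g)) Y" "f \<cdot> lft (pb C f g) = g \<cdot> rgt (pb C f g)"
  using pb[OF assms] assms unfolding is_pullback_def is_span_def by (auto simp: hom_def)

lemma pb_ex1:
  assumes "f \<in> hom C X Z" "g \<in> hom C Y Z" "a \<in> hom C T X" "b \<in> hom C T Y" "f \<cdot> a = g \<cdot> b"
  shows "\<exists>!h. h \<in> hom C T (apex (pb C f g)) \<and> lft (pb C f g) \<cdot> h = a \<and> rgt (pb C f g) \<cdot> h = b"
proof -
  have "T \<in> Obj C" using assms hom_Obj by blast
  moreover have "Dom C f = X" "Dom C g = Y" using assms by (auto simp: hom_def)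
  ultimately show ?thesis
    using pb[OF assms(1,2)] assms(3-5) unfolding is_pullback_def by blast
qed

lemma pb_elem:
  assumes "f \<in> hom C X Z" "g \<in> hom C Y Z" "a \<in> hom C T X" "b \<in> hom C T Y" "f \<cdot> a = g \<cdot> b"
  obtains h where "h \<in> hom C T (apex (pb C f g))" "lft (pb C f g) \<cdot> h = a" "rgt (pb C f g) \<cdot> h = b"
  using pb_ex1[OF assms] by blast

lemma pb_joint_mono:
  assumes f: "f \<in> hom C X Z" and g: "g \<in> hom C Y Z"
    and h: "h \<in> hom C T (apex (pb C f g))" and k: "k \<in> hom C T (apex (pb C f g))"
    and eq: "lft (pb C f g) \<cdot> h = lft (pb C f g) \<cdot> k" "rgt (pb C f g) \<cdot> h = rgt (pb C f g) \<cdot> k"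
  shows "h = k"
proof -
  note P = pb_hom[OF f g]
  have "f \<cdot> (lft (pb C f g) \<cdot> k) = g \<cdot> (rgt (pb C f g) \<cdot> k)"
    using whisker[OF P(4) P(2) f k] P k f g by (simp add: hom_def)
  then have "\<exists>!h. h \<in> hom C T (apex (pb C f g)) \<and> lft (pb C f g) \<cdot> h = lft (pb C f g) \<cdot> k \<and>
      rgt (pb C f g) \<cdot> h = rgt (pb C f g) \<cdot> k"
    using P k by (intro pb_ex1[OF f g]) auto
  then show ?thesis using h k eq by blast
qed

lemma prd:
  assumes "X \<in> Obj C" "Y \<in> Obj C"
  shows "is_product C X Y (prd C X Y)"
  unfolding prd_def using ex_product[OF assms] by (rule someI_ex)

lemma prd_hom:
  assumes "X \<in> Obj C" "Y \<in> Obj C"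
  shows "apex (prd C X Y) \<in> Obj C" "lft (prd C X Y) \<in> hom C (apex (prd C X Y)) X"
    "rgt (prd C X Y) \<in> hom C (apex (prd C X Y)) Y"
  using prd[OF assms] unfolding is_product_def is_span_def by auto

lemma prd_joint_mono:
  assumes "X \<in> Obj C" "Y \<in> Obj C" "h \<in> hom C T (apex (prd C X Y))" "k \<in> hom C T (apex (prd C X Y))"
    "lft (prd C X Y) \<cdot> h = lft (prd C X Y) \<cdot> k" "rgt (prd C X Y) \<cdot> h = rgt (prd C X Y) \<cdot> k"
  shows "h = k"
proof -
  have "T \<in> Obj C" using assms hom_Obj by blast
  moreover have "lft (prd C X Y) \<cdot> k \<in> hom C T X" "rgt (prd C X Y) \<cdot> k \<in> hom C T Y"
    using prd_hom[OF assms(1,2)] assms(4) by blast+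
  ultimately have "\<exists>!h. h \<in> hom C T (apex (prd C X Y)) \<and> lft (prd C X Y) \<cdot> h = lft (prd C X Y) \<cdot> k \<and>
      rgt (prd C X Y) \<cdot> h = rgt (prd C X Y) \<cdot> k"
    using prd[OF assms(1,2)] unfolding is_product_def by blast
  then show ?thesis using assms by blast
qed

lemma pairing:
  assumes "a \<in> hom C T X" "b \<in> hom C T Y"
  shows "pairing C a b \<in> hom C T (apex (prd C X Y))"
    "lft (prd C X Y) \<cdot> pairing C a b = a" "rgt (prd C X Y) \<cdot> pairing C a b = b"
proof -
  have obj: "T \<in> Obj C" "X \<in> Obj C" "Y \<in> Obj C" using assms hom_Obj by blast+
  have eq: "Dom C a = T" "Cod C a = X" "Cod C b = Y" using assms by (auto simp: hom_def)
  have "\<exists>!h. h \<in> hom C T (apex (prd C X Y)) \<and> lft (prd C X Y) \<cdot> h = a \<and> rgt (prd C X Y) \<cdot> h = b"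
    using prd[OF obj(2,3)] obj assms unfolding is_product_def by blast
  from theI'[OF this] show "pairing C a b \<in> hom C T (apex (prd C X Y))"
    "lft (prd C X Y) \<cdot> pairing C a b = a" "rgt (prd C X Y) \<cdot> pairing C a b = b"
    by (auto simp: pairing_def Let_def eq)
qed

text \<open>The kernel of a pairing is the intersection of the two kernels; in this way a
  conjunction of equations becomes a single kernel relation.\<close>

lemma pairing_eq_iff:
  assumes a: "a \<in> hom C A X" and b: "b \<in> hom C A Y" and u: "u \<in> hom C T A" and v: "v \<in> hom C T A"
  shows "pairing C a b \<cdot> u = pairing C a b \<cdot> v \<longleftrightarrow> a \<cdot> u = a \<cdot> v \<and> b \<cdot> u = b \<cdot> v"
proof -
  have obj: "X \<in> Obj C" "Y \<in> Obj C" using assms hom_Obj by blast+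
  note p = pairing[OF a b] and P = prd_hom[OF obj]
  note w = whisker[OF p(2) p(1) P(2)] whisker[OF p(3) p(1) P(3)]
  show ?thesis
  proof
    assume "pairing C a b \<cdot> u = pairing C a b \<cdot> v"
    then show "a \<cdot> u = a \<cdot> v \<and> b \<cdot> u = b \<cdot> v" using w u v by metis
  next
    assume "a \<cdot> u = a \<cdot> v \<and> b \<cdot> u = b \<cdot> v"
    then show "pairing C a b \<cdot> u = pairing C a b \<cdot> v"
      using w[OF u] w[OF v] comp_hom[OF p(1) u] comp_hom[OF p(1) v] prd_joint_mono[OF obj] by metis
  qed
qed

text \<open>Stability under pullback makes regular epimorphisms locally surjective: pulling
  \<open>e\<close> back along \<open>x\<close> gives both the cover of \<open>T\<close> and the
  lift.\<close>

lemma cover_lift: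
  assumes "e \<in> cover A B" "x \<in> hom C T B"
  obtains T' c y where "c \<in> cover T' T" "y \<in> hom C T' A" "e \<cdot> y = x \<cdot> c"
proof -
  have e: "e \<in> hom C A B" using assms by simp
  have "regular_epi C (rgt (pb C e x))"
    using regular_epi_pullback[OF pb[OF e assms(2)]] assms(1) by simp
  then show thesis
    by (intro that[of "rgt (pb C e x)" "apex (pb C e x)" "lft (pb C e x)"])
      (simp_all add: pb_hom[OF e assms(2)])
qed

text \<open>The coequaliser \<open>q\<close> of the kernel pair of \<open>f\<close> is the first
  factor; the work lies in proving the second factor \<open>m\<close> monic.\<close>

lemma ex_image:
  assumes f: "f \<in> hom C X Y"
  obtains I e m where "e \<in> cover X I" "m \<in> hom C I Y" "is_mono C m" "f = m \<cdot> e"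
proof -
  let ?K = "pb C f f"
  note K = pb_hom[OF f f]
  obtain q where q: "is_coequaliser C (lft ?K) (rgt ?K) q"
    using ex_coequaliser_kernel_pair[OF pb[OF f f]] by blast
  define I where "I = Cod C q"
  have qh: "q \<in> hom C X I"
    using q K(2) unfolding is_coequaliser_def I_def by (auto simp: hom_def)
  then have qc: "q \<in> cover X I" using q unfolding regular_epi_def by blast
  note qK = coequaliserD(3)[OF q qh]
  obtain m where m: "m \<in> hom C I Y" "m \<cdot> q = f"
    using coequaliser_factor[OF q qh f K(4)] by blast
  have "is_mono C m"
    unfolding is_mono_def
  proof (intro conjI ballI impI)
    show "m \<in> Arr C" using m by (simp add: hom_def)
    fix T a b
    assume "a \<in> hom C T (Dom C m)" "b \<in> hom C T (Dom C m)" and ab: "m \<cdot> a = m \<cdot> b"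
    then have a: "a \<in> hom C T I" and b: "b \<in> hom C T I" using m by (auto simp: hom_def)
    \<comment> \<open>Lift \<open>a\<close> and \<open>b\<close> along \<open>q\<close> over a
      common cover. The lifts have equal images under \<open>f\<close>, so they form an element of
      the kernel pair, which \<open>q\<close> collapses.\<close>
    obtain T1 c x where c: "c \<in> cover T1 T" "x \<in> hom C T1 X" "q \<cdot> x = a \<cdot> c"
      using cover_lift[OF qc a] by blast
    have "b \<cdot> c \<in> hom C T1 I" using b c by blast
    then obtain T2 d y where d: "d \<in> cover T2 T1" "y \<in> hom C T2 X" "q \<cdot> y = (b \<cdot> c) \<cdot> d"
      using cover_lift[OF qc] by blast
    have ch: "c \<in> hom C T1 T" "d \<in> hom C T2 T1" using c d by auto
    have xd: "q \<cdot> (x \<cdot> d) = a \<cdot> (c \<cdot> d)"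
      using whisker[OF c(3) c(2) qh ch(2)] a ch by (simp add: hom_assoc)
    have yd: "q \<cdot> y = b \<cdot> (c \<cdot> d)" using d(3) b ch by (simp add: hom_assoc)
    have xdh: "x \<cdot> d \<in> hom C T2 X" and cdh: "c \<cdot> d \<in> hom C T2 T" using c d by auto
    have "f \<cdot> (x \<cdot> d) = m \<cdot> (b \<cdot> (c \<cdot> d))"
      using whisker[OF m(2) qh m(1) xdh] whisker[OF refl a m(1) cdh] whisker[OF refl b m(1) cdh]
      by (simp add: xd ab)
    also have "\<dots> = f \<cdot> y" using whisker[OF m(2) qh m(1) d(2)] by (simp add: yd)
    finally have "f \<cdot> (x \<cdot> d) = f \<cdot> y" .
    then obtain h where h: "h \<in> hom C T2 (apex ?K)" "lft ?K \<cdot> h = x \<cdot> d" "rgt ?K \<cdot> h = y"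
      using pb_elem[OF f f xdh d(2)] by blast
    have "q \<cdot> (x \<cdot> d) = q \<cdot> y"
      using whisker[OF qK K(2) qh h(1)] h K qh by (simp add: hom_assoc)
    then have "(a \<cdot> c) \<cdot> d = (b \<cdot> c) \<cdot> d" using xd yd a b ch by (simp add: hom_assoc)
    then have "a \<cdot> c = b \<cdot> c" using cover_epi[OF d(1)] a b ch by blast
    then show "a = b" using cover_epi[OF c(1)] a b by blast
  qed
  then show thesis using that qc m by blast
qed

text \<open>The converse of local lifting: the cover \<open>c\<close> also factors through the monic
  part of the image factorisation of \<open>f\<close>, which therefore has a section.\<close>

lemma cover_if_local_section:
  assumes f: "f \<in> hom C A B" and c: "c \<in> cover T B" and y: "y \<in> hom C T A" "f \<cdot> y = c"
  shows "f \<in> cover A B"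
proof -
  obtain I e m where I: "e \<in> cover A I" "m \<in> hom C I B" "is_mono C m" "f = m \<cdot> e"
    using ex_image[OF f] by blast
  have "e \<cdot> y \<in> hom C T I" "m \<cdot> (e \<cdot> y) = c" using I y by (auto simp: hom_def)
  then obtain s where "s \<in> hom C B I" "m \<cdot> s = Idt C B"
    using cover_through_mono[OF c I(2,3)] by blast
  then show ?thesis using cover_split_mono[OF I(1-3)] I(4) by blast
qed

text \<open>In the image factorisation \<open>m e\<close> of \<open>g h\<close>, monicity of
  \<open>m\<close> lets \<open>e\<close> descend along \<open>h\<close> to some \<open>d\<close>
  with \<open>m d = g\<close>; since the cover \<open>g\<close> factors through \<open>m\<close>,
  the latter splits.\<close>

lemma cover_comp:
  assumes h: "h \<in> cover X Y" and g: "g \<in> cover Y Z"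
  shows "g \<cdot> h \<in> cover X Z"
proof -
  have gh: "g \<in> hom C Y Z" "h \<in> hom C X Y" using assms by auto
  obtain I e m where I: "e \<in> cover X I" "m \<in> hom C I Z" "is_mono C m" "g \<cdot> h = m \<cdot> e"
    using ex_image[OF comp_hom[OF gh]] by blast
  have eh: "e \<in> hom C X I" using I by simp
  have "e \<cdot> u = e \<cdot> v" if "u \<in> hom C U X" "v \<in> hom C U X" "h \<cdot> u = h \<cdot> v" for U u v
  proof (rule mono_cancel[OF I(3,2)])
    show "e \<cdot> u \<in> hom C U I" "e \<cdot> v \<in> hom C U I" using that eh by auto
    show "m \<cdot> (e \<cdot> u) = m \<cdot> (e \<cdot> v)"
      using whisker[OF I(4) gh(2,1)] hom_assoc[OF _ eh I(2)] that by metis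
  qed
  then obtain d where d: "d \<in> hom C Y I" "d \<cdot> h = e" using cover_factor[OF h eh] by metis
  have "m \<cdot> d = g"
    by (rule cover_epi[OF h]) (use d I gh in \<open>auto simp: hom_assoc\<close>)
  then obtain s where "s \<in> hom C Z I" "m \<cdot> s = Idt C Z"
    using cover_through_mono[OF g I(2,3) d(1)] by blast
  then show ?thesis using cover_split_mono[OF I(1-3)] I(4) by metis
qed

lemma Idt_cover: "X \<in> Obj C \<Longrightarrow> Idt C X \<in> cover X X"
proof -
  assume X: "X \<in> Obj C"
  have "is_coequaliser C (Idt C X) (Idt C X) (Idt C X)"
    unfolding is_coequaliser_def using X by (auto simp: hom_def)
  then show ?thesis using X unfolding regular_epi_def by auto
qed

end

section \<open>Relations through generalized elements\<close>

context regular_cat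
begin

lemma relation_span:
  assumes "relation C X Y R"
  shows "X \<in> Obj C" "Y \<in> Obj C" "apex R \<in> Obj C" "lft R \<in> hom C (apex R) X"
    "rgt R \<in> hom C (apex R) Y"
  using assms unfolding relation_def is_span_def by auto

lemma relation_joint_mono:
  assumes R: "relation C X Y R" and h: "h \<in> hom C T (apex R)" and k: "k \<in> hom C T (apex R)"
    and eq: "lft R \<cdot> h = lft R \<cdot> k" "rgt R \<cdot> h = rgt R \<cdot> k"
  shows "h = k"
proof -
  note s = relation_span[OF R]
  have "is_mono C (pairing C (lft R) (rgt R))" using R unfolding relation_def by simp
  then show ?thesis
    by (rule mono_cancel[OF _ pairing(1)[OF s(4,5)] h k])
      (simp add: pairing_eq_iff[OF s(4,5) h k] eq)
qed

lemma relationI: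
  assumes l: "l \<in> hom C A X" and r: "r \<in> hom C A Y"
    and joint: "\<And>T h k. h \<in> hom C T A \<Longrightarrow> k \<in> hom C T A \<Longrightarrow> l \<cdot> h = l \<cdot> k \<Longrightarrow> r \<cdot> h = r \<cdot> k \<Longrightarrow> h = k"
  shows "relation C X Y (Span A l r)"
proof -
  have p: "pairing C l r \<in> Arr C" "Dom C (pairing C l r) = A"
    using pairing(1)[OF l r] by (auto simp: hom_def)
  have "is_mono C (pairing C l r)"
    unfolding is_mono_def p(2) using p(1) joint pairing_eq_iff[OF l r] by metis
  then show ?thesis
    unfolding relation_def is_span_def using l r hom_Obj[OF l] hom_Obj[OF r] by simp
qed

lemma relates_iff:
  assumes "x \<in> hom C T X"
  shows "relates C R x y \<longleftrightarrow> (\<exists>r \<in> hom C T (apex R). lft R \<cdot> r = x \<and> rgt R \<cdot> r = y)"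
  using assms unfolding relates_def by (simp add: hom_def)

lemma relatesI:
  assumes "relation C X Y R" "r \<in> hom C T (apex R)"
  shows "relates C R (lft R \<cdot> r) (rgt R \<cdot> r)"
  using relates_iff[OF comp_hom[OF relation_span(4)[OF assms(1)] assms(2)]] assms(2) by blast

lemma relates_comp:
  assumes R: "relation C X Y R" and xy: "relates C R x y" and x: "x \<in> hom C T X"
    and c: "c \<in> hom C S T"
  shows "relates C R (x \<cdot> c) (y \<cdot> c)"
proof -
  obtain r where r: "r \<in> hom C T (apex R)" "lft R \<cdot> r = x" "rgt R \<cdot> r = y"
    using xy relates_iff[OF x] by blast
  show ?thesis
    using relatesI[OF R comp_hom[OF r(1) c]] whisker[OF r(2) r(1) relation_span(4)[OF R] c]
      whisker[OF r(3) r(1) relation_span(5)[OF R] c] by simp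
qed

text \<open>The witness over \<open>S\<close> is compatible with the kernel of \<open>c\<close>
  because the projections of \<open>R\<close> are jointly monic, hence it factors through
  \<open>c\<close>. This is what permits relations to be checked after passing to a cover.\<close>

lemma relates_local:
  assumes R: "relation C X Y R" and x: "x \<in> hom C T X" and y: "y \<in> hom C T Y" and c: "c \<in> cover S T"
    and xy: "relates C R (x \<cdot> c) (y \<cdot> c)"
  shows "relates C R x y"
proof -
  note s = relation_span[OF R]
  have ch: "c \<in> hom C S T" using c by simp
  obtain r where r: "r \<in> hom C S (apex R)" "lft R \<cdot> r = x \<cdot> c" "rgt R \<cdot> r = y \<cdot> c"
    using xy relates_iff[OF comp_hom[OF x ch]] by blast
  have "r \<cdot> u = r \<cdot> v" if u: "u \<in> hom C U S" and v: "v \<in> hom C U S" and cuv: "c \<cdot> u = c \<cdot> v" for U u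
    v
  proof (rule relation_joint_mono[OF R])
    show "r \<cdot> u \<in> hom C U (apex R)" "r \<cdot> v \<in> hom C U (apex R)" using r u v by auto
    show "lft R \<cdot> (r \<cdot> u) = lft R \<cdot> (r \<cdot> v)"
      using whisker[OF r(2) r(1) s(4) u] whisker[OF r(2) r(1) s(4) v] hom_assoc[OF u ch x]
        hom_assoc[OF v ch x] cuv
      by simp
    show "rgt R \<cdot> (r \<cdot> u) = rgt R \<cdot> (r \<cdot> v)"
      using whisker[OF r(3) r(1) s(5) u] whisker[OF r(3) r(1) s(5) v] hom_assoc[OF u ch y]
        hom_assoc[OF v ch y] cuv
      by simp
  qed
  then obtain k where k: "k \<in> hom C T (apex R)" "k \<cdot> c = r"
    using cover_factor[OF c r(1)] by metis
  have "lft R \<cdot> k = x"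
    by (rule cover_epi[OF c comp_hom[OF s(4) k(1)] x]) (use hom_assoc[OF ch k(1) s(4)] k r in simp)
  moreover have "rgt R \<cdot> k = y"
    by (rule cover_epi[OF c comp_hom[OF s(5) k(1)] y]) (use hom_assoc[OF ch k(1) s(5)] k r in simp)
  ultimately show ?thesis using relates_iff[OF x] k(1) by blast
qed

section \<open>Equivalence relations on generalized elements\<close>

lemma eqrel_relation: "equivalence_rel C X R \<Longrightarrow> relation C X X R"
  unfolding equivalence_rel_def by simp

lemma eqrel_refl:
  assumes R: "equivalence_rel C X R" and x: "x \<in> hom C T X"
  shows "relates C R x x"
proof -
  obtain d where d: "d \<in> hom C X (apex R)" "lft R \<cdot> d = Idt C X" "rgt R \<cdot> d = Idt C X"
    using R unfolding equivalence_rel_def internally_reflexive_def by blast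
  note s = relation_span[OF eqrel_relation[OF R]]
  have "Idt C X \<cdot> x = x" using x by (simp add: hom_def)
  then show ?thesis
    using relatesI[OF eqrel_relation[OF R] comp_hom[OF d(1) x]] whisker[OF d(2) d(1) s(4) x]
      whisker[OF d(3) d(1) s(5) x]
    by simp
qed

lemma eqrel_sym:
  assumes R: "equivalence_rel C X R" and x: "x \<in> hom C T X" and xy: "relates C R x y"
  shows "relates C R y x"
proof -
  obtain d where d: "d \<in> hom C (apex R) (apex R)" "lft R \<cdot> d = rgt R" "rgt R \<cdot> d = lft R"
    using R unfolding equivalence_rel_def internally_symmetric_def by blast
  note s = relation_span[OF eqrel_relation[OF R]]
  obtain r where r: "r \<in> hom C T (apex R)" "lft R \<cdot> r = x" "rgt R \<cdot> r = y"
    using xy relates_iff[OF x] by blast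
  show ?thesis
    using relatesI[OF eqrel_relation[OF R] comp_hom[OF d(1) r(1)]] whisker[OF d(2) d(1) s(4) r(1)]
      whisker[OF d(3) d(1) s(5) r(1)] r by simp
qed

lemma eqrel_trans:
  assumes R: "equivalence_rel C X R" and x: "x \<in> hom C T X" and y: "y \<in> hom C T X"
    and xy: "relates C R x y" and yz: "relates C R y z"
  shows "relates C R x z"
proof -
  note s = relation_span[OF eqrel_relation[OF R]]
  let ?P = "pb C (rgt R) (lft R)"
  note P = pb_hom[OF s(5,4)]
  obtain t where t: "t \<in> hom C (apex ?P) (apex R)" "lft R \<cdot> t = lft R \<cdot> lft ?P"
    "rgt R \<cdot> t = rgt R \<cdot> rgt ?P"
    using R unfolding equivalence_rel_def internally_transitive_def Let_def by blast
  obtain r where r: "r \<in> hom C T (apex R)" "lft R \<cdot> r = x" "rgt R \<cdot> r = y"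
    using xy relates_iff[OF x] by blast
  obtain r' where r': "r' \<in> hom C T (apex R)" "lft R \<cdot> r' = y" "rgt R \<cdot> r' = z"
    using yz relates_iff[OF y] by blast
  obtain h where h: "h \<in> hom C T (apex ?P)" "lft ?P \<cdot> h = r" "rgt ?P \<cdot> h = r'"
    using pb_elem[OF s(5,4) r(1) r'(1)] r(3) r'(2) by auto
  show ?thesis
    using relatesI[OF eqrel_relation[OF R] comp_hom[OF t(1) h(1)]] whisker[OF t(2) t(1) s(4) h(1)]
      whisker[OF t(3) t(1) s(5) h(1)] hom_assoc[OF h(1) P(2) s(4)] hom_assoc[OF h(1) P(3) s(5)] h r
        r'
    by simp
qed

text \<open>Each internal axiom is the elementwise one at a generic element: the identity of
  \<open>X\<close> for reflexivity, the two projections of \<open>R\<close> for symmetry, the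
  projections of the pullback for transitivity.\<close>

lemma equivalence_relI:
  assumes R: "relation C X X R"
    and refl: "relates C R (Idt C X) (Idt C X)"
    and sym: "\<And>T x y. x \<in> hom C T X \<Longrightarrow> y \<in> hom C T X \<Longrightarrow> relates C R x y \<Longrightarrow> relates C R y x"
    and trans: "\<And>T x y z. x \<in> hom C T X \<Longrightarrow> y \<in> hom C T X \<Longrightarrow> z \<in> hom C T X \<Longrightarrow>
      relates C R x y \<Longrightarrow> relates C R y z \<Longrightarrow> relates C R x z"
  shows "equivalence_rel C X R"
proof -
  note s = relation_span[OF R]
  have "internally_reflexive C X R"
    unfolding internally_reflexive_def using refl relates_iff[OF Idt_hom[OF s(1)]] by blast
  moreover have "internally_symmetric C R"
  proof -
    have "relates C R (lft R) (rgt R)"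
      using relatesI[OF R Idt_hom[OF s(3)]] s(4,5) by (simp add: hom_def)
    then have "relates C R (rgt R) (lft R)" using sym s by blast
    then show ?thesis unfolding internally_symmetric_def using relates_iff[OF s(5)] by blast
  qed
  moreover have "internally_transitive C R"
  proof -
    let ?P = "pb C (rgt R) (lft R)"
    note P = pb_hom[OF s(5,4)]
    have m: "lft R \<cdot> lft ?P \<in> hom C (apex ?P) X" "rgt R \<cdot> lft ?P \<in> hom C (apex ?P) X"
      "rgt R \<cdot> rgt ?P \<in> hom C (apex ?P) X"
      using P s by blast+
    have "relates C R (lft R \<cdot> lft ?P) (rgt R \<cdot> rgt ?P)"
      by (rule trans[OF m relatesI[OF R P(2)]]) (use relatesI[OF R P(3)] P(4) in simp)
    then show ?thesis
      unfolding internally_transitive_def Let_def using relates_iff[OF m(1)] by blast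
  qed
  ultimately show ?thesis unfolding equivalence_rel_def using R by simp
qed

section \<open>Images, composites, kernel relations and inverse images\<close>

lemma image:
  assumes f: "f \<in> hom C X Y"
  shows "\<exists>e \<in> cover X (Dom C (im C f)). im C f \<in> hom C (Dom C (im C f)) Y \<and> is_mono C (im C f) \<and> f = im C f \<cdot> e"
proof -
  obtain I e m where I: "e \<in> cover X I" "m \<in> hom C I Y" "is_mono C m" "f = m \<cdot> e"
    using ex_image[OF f] .
  have "is_image C f m" unfolding is_image_def using I by (auto simp: hom_def)
  then have "is_image C f (im C f)" unfolding im_def by (rule someI)
  then obtain e' where e': "is_mono C (im C f)" "regular_epi C e'" "Cod C e' = Dom C (im C f)"
    "f = im C f \<cdot> e'"
    unfolding is_image_def by blast
  have a: "e' \<in> Arr C" "im C f \<in> Arr C" using e' unfolding regular_epi_def is_coequaliser_def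
    is_mono_def by auto
  have "Dom C (im C f \<cdot> e') = Dom C e'" "Cod C (im C f \<cdot> e') = Cod C (im C f)" using a e'(3)
    by simp_all
  then have "Dom C e' = X" "Cod C (im C f) = Y" using f e'(4) by (simp_all add: hom_def)
  then show ?thesis using a e' by (intro bexI[of _ e']) (auto simp: hom_def)
qed

text \<open>The equation for \<open>R\<close> has the shape to which \<open>rel_comp\<close>
  unfolds; instantiated by reflexivity of equality it also produces direct images along an
  arrow.\<close>

lemma image_relation:
  assumes a: "a \<in> hom C A X" and b: "b \<in> hom C A Y"
    and R: "R = (let m = im C (pairing C a b) in Span (Dom C m) (lft (prd C X Y) \<cdot> m) (rgt (prd C X Y) \<cdot> m))"
  obtains e where "relation C X Y R" "e \<in> cover A (apex R)" "lft R \<cdot> e = a" "rgt R \<cdot> e = b"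
proof -
  have obj: "X \<in> Obj C" "Y \<in> Obj C" using hom_Obj a b by blast+
  note P = prd_hom[OF obj] and p = pairing[OF a b]
  define m where "m = im C (pairing C a b)"
  obtain e where e: "e \<in> cover A (Dom C m)" and m: "m \<in> hom C (Dom C m) (apex (prd C X Y))"
    "is_mono C m"
    and pe: "pairing C a b = m \<cdot> e"
    using image[OF p(1)] unfolding m_def by blast
  have R': "R = Span (Dom C m) (lft (prd C X Y) \<cdot> m) (rgt (prd C X Y) \<cdot> m)"
    by (simp add: R m_def Let_def)
  have "relation C X Y R"
    unfolding R'
  proof (rule relationI)
    show "lft (prd C X Y) \<cdot> m \<in> hom C (Dom C m) X" "rgt (prd C X Y) \<cdot> m \<in> hom C (Dom C m) Y"
      using P m by blast+
    fix T h k
    assume h: "h \<in> hom C T (Dom C m)" and k: "k \<in> hom C T (Dom C m)"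
      and "(lft (prd C X Y) \<cdot> m) \<cdot> h = (lft (prd C X Y) \<cdot> m) \<cdot> k"
      and "(rgt (prd C X Y) \<cdot> m) \<cdot> h = (rgt (prd C X Y) \<cdot> m) \<cdot> k"
    then have "m \<cdot> h = m \<cdot> k"
      using hom_assoc[OF h m(1)] hom_assoc[OF k m(1)] P
        prd_joint_mono[OF obj comp_hom[OF m(1) h] comp_hom[OF m(1) k]]
      by simp
    then show "h = k" by (rule mono_cancel[OF m(2,1) h k])
  qed
  moreover have "lft R \<cdot> e = a" "rgt R \<cdot> e = b"
    using p(2,3) hom_assoc[of e A "Dom C m", OF _ m(1)] P e unfolding R' pe by simp_all
  ultimately show thesis using that e R' by simp
qed

text \<open>Forward, the witness is lifted along the cover \<open>e\<close>; backward, membership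
  holds over the cover \<open>c\<close> and descends. Middle terms of composites and preimages for
  direct images are both read off from this.\<close>

lemma relates_image_iff:
  assumes R: "relation C X Y R" and e: "e \<in> cover A (apex R)" and x: "x \<in> hom C T X"
    and y: "y \<in> hom C T Y"
  shows "relates C R x y \<longleftrightarrow>
    (\<exists>S c t. c \<in> cover S T \<and> t \<in> hom C S A \<and> (lft R \<cdot> e) \<cdot> t = x \<cdot> c \<and> (rgt R \<cdot> e) \<cdot> t = y \<cdot> c)"
proof
  note s = relation_span[OF R]
  have eh: "e \<in> hom C A (apex R)" using e by simp
  assume "relates C R x y"
  then obtain r where r: "r \<in> hom C T (apex R)" "lft R \<cdot> r = x" "rgt R \<cdot> r = y"
    using relates_iff[OF x] by blast
  obtain S c t where c: "c \<in> cover S T" "t \<in> hom C S A" "e \<cdot> t = r \<cdot> c"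
    using cover_lift[OF e r(1)] .
  have ch: "c \<in> hom C S T" using c by simp
  have "(lft R \<cdot> e) \<cdot> t = x \<cdot> c" "(rgt R \<cdot> e) \<cdot> t = y \<cdot> c"
    using hom_assoc[OF c(2) eh] s c(3) whisker[OF r(2,1) s(4) ch] whisker[OF r(3,1) s(5) ch] by auto
  then show "\<exists>S c t. c \<in> cover S T \<and> t \<in> hom C S A \<and> (lft R \<cdot> e) \<cdot> t = x \<cdot> c \<and> (rgt R \<cdot> e) \<cdot> t = y \<cdot> c"
    using c by blast
next
  note s = relation_span[OF R]
  have eh: "e \<in> hom C A (apex R)" using e by simp
  assume "\<exists>S c t. c \<in> cover S T \<and> t \<in> hom C S A \<and> (lft R \<cdot> e) \<cdot> t = x \<cdot> c \<and> (rgt R \<cdot> e) \<cdot> t = y \<cdot> c"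
  then obtain S c t where c: "c \<in> cover S T" and t: "t \<in> hom C S A" "(lft R \<cdot> e) \<cdot> t = x \<cdot> c"
    "(rgt R \<cdot> e) \<cdot> t = y \<cdot> c"
    by blast
  have "relates C R (x \<cdot> c) (y \<cdot> c)"
    using relatesI[OF R comp_hom[OF eh t(1)]] hom_assoc[OF t(1) eh s(4)] hom_assoc[OF t(1) eh s(5)]
      t by simp
  then show "relates C R x y" by (rule relates_local[OF R x y c])
qed

text \<open>A composite quantifies existentially over the middle term, and existence in a regular
  category means existence over a cover.\<close>

lemma rel_comp:
  assumes R: "relation C X Y R" and S: "relation C Y Z S"
  shows "relation C X Z (rel_comp C S R)"
    "x \<in> hom C T X \<Longrightarrow> z \<in> hom C T Z \<Longrightarrow> relates C (rel_comp C S R) x z \<longleftrightarrow>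
      (\<exists>T' c y. c \<in> cover T' T \<and> y \<in> hom C T' Y \<and> relates C R (x \<cdot> c) y \<and> relates C S y (z \<cdot> c))"
proof -
  note r = relation_span[OF R] and s = relation_span[OF S]
  let ?P = "pb C (rgt R) (lft S)"
  note P = pb_hom[OF r(5) s(4)]
  let ?a = "lft R \<cdot> lft ?P" and ?b = "rgt S \<cdot> rgt ?P"
  have a: "?a \<in> hom C (apex ?P) X" and b: "?b \<in> hom C (apex ?P) Z" using P r s by blast+
  have cod: "Cod C (lft R) = X" "Cod C (rgt S) = Z" using r s by (auto simp: hom_def)
  obtain e where comp: "relation C X Z (rel_comp C S R)"
    and e: "e \<in> cover (apex ?P) (apex (rel_comp C S R))"
    and le: "lft (rel_comp C S R) \<cdot> e = ?a" "rgt (rel_comp C S R) \<cdot> e = ?b"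
    by (rule image_relation[OF a b, of "rel_comp C S R"]) (simp_all add: rel_comp_def Let_def cod)
  show "relation C X Z (rel_comp C S R)" by (rule comp)
  assume x: "x \<in> hom C T X" and z: "z \<in> hom C T Z"
  have "(\<exists>t. t \<in> hom C T' (apex ?P) \<and> ?a \<cdot> t = x \<cdot> c \<and> ?b \<cdot> t = z \<cdot> c) \<longleftrightarrow>
      (\<exists>y. y \<in> hom C T' Y \<and> relates C R (x \<cdot> c) y \<and> relates C S y (z \<cdot> c))"
    if c: "c \<in> cover T' T" for T' c
  proof
    have ch: "c \<in> hom C T' T" using c by simp
    assume "\<exists>t. t \<in> hom C T' (apex ?P) \<and> ?a \<cdot> t = x \<cdot> c \<and> ?b \<cdot> t = z \<cdot> c"
    then obtain t where t: "t \<in> hom C T' (apex ?P)" "?a \<cdot> t = x \<cdot> c" "?b \<cdot> t = z \<cdot> c" by blast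
    have "relates C R (x \<cdot> c) (rgt R \<cdot> (lft ?P \<cdot> t))"
      using relatesI[OF R comp_hom[OF P(2) t(1)]] hom_assoc[OF t(1) P(2) r(4)] t(2) by simp
    moreover have "relates C S (lft S \<cdot> (rgt ?P \<cdot> t)) (z \<cdot> c)"
      using relatesI[OF S comp_hom[OF P(3) t(1)]] hom_assoc[OF t(1) P(3) s(5)] t(3) by simp
    moreover have "rgt R \<cdot> (lft ?P \<cdot> t) = lft S \<cdot> (rgt ?P \<cdot> t)"
      using whisker[OF P(4) P(2) r(5) t(1)] hom_assoc[OF t(1) P(3) s(4)] by simp
    moreover have "rgt R \<cdot> (lft ?P \<cdot> t) \<in> hom C T' Y" using r P t by blast
    ultimately show "\<exists>y. y \<in> hom C T' Y \<and> relates C R (x \<cdot> c) y \<and> relates C S y (z \<cdot> c)" by metis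
  next
    have ch: "c \<in> hom C T' T" using c by simp
    assume "\<exists>y. y \<in> hom C T' Y \<and> relates C R (x \<cdot> c) y \<and> relates C S y (z \<cdot> c)"
    then obtain y where y: "y \<in> hom C T' Y" "relates C R (x \<cdot> c) y" "relates C S y (z \<cdot> c)" by blast
    obtain u where u: "u \<in> hom C T' (apex R)" "lft R \<cdot> u = x \<cdot> c" "rgt R \<cdot> u = y"
      using y(2) relates_iff[OF comp_hom[OF x ch]] by blast
    obtain v where v: "v \<in> hom C T' (apex S)" "lft S \<cdot> v = y" "rgt S \<cdot> v = z \<cdot> c"
      using y(3) relates_iff[OF y(1)] by blast
    obtain t where t: "t \<in> hom C T' (apex ?P)" "lft ?P \<cdot> t = u" "rgt ?P \<cdot> t = v"
      using pb_elem[OF r(5) s(4) u(1) v(1)] u v by auto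
    then show "\<exists>t. t \<in> hom C T' (apex ?P) \<and> ?a \<cdot> t = x \<cdot> c \<and> ?b \<cdot> t = z \<cdot> c"
      using hom_assoc[OF t(1) P(2) r(4)] hom_assoc[OF t(1) P(3) s(5)] u v by metis
  qed
  then show "relates C (rel_comp C S R) x z \<longleftrightarrow>
      (\<exists>T' c y. c \<in> cover T' T \<and> y \<in> hom C T' Y \<and> relates C R (x \<cdot> c) y \<and> relates C S y (z \<cdot> c))"
    unfolding relates_image_iff[OF comp e x z] le by blast
qed

lemma rel_compI:
  assumes R: "relation C X Y R" and S: "relation C Y Z S"
    and x: "x \<in> hom C T X" and y: "y \<in> hom C T Y" and z: "z \<in> hom C T Z"
    and xy: "relates C R x y" and yz: "relates C S y z"
  shows "relates C (rel_comp C S R) x z"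
  unfolding rel_comp(2)[OF R S x z]
proof (intro exI conjI)
  show "Idt C T \<in> cover T T" using Idt_cover[OF hom_Obj(1)[OF x]] .
  show "relates C R (x \<cdot> Idt C T) y" "relates C S y (z \<cdot> Idt C T)"
    using xy yz x z by (simp_all add: hom_def)
qed (rule y)

text \<open>Turns equality under \<open>f\<close> into an equivalence relation, so that
  3-permutability can be applied to arrows in place of relations.\<close>

lemma kernel_equivalence:
  assumes f: "f \<in> hom C X Y"
  shows "equivalence_rel C X (pb C f f)"
    "x \<in> hom C T X \<Longrightarrow> y \<in> hom C T X \<Longrightarrow> relates C (pb C f f) x y \<longleftrightarrow> f \<cdot> x = f \<cdot> y"
proof -
  note P = pb_hom[OF f f]
  have R: "relation C X X (pb C f f)"
    using relationI[OF P(2,3)] pb_joint_mono[OF f f] by simp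
  have iff: "relates C (pb C f f) x y \<longleftrightarrow> f \<cdot> x = f \<cdot> y" if x: "x \<in> hom C T X" and y: "y \<in> hom C T X"
    for T x y
  proof
    assume "relates C (pb C f f) x y"
    then obtain r where r: "r \<in> hom C T (apex (pb C f f))" "lft (pb C f f) \<cdot> r = x"
      "rgt (pb C f f) \<cdot> r = y"
      using relates_iff[OF x] by blast
    show "f \<cdot> x = f \<cdot> y" using whisker[OF P(4) P(2) f r(1)] hom_assoc[OF r(1) P(3) f] r by simp
  next
    assume "f \<cdot> x = f \<cdot> y"
    then obtain r where "r \<in> hom C T (apex (pb C f f))" "lft (pb C f f) \<cdot> r = x"
      "rgt (pb C f f) \<cdot> r = y"
      by (rule pb_elem[OF f f x y])
    then show "relates C (pb C f f) x y" using relates_iff[OF x] by blast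
  qed
  show "equivalence_rel C X (pb C f f)"
    by (rule equivalence_relI[OF R]) (use iff Idt_hom[OF hom_Obj(1)[OF f]] in auto)
  show "x \<in> hom C T X \<Longrightarrow> y \<in> hom C T X \<Longrightarrow> relates C (pb C f f) x y \<longleftrightarrow> f \<cdot> x = f \<cdot> y" by (rule iff)
qed

lemma cover_lift2:
  assumes e: "e \<in> cover A B" and e': "e' \<in> cover A' B'" and x: "x \<in> hom C T B"
    and y: "y \<in> hom C T B'"
  obtains S c u v where "c \<in> cover S T" "u \<in> hom C S A" "e \<cdot> u = x \<cdot> c" "v \<in> hom C S A'"
    "e' \<cdot> v = y \<cdot> c"
proof -
  obtain S1 c u where c: "c \<in> cover S1 T" "u \<in> hom C S1 A" "e \<cdot> u = x \<cdot> c"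
    using cover_lift[OF e x] .
  have ch: "c \<in> hom C S1 T" and eh: "e \<in> hom C A B" using c e by auto
  obtain S d v where d: "d \<in> cover S S1" "v \<in> hom C S A'" "e' \<cdot> v = (y \<cdot> c) \<cdot> d"
    using cover_lift[OF e' comp_hom[OF y ch]] .
  have dh: "d \<in> hom C S S1" using d by simp
  show thesis
  proof (rule that)
    show "c \<cdot> d \<in> cover S T" by (rule cover_comp[OF d(1) c(1)])
    show "u \<cdot> d \<in> hom C S A" using c(2) dh by blast
    show "e \<cdot> (u \<cdot> d) = x \<cdot> (c \<cdot> d)" using whisker[OF c(3,2) eh dh] hom_assoc[OF dh ch x] by simp
    show "e' \<cdot> v = y \<cdot> (c \<cdot> d)" using d(3) hom_assoc[OF dh ch y] by simp
  qed (rule d(2))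
qed

lemma ex_inverse_image:
  assumes m: "m \<in> hom C M X" and R: "equivalence_rel C X R"
  obtains S where "equivalence_rel C M S"
    "\<And>T a b. a \<in> hom C T M \<Longrightarrow> b \<in> hom C T M \<Longrightarrow> relates C S a b \<longleftrightarrow> relates C R (m \<cdot> a) (m \<cdot> b)"
proof -
  note r = relation_span[OF eqrel_relation[OF R]]
  \<comment> \<open>The two legs of \<open>R\<close> are pulled back along \<open>m\<close> one
    after the other; \<open>?w\<close> is the underlying element of \<open>R\<close>.\<close>
  let ?P = "pb C m (lft R)"
  note P = pb_hom[OF m r(4)]
  have g: "rgt R \<cdot> rgt ?P \<in> hom C (apex ?P) X" using P r by blast
  let ?Q = "pb C (rgt R \<cdot> rgt ?P) m"
  note Q = pb_hom[OF g m]
  let ?l = "lft ?P \<cdot> lft ?Q" and ?r = "rgt ?Q" and ?w = "rgt ?P \<cdot> lft ?Q"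
  have l: "?l \<in> hom C (apex ?Q) M" and w: "?w \<in> hom C (apex ?Q) (apex R)" using P Q by blast+
  have lw: "m \<cdot> ?l = lft R \<cdot> ?w"
    using whisker[OF P(4) P(2) m Q(2)] hom_assoc[OF Q(2) P(3) r(4)] by simp
  have rw: "rgt R \<cdot> ?w = m \<cdot> ?r" using Q(4) hom_assoc[OF Q(2) P(3) r(5)] by simp
  let ?S = "Span (apex ?Q) ?l ?r"
  have S: "relation C M M ?S"
  proof (rule relationI[OF l Q(3)])
    fix T h k
    assume h: "h \<in> hom C T (apex ?Q)" and k: "k \<in> hom C T (apex ?Q)" and eq: "?l \<cdot> h = ?l \<cdot> k"
      "?r \<cdot> h = ?r \<cdot> k"
    have "?w \<cdot> h = ?w \<cdot> k"
    proof (rule relation_joint_mono[OF eqrel_relation[OF R]])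
      show "?w \<cdot> h \<in> hom C T (apex R)" "?w \<cdot> k \<in> hom C T (apex R)" using w h k by blast+
      show "lft R \<cdot> (?w \<cdot> h) = lft R \<cdot> (?w \<cdot> k)"
        using whisker[OF lw[symmetric] w r(4)] hom_assoc[OF _ l m] h k eq by metis
      show "rgt R \<cdot> (?w \<cdot> h) = rgt R \<cdot> (?w \<cdot> k)"
        using whisker[OF rw w r(5)] hom_assoc[OF _ Q(3) m] h k eq by metis
    qed
    then have "lft ?Q \<cdot> h = lft ?Q \<cdot> k"
      using eq(1) hom_assoc[OF h Q(2)] hom_assoc[OF k Q(2)] P
        pb_joint_mono[OF m r(4) comp_hom[OF Q(2) h] comp_hom[OF Q(2) k]] by simp
    then show "h = k" using pb_joint_mono[OF g m h k] eq(2) by simp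
  qed
  have iff: "relates C ?S a b \<longleftrightarrow> relates C R (m \<cdot> a) (m \<cdot> b)" if a: "a \<in> hom C T M"
    and b: "b \<in> hom C T M" for T a b
  proof
    assume "relates C ?S a b"
    then obtain h where h: "h \<in> hom C T (apex ?Q)" "?l \<cdot> h = a" "?r \<cdot> h = b" using relates_iff[OF a]
      by auto
    have "lft R \<cdot> (?w \<cdot> h) = m \<cdot> a" "rgt R \<cdot> (?w \<cdot> h) = m \<cdot> b"
      using whisker[OF lw[symmetric] w r(4) h(1)] hom_assoc[OF h(1) l m]
        whisker[OF rw w r(5) h(1)] hom_assoc[OF h(1) Q(3) m] h by simp_all
    then show "relates C R (m \<cdot> a) (m \<cdot> b)"
      using relatesI[OF eqrel_relation[OF R] comp_hom[OF w h(1)]] by simp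
  next
    assume "relates C R (m \<cdot> a) (m \<cdot> b)"
    then obtain u where u: "u \<in> hom C T (apex R)" "lft R \<cdot> u = m \<cdot> a" "rgt R \<cdot> u = m \<cdot> b"
      using relates_iff[OF comp_hom[OF m a]] by blast
    obtain p where p: "p \<in> hom C T (apex ?P)" "lft ?P \<cdot> p = a" "rgt ?P \<cdot> p = u"
      using pb_elem[OF m r(4) a u(1) u(2)[symmetric]] .
    have "(rgt R \<cdot> rgt ?P) \<cdot> p = m \<cdot> b" using hom_assoc[OF p(1) P(3) r(5)] p u by simp
    then obtain h where h: "h \<in> hom C T (apex ?Q)" "lft ?Q \<cdot> h = p" "?r \<cdot> h = b"
      using pb_elem[OF g m p(1) b] by blast
    have "?l \<cdot> h = a" using hom_assoc[OF h(1) Q(2) P(2)] h p by simp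
    then show "relates C ?S a b" using relates_iff[OF a, of ?S b] h by auto
  qed
  have "equivalence_rel C M ?S"
  proof (rule equivalence_relI[OF S])
    have i: "Idt C M \<in> hom C M M" using hom_Obj(1)[OF m] by (rule Idt_hom)
    show "relates C ?S (Idt C M) (Idt C M)" unfolding iff[OF i i]
      by (rule eqrel_refl[OF R comp_hom[OF m i]])
  next
    fix T x y assume "x \<in> hom C T M" "y \<in> hom C T M" "relates C ?S x y"
    then show "relates C ?S y x" using iff eqrel_sym[OF R comp_hom[OF m]] by metis
  next
    fix T x y z
    assume x: "x \<in> hom C T M" and y: "y \<in> hom C T M" and z: "z \<in> hom C T M"
      and "relates C ?S x y" "relates C ?S y z"
    then have "relates C R (m \<cdot> x) (m \<cdot> z)"
      using iff[OF x y] iff[OF y z] eqrel_trans[OF R comp_hom[OF m x] comp_hom[OF m y]] by simp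
    then show "relates C ?S x z" using iff[OF x z] by simp
  qed
  then show thesis using iff by (rule that)
qed

end

section \<open>Consequences of 3-permutability\<close>

locale goursat_cat = regular_cat C for C :: "('o, 'm) cat" (structure) +
  assumes goursat: "goursat_category C"
begin

text \<open>The inclusion of \<open>R S R\<close> in \<open>S R S\<close> with its two local middle
  terms moved to one common cover. The reverse inclusion is the same statement with \<open>R\<close>
  and \<open>S\<close> exchanged.\<close>

lemma goursat_elem:
  assumes R: "equivalence_rel C X R" and S: "equivalence_rel C X S"
    and x: "x \<in> hom C T X" and y: "y \<in> hom C T X" and z: "z \<in> hom C T X" and w: "w \<in> hom C T X"
    and xy: "relates C R x y" and yz: "relates C S y z" and zw: "relates C R z w"
  obtains T' c y' z' where "c \<in> cover T' T" "y' \<in> hom C T' X" "z' \<in> hom C T' X"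
    "relates C S (x \<cdot> c) y'" "relates C R y' z'" "relates C S z' (w \<cdot> c)"
proof -
  note R' = eqrel_relation[OF R] and S' = eqrel_relation[OF S]
  note SR = rel_comp[OF R' S'] and RS = rel_comp[OF S' R']
  note RSR = rel_comp[OF SR(1) R'] and SRS = rel_comp[OF RS(1) S']
  have "relates C (rel_comp C R (rel_comp C S R)) x w"
    by (rule rel_compI[OF SR(1) R' x z w rel_compI[OF R' S' x y z xy yz] zw])
  then obtain r where r: "r \<in> hom C T (apex (rel_comp C R (rel_comp C S R)))"
      "lft (rel_comp C R (rel_comp C S R)) \<cdot> r = x" "rgt (rel_comp C R (rel_comp C S R)) \<cdot> r = w"
    using relates_iff[OF x] by blast
  have "rel_eq C (rel_comp C R (rel_comp C S R)) (rel_comp C S (rel_comp C R S))"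
    using goursat R S unfolding goursat_category_def by blast
  then obtain i
    where i: "i \<in> hom C (apex (rel_comp C R (rel_comp C S R))) (apex (rel_comp C S (rel_comp C R S)))"
      "lft (rel_comp C S (rel_comp C R S)) \<cdot> i = lft (rel_comp C R (rel_comp C S R))"
      "rgt (rel_comp C S (rel_comp C R S)) \<cdot> i = rgt (rel_comp C R (rel_comp C S R))"
    unfolding rel_eq_def by blast
  note t = relation_span[OF SRS(1)]
  have "relates C (rel_comp C S (rel_comp C R S)) x w"
    using relatesI[OF SRS(1) comp_hom[OF i(1) r(1)]] whisker[OF i(2,1) t(4) r(1)]
      whisker[OF i(3,1) t(5) r(1)] r
    by simp
  then obtain T1 c z' where c: "c \<in> cover T1 T" and z': "z' \<in> hom C T1 X"
      and xz: "relates C (rel_comp C R S) (x \<cdot> c) z'" and zw': "relates C S z' (w \<cdot> c)"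
    unfolding SRS(2)[OF x w] by blast
  have ch: "c \<in> hom C T1 T" using c by simp
  have xc: "x \<cdot> c \<in> hom C T1 X" using x ch by blast
  obtain T2 d y' where d: "d \<in> cover T2 T1" and y': "y' \<in> hom C T2 X"
      and xy': "relates C S ((x \<cdot> c) \<cdot> d) y'" and yz': "relates C R y' (z' \<cdot> d)"
    using xz unfolding RS(2)[OF xc z'] by blast
  have dh: "d \<in> hom C T2 T1" using d by simp
  show thesis
  proof (rule that)
    show "c \<cdot> d \<in> cover T2 T" by (rule cover_comp[OF d c])
    show "y' \<in> hom C T2 X" by (rule y')
    show "z' \<cdot> d \<in> hom C T2 X" using z' dh by blast
    show "relates C S (x \<cdot> (c \<cdot> d)) y'" using xy' hom_assoc[OF dh ch x] by simp
    show "relates C R y' (z' \<cdot> d)" by (rule yz')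
    show "relates C S (z' \<cdot> d) (w \<cdot> (c \<cdot> d))"
      using relates_comp[OF S' zw' z' dh] hom_assoc[OF dh ch w] by simp
  qed
qed

text \<open>Reflexivity and symmetry pass to images in every regular category. For transitivity,
  lifts of \<open>u R' v R' w\<close> form a zigzag \<open>R K R\<close> with \<open>K\<close> the
  kernel relation of \<open>e\<close>; exchanging it for \<open>K R K\<close> gives an
  \<open>R\<close>-related pair over \<open>u\<close> and \<open>w\<close>.\<close>

lemma ex_direct_image:
  assumes e: "e \<in> cover X Y" and R: "equivalence_rel C X R"
  obtains R' eR where "equivalence_rel C Y R'" "eR \<in> cover (apex R) (apex R')"
    "lft R' \<cdot> eR = e \<cdot> lft R" "rgt R' \<cdot> eR = e \<cdot> rgt R"
proof -
  note Rr = eqrel_relation[OF R]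
  note r = relation_span[OF Rr]
  have eh: "e \<in> hom C X Y" using e by simp
  have a: "e \<cdot> lft R \<in> hom C (apex R) Y" and b: "e \<cdot> rgt R \<in> hom C (apex R) Y" using eh r by blast+
  obtain R' eR where R': "relation C Y Y R'" and eR: "eR \<in> cover (apex R) (apex R')"
    and le: "lft R' \<cdot> eR = e \<cdot> lft R" "rgt R' \<cdot> eR = e \<cdot> rgt R"
    using image_relation[OF a b refl] .
  have iff: "relates C R' u v \<longleftrightarrow> (\<exists>S c x y. c \<in> cover S T \<and> x \<in> hom C S X \<and> y \<in> hom C S X \<and>
      relates C R x y \<and> e \<cdot> x = u \<cdot> c \<and> e \<cdot> y = v \<cdot> c)" (is "_ \<longleftrightarrow> ?rhs")
    if u: "u \<in> hom C T Y" and v: "v \<in> hom C T Y" for T u v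
  proof
    assume "relates C R' u v"
    then obtain S c t where c: "c \<in> cover S T" and t: "t \<in> hom C S (apex R)"
      "(e \<cdot> lft R) \<cdot> t = u \<cdot> c" "(e \<cdot> rgt R) \<cdot> t = v \<cdot> c"
      unfolding relates_image_iff[OF R' eR u v] le by blast
    have "e \<cdot> (lft R \<cdot> t) = u \<cdot> c" "e \<cdot> (rgt R \<cdot> t) = v \<cdot> c"
      using hom_assoc[OF t(1) r(4) eh] hom_assoc[OF t(1) r(5) eh] t by simp_all
    moreover have "lft R \<cdot> t \<in> hom C S X" "rgt R \<cdot> t \<in> hom C S X" using r t(1) by blast+
    ultimately show ?rhs
      by (intro exI[of _ S] exI[of _ c] exI[of _ "lft R \<cdot> t"] exI[of _ "rgt R \<cdot> t"] conjI c relatesI[OF Rr t(1)])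
  next
    assume ?rhs
    then obtain S c x y where c: "c \<in> cover S T" and xy: "x \<in> hom C S X" "y \<in> hom C S X"
      "relates C R x y"
      "e \<cdot> x = u \<cdot> c" "e \<cdot> y = v \<cdot> c" by blast
    obtain t where t: "t \<in> hom C S (apex R)" "lft R \<cdot> t = x" "rgt R \<cdot> t = y"
      using xy(3) relates_iff[OF xy(1)] by blast
    have "(e \<cdot> lft R) \<cdot> t = u \<cdot> c" "(e \<cdot> rgt R) \<cdot> t = v \<cdot> c"
      using hom_assoc[OF t(1) r(4) eh] hom_assoc[OF t(1) r(5) eh] t xy by simp_all
    then show "relates C R' u v"
      unfolding relates_image_iff[OF R' eR u v] le using c t(1) by blast
  qed
  have "equivalence_rel C Y R'"
  proof (rule equivalence_relI[OF R'])
    have i: "Idt C Y \<in> hom C Y Y" and j: "Idt C X \<in> hom C X X" using hom_Obj[OF eh] by blast+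
    have "e \<cdot> Idt C X = Idt C Y \<cdot> e" using eh by (simp add: hom_def)
    then show "relates C R' (Idt C Y) (Idt C Y)"
      unfolding iff[OF i i] using e j eqrel_refl[OF R j] by blast
  next
    fix T u v assume u: "u \<in> hom C T Y" and v: "v \<in> hom C T Y" and "relates C R' u v"
    then show "relates C R' v u" unfolding iff[OF u v] iff[OF v u] using eqrel_sym[OF R] by blast
  next
    fix T u v w
    assume u: "u \<in> hom C T Y" and v: "v \<in> hom C T Y" and w: "w \<in> hom C T Y"
      and uv: "relates C R' u v" and vw: "relates C R' v w"
    obtain S1 c1 x y where c1: "c1 \<in> cover S1 T" and x: "x \<in> hom C S1 X" and y: "y \<in> hom C S1 X"
      and xy: "relates C R x y" and ex: "e \<cdot> x = u \<cdot> c1" and ey: "e \<cdot> y = v \<cdot> c1"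
      using uv unfolding iff[OF u v] by blast
    obtain S2 c2 y' z where c2: "c2 \<in> cover S2 T" and y': "y' \<in> hom C S2 X" and z: "z \<in> hom C S2 X"
      and yz: "relates C R y' z" and ey': "e \<cdot> y' = v \<cdot> c2" and ez: "e \<cdot> z = w \<cdot> c2"
      using vw unfolding iff[OF v w] by blast
    have ch: "c1 \<in> hom C S1 T" "c2 \<in> hom C S2 T" using c1 c2 by auto
    \<comment> \<open>Over a common base the two lifts \<open>y\<close> and \<open>y'\<close> of
      \<open>v\<close> agree under \<open>e\<close>, which supplies the middle link
      \<open>K\<close>.\<close>
    obtain S d k where d: "d \<in> cover S S2" and k: "k \<in> hom C S S1" and ck: "c1 \<cdot> k = c2 \<cdot> d"
      using cover_lift[OF c1 ch(2)] .
    have dh: "d \<in> hom C S S2" using d by simp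
    have "e \<cdot> (y \<cdot> k) = e \<cdot> (y' \<cdot> d)"
      using whisker[OF ey y eh k] whisker[OF ey' y' eh dh] hom_assoc[OF k ch(1) v]
        hom_assoc[OF dh ch(2) v] ck
      by simp
    then have "relates C (pb C e e) (y \<cdot> k) (y' \<cdot> d)"
      using kernel_equivalence(2)[OF eh comp_hom[OF y k] comp_hom[OF y' dh]] by simp
    from goursat_elem[OF R kernel_equivalence(1)[OF eh] comp_hom[OF x k] comp_hom[OF y k] comp_hom[OF y' dh]
        comp_hom[OF z dh] relates_comp[OF Rr xy x k] this relates_comp[OF Rr yz y' dh]]
    obtain S' f p q where f: "f \<in> cover S' S" and p: "p \<in> hom C S' X" and q: "q \<in> hom C S' X"
      and kp: "relates C (pb C e e) ((x \<cdot> k) \<cdot> f) p" and pq: "relates C R p q"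
      and kq: "relates C (pb C e e) q ((z \<cdot> d) \<cdot> f)" .
    have fh: "f \<in> hom C S' S" using f by simp
    have xk: "x \<cdot> k \<in> hom C S X" and zd: "z \<cdot> d \<in> hom C S X" using x k z dh by blast+
    have "e \<cdot> p = e \<cdot> ((x \<cdot> k) \<cdot> f)"
      using kp kernel_equivalence(2)[OF eh comp_hom[OF xk fh] p] by simp
    also have "\<dots> = (e \<cdot> (x \<cdot> k)) \<cdot> f" by (rule hom_assoc[OF fh xk eh, symmetric])
    also have "e \<cdot> (x \<cdot> k) = u \<cdot> (c2 \<cdot> d)" using whisker[OF ex x eh k] hom_assoc[OF k ch(1) u] ck
      by simp
    also have "(u \<cdot> (c2 \<cdot> d)) \<cdot> f = u \<cdot> ((c2 \<cdot> d) \<cdot> f)"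
      by (rule hom_assoc[OF fh comp_hom[OF ch(2) dh] u])
    finally have ep: "e \<cdot> p = u \<cdot> ((c2 \<cdot> d) \<cdot> f)" .
    have "e \<cdot> q = e \<cdot> ((z \<cdot> d) \<cdot> f)"
      using kq kernel_equivalence(2)[OF eh q comp_hom[OF zd fh]] by simp
    also have "\<dots> = (e \<cdot> (z \<cdot> d)) \<cdot> f" by (rule hom_assoc[OF fh zd eh, symmetric])
    also have "e \<cdot> (z \<cdot> d) = w \<cdot> (c2 \<cdot> d)" using whisker[OF ez z eh dh] hom_assoc[OF dh ch(2) w]
      by simp
    also have "(w \<cdot> (c2 \<cdot> d)) \<cdot> f = w \<cdot> ((c2 \<cdot> d) \<cdot> f)"
      by (rule hom_assoc[OF fh comp_hom[OF ch(2) dh] w])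
    finally have eq: "e \<cdot> q = w \<cdot> ((c2 \<cdot> d) \<cdot> f)" .
    have "(c2 \<cdot> d) \<cdot> f \<in> cover S' T" by (rule cover_comp[OF f cover_comp[OF d c2]])
    then show "relates C R' u w" unfolding iff[OF u w] using p q pq ep eq by blast
  qed
  then show thesis using that eR le by blast
qed

text \<open>The Shifting Lemma for the kernel relations of \<open>g\<close>, \<open>h\<close> and \<open>k\<close>: apply 3-permutability to the
  kernel relation of \<open>h\<close> and that of \<open>(g, k)\<close>.\<close>

lemma kernel_shifting:
  assumes g: "g \<in> hom C P A" and h: "h \<in> hom C P B" and k: "k \<in> hom C P D"
    and a: "a \<in> hom C T P" and b: "b \<in> hom C T P" and c: "c \<in> hom C T P" and d: "d \<in> hom C T P"
    and ab: "h \<cdot> a = h \<cdot> b" and bc: "g \<cdot> b = g \<cdot> c" "k \<cdot> b = k \<cdot> c" and cd: "h \<cdot> c = h \<cdot> d"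
    and ad: "g \<cdot> a = g \<cdot> d"
    and meet: "\<And>S u v. u \<in> hom C S P \<Longrightarrow> v \<in> hom C S P \<Longrightarrow> g \<cdot> u = g \<cdot> v \<Longrightarrow> h \<cdot> u = h \<cdot> v \<Longrightarrow> k \<cdot> u = k \<cdot> v"
  shows "k \<cdot> a = k \<cdot> d"
proof -
  have gk: "pairing C g k \<in> hom C P (apex (prd C A D))" by (rule pairing(1)[OF g k])
  note H = kernel_equivalence[OF h] and G = kernel_equivalence[OF gk]
  have G': "relates C (pb C (pairing C g k) (pairing C g k)) u v \<longleftrightarrow> g \<cdot> u = g \<cdot> v \<and> k \<cdot> u = k \<cdot> v"
    if "u \<in> hom C S P" "v \<in> hom C S P" for S u v
    using G(2)[OF that] pairing_eq_iff[OF g k that] by simp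
  have "relates C (pb C h h) a b" "relates C (pb C (pairing C g k) (pairing C g k)) b c"
    "relates C (pb C h h) c d"
    using H(2)[OF a b] G'[OF b c] H(2)[OF c d] ab bc cd by simp_all
  from goursat_elem[OF H(1) G(1) a b c d this]
  obtain S e u v where e: "e \<in> cover S T" and u: "u \<in> hom C S P" and v: "v \<in> hom C S P"
    and au: "relates C (pb C (pairing C g k) (pairing C g k)) (a \<cdot> e) u"
      and uv: "relates C (pb C h h) u v"
    and vd: "relates C (pb C (pairing C g k) (pairing C g k)) v (d \<cdot> e)" .
  have eh: "e \<in> hom C S T" using e by simp
  note ae = comp_hom[OF a eh] and de = comp_hom[OF d eh]
  have gku: "g \<cdot> (a \<cdot> e) = g \<cdot> u" "k \<cdot> (a \<cdot> e) = k \<cdot> u" using au G'[OF ae u] by simp_all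
  have gkv: "g \<cdot> v = g \<cdot> (d \<cdot> e)" "k \<cdot> v = k \<cdot> (d \<cdot> e)" using vd G'[OF v de] by simp_all
  \<comment> \<open>The exchange leaves \<open>u\<close> and \<open>v\<close> related by
    \<open>h\<close>; they also agree under \<open>g\<close> because \<open>a\<close> and
    \<open>d\<close> do, so \<open>meet\<close> applies to them. Under \<open>k\<close> they have
    the same values as \<open>a\<close> and \<open>d\<close> over the cover.\<close>
  have "g \<cdot> u = g \<cdot> v"
    using gku gkv hom_assoc[OF eh a g] hom_assoc[OF eh d g] ad by simp
  then have "k \<cdot> u = k \<cdot> v" using meet[OF u v] uv H(2)[OF u v] by simp
  then have "(k \<cdot> a) \<cdot> e = (k \<cdot> d) \<cdot> e"
    using gku gkv hom_assoc[OF eh a k] hom_assoc[OF eh d k] by simp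
  then show ?thesis using cover_epi[OF e comp_hom[OF k a] comp_hom[OF k d]] by blast
qed

text \<open>Let \<open>K\<close> be the kernel relation of \<open>g\<close> and \<open>S\<close> the inverse image of \<open>R\<close> along \<open>m\<close>. Arbitrary lifts of
  \<open>a\<close>, \<open>b\<close> and of the pair \<open>(m' a, m' b)\<close> are joined, by way of the section \<open>\<sigma>\<close>, by \<open>S K S K S\<close>, which
  is \<open>K S K\<close> by 3-permutability; the two middle elements of the latter are the lifts sought.\<close>

lemma lift_related:
  assumes R: "equivalence_rel C X R" and R': "equivalence_rel C X' R'" and f: "f \<in> hom C X X'"
    and fR: "fR \<in> cover (apex R) (apex R')" and lR: "lft R' \<cdot> fR = f \<cdot> lft R"
      and rR: "rgt R' \<cdot> fR = f \<cdot> rgt R"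
    and m: "m \<in> hom C M X" and m': "m' \<in> hom C M' X'" and g: "g \<in> cover M M'"
      and mg: "m' \<cdot> g = f \<cdot> m"
    and \<sigma>: "\<sigma> \<in> hom C X M" "m \<cdot> \<sigma> = Idt C X" and \<sigma>': "\<sigma>' \<in> hom C X' M'" "g \<cdot> \<sigma> = \<sigma>' \<cdot> f"
    and a: "a \<in> hom C T M'" and b: "b \<in> hom C T M'" and ab: "relates C R' (m' \<cdot> a) (m' \<cdot> b)"
  obtains S c a' b' where "c \<in> cover S T" "a' \<in> hom C S M" "b' \<in> hom C S M"
    "g \<cdot> a' = a \<cdot> c" "g \<cdot> b' = b \<cdot> c" "relates C R (m \<cdot> a') (m \<cdot> b')"
proof -
  note Rr = eqrel_relation[OF R]
  note s = relation_span[OF Rr] and s' = relation_span[OF eqrel_relation[OF R']]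
  have gh: "g \<in> hom C M M'" and fRh: "fR \<in> hom C (apex R) (apex R')" using g fR by auto
  obtain r' where r': "r' \<in> hom C T (apex R')" "lft R' \<cdot> r' = m' \<cdot> a" "rgt R' \<cdot> r' = m' \<cdot> b"
    using ab relates_iff[OF comp_hom[OF m' a]] by blast
  obtain S0 c0 a0 b0 where c0: "c0 \<in> cover S0 T" and a0: "a0 \<in> hom C S0 M" "g \<cdot> a0 = a \<cdot> c0"
    and b0: "b0 \<in> hom C S0 M" "g \<cdot> b0 = b \<cdot> c0"
    using cover_lift2[OF g g a b] .
  have c0h: "c0 \<in> hom C S0 T" using c0 by simp
  obtain S1 d r where d: "d \<in> cover S1 S0" and r: "r \<in> hom C S1 (apex R)"
    and fr: "fR \<cdot> r = (r' \<cdot> c0) \<cdot> d"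
    using cover_lift[OF fR comp_hom[OF r'(1) c0h]] .
  have dh: "d \<in> hom C S1 S0" using d by simp
  define c where "c = c0 \<cdot> d"
  define a1 where "a1 = a0 \<cdot> d"
  define b1 where "b1 = b0 \<cdot> d"
  define x where "x = lft R \<cdot> r"
  define y where "y = rgt R \<cdot> r"
  have c: "c \<in> cover S1 T" unfolding c_def by (rule cover_comp[OF d c0])
  then have ch: "c \<in> hom C S1 T" by simp
  have a1: "a1 \<in> hom C S1 M" and b1: "b1 \<in> hom C S1 M" and x: "x \<in> hom C S1 X"
    and y: "y \<in> hom C S1 X"
    unfolding a1_def b1_def x_def y_def using a0 b0 dh r s by blast+
  have ga1: "g \<cdot> a1 = a \<cdot> c" unfolding a1_def c_def using whisker[OF a0(2,1) gh dh]
    hom_assoc[OF dh c0h a] by simp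
  have gb1: "g \<cdot> b1 = b \<cdot> c" unfolding b1_def c_def using whisker[OF b0(2,1) gh dh]
    hom_assoc[OF dh c0h b] by simp
  have fr': "fR \<cdot> r = r' \<cdot> c" using fr hom_assoc[OF dh c0h r'(1)] by (simp add: c_def)
  have fx: "f \<cdot> x = f \<cdot> (m \<cdot> a1)"
  proof -
    have "f \<cdot> x = lft R' \<cdot> (r' \<cdot> c)" using whisker[OF lR fRh s'(4) r] hom_assoc[OF r s(4) f] fr'
      by (simp add: x_def)
    also have "\<dots> = m' \<cdot> (g \<cdot> a1)" using whisker[OF r'(2,1) s'(4) ch] hom_assoc[OF ch a m']
      by (simp add: ga1)
    also have "\<dots> = f \<cdot> (m \<cdot> a1)" using whisker[OF mg gh m' a1] hom_assoc[OF a1 m f] by simp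
    finally show ?thesis .
  qed
  have fy: "f \<cdot> y = f \<cdot> (m \<cdot> b1)"
  proof -
    have "f \<cdot> y = rgt R' \<cdot> (r' \<cdot> c)" using whisker[OF rR fRh s'(5) r] hom_assoc[OF r s(5) f] fr'
      by (simp add: y_def)
    also have "\<dots> = m' \<cdot> (g \<cdot> b1)" using whisker[OF r'(3,1) s'(5) ch] hom_assoc[OF ch b m']
      by (simp add: gb1)
    also have "\<dots> = f \<cdot> (m \<cdot> b1)" using whisker[OF mg gh m' b1] hom_assoc[OF b1 m f] by simp
    finally show ?thesis .
  qed
  obtain \<Sigma> where \<Sigma>: "equivalence_rel C M \<Sigma>"
    and \<Sigma>_iff:
      "\<And>T a b. a \<in> hom C T M \<Longrightarrow> b \<in> hom C T M \<Longrightarrow> relates C \<Sigma> a b \<longleftrightarrow> relates C R (m \<cdot> a) (m \<cdot> b)"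
    by (rule ex_inverse_image[OF m R]) blast
  let ?K = "pb C g g"
  note K = kernel_equivalence[OF gh]
  \<comment> \<open>On the image of \<open>\<sigma>\<close>, \<open>m\<close> recovers the argument
    while \<open>g\<close> sees it only through \<open>f\<close>. So \<open>a1\<close> may be
    exchanged for \<open>\<sigma> (m a1)\<close> within \<open>\<Sigma>\<close>, and within
    \<open>?K\<close> the argument of \<open>\<sigma>\<close> for any other with the same image
    under \<open>f\<close>.\<close>
  have m\<sigma>: "m \<cdot> (\<sigma> \<cdot> t) = t" if t: "t \<in> hom C U X" for t U
    using whisker[OF \<sigma>(2,1) m t] t by (simp add: hom_def)
  have g\<sigma>: "g \<cdot> (\<sigma> \<cdot> t) = \<sigma>' \<cdot> (f \<cdot> t)" if t: "t \<in> hom C U X" for t U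
    using whisker[OF \<sigma>'(2) \<sigma>(1) gh t] hom_assoc[OF t f \<sigma>'(1)] by simp
  note ma = comp_hom[OF m a1] and mb = comp_hom[OF m b1]
  note p2 = comp_hom[OF \<sigma>(1) ma] and p3 = comp_hom[OF \<sigma>(1) x] and p4 = comp_hom[OF \<sigma>(1) y] and p5
    = comp_hom[OF \<sigma>(1) mb]
  have 1: "relates C \<Sigma> a1 (\<sigma> \<cdot> (m \<cdot> a1))" unfolding \<Sigma>_iff[OF a1 p2] m\<sigma>[OF ma]
    by (rule eqrel_refl[OF R ma])
  have 2: "relates C ?K (\<sigma> \<cdot> (m \<cdot> a1)) (\<sigma> \<cdot> x)" unfolding K(2)[OF p2 p3] g\<sigma>[OF ma] g\<sigma>[OF x] fx
    by (rule HOL.refl)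
  have 3: "relates C \<Sigma> (\<sigma> \<cdot> x) (\<sigma> \<cdot> y)"
    unfolding \<Sigma>_iff[OF p3 p4] m\<sigma>[OF x] m\<sigma>[OF y] unfolding x_def y_def by (rule relatesI[OF Rr r])
  have 4: "relates C ?K (\<sigma> \<cdot> y) (\<sigma> \<cdot> (m \<cdot> b1))" unfolding K(2)[OF p4 p5] g\<sigma>[OF mb] g\<sigma>[OF y] fy
    by (rule HOL.refl)
  have 5: "relates C \<Sigma> (\<sigma> \<cdot> (m \<cdot> b1)) b1" unfolding \<Sigma>_iff[OF p5 b1] m\<sigma>[OF mb]
    by (rule eqrel_refl[OF R mb])
  \<comment> \<open>The first exchange concerns the links 1, 2, 3. Its last link merges with link 4
    by transitivity of \<open>?K\<close>, which together with link 5 leaves a zigzag of the same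
    shape from \<open>q\<close> to \<open>b1\<close> for the second exchange.\<close>
  obtain S2 d1 q q' where d1: "d1 \<in> cover S2 S1" and q: "q \<in> hom C S2 M" "q' \<in> hom C S2 M"
    and k: "relates C ?K (a1 \<cdot> d1) q" "relates C \<Sigma> q q'" "relates C ?K q' ((\<sigma> \<cdot> y) \<cdot> d1)"
    using goursat_elem[OF \<Sigma> K(1) a1 p2 p3 p4 1 2 3] .
  have d1h: "d1 \<in> hom C S2 S1" using d1 by simp
  note a1d = comp_hom[OF a1 d1h] and p4d = comp_hom[OF p4 d1h] and p5d = comp_hom[OF p5 d1h] and b1d
    = comp_hom[OF b1 d1h]
  have 6: "relates C ?K q' ((\<sigma> \<cdot> (m \<cdot> b1)) \<cdot> d1)"
    by (rule eqrel_trans[OF K(1) q(2) p4d k(3) relates_comp[OF eqrel_relation[OF K(1)] 4 p4 d1h]])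
  have 7: "relates C \<Sigma> ((\<sigma> \<cdot> (m \<cdot> b1)) \<cdot> d1) (b1 \<cdot> d1)"
    by (rule relates_comp[OF eqrel_relation[OF \<Sigma>] 5 p5 d1h])
  obtain S3 d2 t t' where d2: "d2 \<in> cover S3 S2" and t: "t \<in> hom C S3 M" "t' \<in> hom C S3 M"
    and l: "relates C ?K (q \<cdot> d2) t" "relates C \<Sigma> t t'" "relates C ?K t' ((b1 \<cdot> d1) \<cdot> d2)"
    using goursat_elem[OF \<Sigma> K(1) q p5d b1d k(2) 6 7] .
  have d2h: "d2 \<in> hom C S3 S2" using d2 by simp
  have dd: "(c \<cdot> d1) \<cdot> d2 \<in> cover S3 T" by (rule cover_comp[OF d2 cover_comp[OF d1 c]])
  have "g \<cdot> t = g \<cdot> (q \<cdot> d2)" using l(1) K(2)[OF comp_hom[OF q(1) d2h] t(1)] by simp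
  also have "\<dots> = (g \<cdot> q) \<cdot> d2" by (rule hom_assoc[OF d2h q(1) gh, symmetric])
  also have "g \<cdot> q = (a \<cdot> c) \<cdot> d1"
    using k(1) K(2)[OF a1d q(1)] hom_assoc[OF d1h a1 gh] by (simp add: ga1)
  also have "((a \<cdot> c) \<cdot> d1) \<cdot> d2 = a \<cdot> ((c \<cdot> d1) \<cdot> d2)"
    using hom_assoc[OF d1h ch a] hom_assoc[OF d2h comp_hom[OF ch d1h] a] by simp
  finally have gt: "g \<cdot> t = a \<cdot> ((c \<cdot> d1) \<cdot> d2)" .
  have "g \<cdot> t' = g \<cdot> ((b1 \<cdot> d1) \<cdot> d2)" using l(3) K(2)[OF t(2) comp_hom[OF b1d d2h]] by simp
  also have "\<dots> = (g \<cdot> (b1 \<cdot> d1)) \<cdot> d2" by (rule hom_assoc[OF d2h b1d gh, symmetric])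
  also have "g \<cdot> (b1 \<cdot> d1) = (b \<cdot> c) \<cdot> d1" using hom_assoc[OF d1h b1 gh] by (simp add: gb1)
  also have "((b \<cdot> c) \<cdot> d1) \<cdot> d2 = b \<cdot> ((c \<cdot> d1) \<cdot> d2)"
    using hom_assoc[OF d1h ch b] hom_assoc[OF d2h comp_hom[OF ch d1h] b] by simp
  finally have gt': "g \<cdot> t' = b \<cdot> ((c \<cdot> d1) \<cdot> d2)" .
  show thesis by (rule that[OF dd t gt gt']) (use l(2) \<Sigma>_iff[OF t] in simp)
qed

end

section \<open>Connectors on generalized elements\<close>

locale eq_pair = regular_cat C for C :: "('o, 'm) cat" (structure) +
  fixes X :: 'o and R S :: "('o, 'm) span"
  assumes R: "equivalence_rel C X R" and S: "equivalence_rel C X S"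
begin

lemmas Rr = eqrel_relation[OF R] and Sr = eqrel_relation[OF S]
lemmas Rs = relation_span[OF Rr] and Ss = relation_span[OF Sr]

abbreviation "P \<equiv> apex (rs_pb C R S)"
abbreviation "\<pi>1 \<equiv> lft (rs_pb C R S)"
abbreviation "\<pi>2 \<equiv> rgt (rs_pb C R S)"

text \<open>The entries of the generic triple. Every triple is its composite with an arrow into
  \<open>P\<close>, so an equation between arrows out of \<open>P\<close> is proved by computing
  with this one.\<close>

definition "px = lft R \<cdot> \<pi>1"
definition "py = rgt R \<cdot> \<pi>1"
definition "pz = rgt S \<cdot> \<pi>2"

lemma rs_pb_hom:
  shows "P \<in> Obj C" "\<pi>1 \<in> hom C P (apex R)" "\<pi>2 \<in> hom C P (apex S)" "rgt R \<cdot> \<pi>1 = lft S \<cdot> \<pi>2"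
  unfolding rs_pb_def using pb_hom[OF Rs(5) Ss(4)] by simp_all

lemma proj_hom: "px \<in> hom C P X" "py \<in> hom C P X" "pz \<in> hom C P X"
  unfolding px_def py_def pz_def using rs_pb_hom Rs Ss by blast+

lemma proj_comp:
  assumes "t \<in> hom C T P"
  shows "lft R \<cdot> (\<pi>1 \<cdot> t) = px \<cdot> t" "rgt R \<cdot> (\<pi>1 \<cdot> t) = py \<cdot> t"
    "lft S \<cdot> (\<pi>2 \<cdot> t) = py \<cdot> t" "rgt S \<cdot> (\<pi>2 \<cdot> t) = pz \<cdot> t"
  using hom_assoc[OF assms rs_pb_hom(2) Rs(4)] hom_assoc[OF assms rs_pb_hom(2) Rs(5)]
    hom_assoc[OF assms rs_pb_hom(3) Ss(4)] hom_assoc[OF assms rs_pb_hom(3) Ss(5)] rs_pb_hom(4)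
  unfolding px_def py_def pz_def by simp_all

lemma \<pi>1_eqI:
  assumes t: "t \<in> hom C T P" and u: "u \<in> hom C T P" and "px \<cdot> t = px \<cdot> u" "py \<cdot> t = py \<cdot> u"
  shows "\<pi>1 \<cdot> t = \<pi>1 \<cdot> u"
  using relation_joint_mono[OF Rr comp_hom[OF rs_pb_hom(2) t] comp_hom[OF rs_pb_hom(2) u]] proj_comp
    t u assms
  by simp

lemma \<pi>2_eqI:
  assumes t: "t \<in> hom C T P" and u: "u \<in> hom C T P" and "py \<cdot> t = py \<cdot> u" "pz \<cdot> t = pz \<cdot> u"
  shows "\<pi>2 \<cdot> t = \<pi>2 \<cdot> u"
  using relation_joint_mono[OF Sr comp_hom[OF rs_pb_hom(3) t] comp_hom[OF rs_pb_hom(3) u]] proj_comp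
    t u assms
  by simp

lemma \<pi>_joint_mono:
  assumes "t \<in> hom C T P" "u \<in> hom C T P" "\<pi>1 \<cdot> t = \<pi>1 \<cdot> u" "\<pi>2 \<cdot> t = \<pi>2 \<cdot> u"
  shows "t = u"
  using pb_joint_mono[OF Rs(5) Ss(4)] assms unfolding rs_pb_def by blast

lemma proj_joint_mono:
  assumes "t \<in> hom C T P" "u \<in> hom C T P" "px \<cdot> t = px \<cdot> u" "py \<cdot> t = py \<cdot> u" "pz \<cdot> t = pz \<cdot> u"
  shows "t = u"
  by (rule \<pi>_joint_mono[OF assms(1,2) \<pi>1_eqI[OF assms(1-4)] \<pi>2_eqI[OF assms(1,2,4,5)]])

lemma composable_proj:
  assumes t: "t \<in> hom C T P"
  shows "relates C R (px \<cdot> t) (py \<cdot> t)" "relates C S (py \<cdot> t) (pz \<cdot> t)"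
    "composable C R S (px \<cdot> t) (py \<cdot> t) (pz \<cdot> t)"
  using relatesI[OF Rr comp_hom[OF rs_pb_hom(2) t]] relatesI[OF Sr comp_hom[OF rs_pb_hom(3) t]]
    proj_comp[OF t]
  unfolding composable_def by simp_all

lemma proj_relates: "relates C R px py" "relates C S py pz"
  using composable_proj(1,2)[OF Idt_hom[OF rs_pb_hom(1)]] proj_hom by (simp_all add: hom_def)

lemma triple_eq:
  assumes t: "t \<in> hom C T P"
  shows "triple C R S (px \<cdot> t) (py \<cdot> t) (pz \<cdot> t) = t"
proof -
  have d: "Dom C (px \<cdot> t) = T" using comp_hom[OF proj_hom(1) t] by (simp add: hom_def)
  show ?thesis
    unfolding triple_def Let_def d
  proof (rule the_equality)
    show "t \<in> hom C T P \<and> lft R \<cdot> \<pi>1 \<cdot> t = px \<cdot> t \<and> rgt R \<cdot> \<pi>1 \<cdot> t = py \<cdot> t \<and>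
        lft S \<cdot> \<pi>2 \<cdot> t = py \<cdot> t \<and> rgt S \<cdot> \<pi>2 \<cdot> t = pz \<cdot> t"
      using t proj_comp[OF t] by simp
    fix u
    assume "u \<in> hom C T P \<and> lft R \<cdot> \<pi>1 \<cdot> u = px \<cdot> t \<and> rgt R \<cdot> \<pi>1 \<cdot> u = py \<cdot> t \<and>
        lft S \<cdot> \<pi>2 \<cdot> u = py \<cdot> t \<and> rgt S \<cdot> \<pi>2 \<cdot> u = pz \<cdot> t"
    then show "u = t" using proj_joint_mono[of u T t] proj_comp[of u T] t by simp
  qed
qed

lemma triple_unique:
  assumes "t \<in> hom C T P" "px \<cdot> t = x" "py \<cdot> t = y" "pz \<cdot> t = z"
  shows "triple C R S x y z = t"
  using triple_eq assms by blast

lemma triple: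
  assumes x: "x \<in> hom C T X" and y: "y \<in> hom C T X" and xy: "relates C R x y"
    and yz: "relates C S y z"
  shows "triple C R S x y z \<in> hom C T P" "px \<cdot> triple C R S x y z = x" "py \<cdot> triple C R S x y z = y"
    "pz \<cdot> triple C R S x y z = z"
proof -
  obtain r where r: "r \<in> hom C T (apex R)" "lft R \<cdot> r = x" "rgt R \<cdot> r = y"
    using xy relates_iff[OF x] by blast
  obtain s where s: "s \<in> hom C T (apex S)" "lft S \<cdot> s = y" "rgt S \<cdot> s = z"
    using yz relates_iff[OF y] by blast
  have "rgt R \<cdot> r = lft S \<cdot> s" using r s by simp
  from pb_elem[OF Rs(5) Ss(4) r(1) s(1) this]
  obtain t where t: "t \<in> hom C T P" "\<pi>1 \<cdot> t = r" "\<pi>2 \<cdot> t = s" unfolding rs_pb_def by blast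
  have p: "px \<cdot> t = x" "py \<cdot> t = y" "pz \<cdot> t = z" using proj_comp[OF t(1)] t r s by simp_all
  then have "triple C R S x y z = t" by (rule triple_unique[OF t(1)])
  then show "triple C R S x y z \<in> hom C T P" "px \<cdot> triple C R S x y z = x"
    "py \<cdot> triple C R S x y z = y"
    "pz \<cdot> triple C R S x y z = z"
    using t p by simp_all
qed

lemma triple_comp:
  assumes x: "x \<in> hom C T X" and y: "y \<in> hom C T X" and xy: "relates C R x y"
    and yz: "relates C S y z"
    and c: "c \<in> hom C U T"
  shows "triple C R S x y z \<cdot> c = triple C R S (x \<cdot> c) (y \<cdot> c) (z \<cdot> c)"
proof -
  note t = triple[OF x y xy yz]
  show ?thesis
    by (rule triple_unique[symmetric, OF comp_hom[OF t(1) c]])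
      (use whisker[OF t(2,1) proj_hom(1) c] whisker[OF t(3,1) proj_hom(2) c] whisker[OF t(4,1) proj_hom(3) c] in simp_all)
qed

lemma app_comp:
  assumes p: "p \<in> hom C P X'" and x: "x \<in> hom C T X" and y: "y \<in> hom C T X"
    and xy: "relates C R x y" and yz: "relates C S y z" and c: "c \<in> hom C U T"
  shows "(p \<cdot> triple C R S x y z) \<cdot> c = p \<cdot> triple C R S (x \<cdot> c) (y \<cdot> c) (z \<cdot> c)"
  using hom_assoc[OF c triple(1)[OF x y xy yz] p] triple_comp[OF x y xy yz c] by simp

end

locale connected_pair = eq_pair C X R S for C :: "('o, 'm) cat" (structure) and X R S +
  fixes p :: 'm
  assumes connector: "connector C X R S p"
begin

definition "ap x y z = p \<cdot> triple C R S x y z"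

lemma p_hom: "p \<in> hom C P X"
  using connector unfolding connector_def by simp

lemma ap_hom:
  assumes "x \<in> hom C T X" "y \<in> hom C T X" "relates C R x y" "relates C S y z"
  shows "ap x y z \<in> hom C T X"
  unfolding ap_def using p_hom triple(1)[OF assms] by blast

lemma ap_comp:
  assumes "x \<in> hom C T X" "y \<in> hom C T X" "relates C R x y" "relates C S y z" "c \<in> hom C U T"
  shows "ap x y z \<cdot> c = ap (x \<cdot> c) (y \<cdot> c) (z \<cdot> c)"
  unfolding ap_def by (rule app_comp[OF p_hom assms])

lemma ap_proj:
  assumes "t \<in> hom C T P"
  shows "ap (px \<cdot> t) (py \<cdot> t) (pz \<cdot> t) = p \<cdot> t"
  unfolding ap_def triple_eq[OF assms] ..

lemma ap_proj_Idt: "ap px py pz = p"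
  using ap_proj[OF Idt_hom[OF rs_pb_hom(1)]] proj_hom p_hom by (simp add: hom_def)

lemma connector_laws:
  assumes "T \<in> Obj C"
  shows "\<forall>x \<in> hom C T X. \<forall>y \<in> hom C T X. \<forall>z \<in> hom C T X. composable C R S x y z \<longrightarrow>
      relates C S x (ap x y z) \<and> relates C R (ap x y z) z"
    "\<forall>x \<in> hom C T X. \<forall>y \<in> hom C T X. composable C R S x x y \<longrightarrow> ap x x y = y"
    "\<forall>x \<in> hom C T X. \<forall>y \<in> hom C T X. composable C R S x y y \<longrightarrow> ap x y y = x"
    "\<forall>x \<in> hom C T X. \<forall>y \<in> hom C T X. \<forall>z \<in> hom C T X. \<forall>u \<in> hom C T X. \<forall>v \<in> hom C T X.
      composable C R S z u v \<and> composable C R S x y (ap z u v) \<and> composable C R S x y z \<and>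
      composable C R S (ap x y z) u v \<longrightarrow> ap x y (ap z u v) = ap (ap x y z) u v"
proof -
  note *
    = conjunct2[OF connector[unfolded connector_def Let_def], rule_format, OF assms, folded ap_def]
  show "\<forall>x \<in> hom C T X. \<forall>y \<in> hom C T X. \<forall>z \<in> hom C T X. composable C R S x y z \<longrightarrow>
      relates C S x (ap x y z) \<and> relates C R (ap x y z) z"
    by (rule *[THEN conjunct1])
  show "\<forall>x \<in> hom C T X. \<forall>y \<in> hom C T X. composable C R S x x y \<longrightarrow> ap x x y = y"
    by (rule *[THEN conjunct2, THEN conjunct1])
  show "\<forall>x \<in> hom C T X. \<forall>y \<in> hom C T X. composable C R S x y y \<longrightarrow> ap x y y = x"
    by (rule *[THEN conjunct2, THEN conjunct2, THEN conjunct1])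
  show "\<forall>x \<in> hom C T X. \<forall>y \<in> hom C T X. \<forall>z \<in> hom C T X. \<forall>u \<in> hom C T X. \<forall>v \<in> hom C T X.
      composable C R S z u v \<and> composable C R S x y (ap z u v) \<and> composable C R S x y z \<and>
      composable C R S (ap x y z) u v \<longrightarrow> ap x y (ap z u v) = ap (ap x y z) u v"
    by (rule *[THEN conjunct2, THEN conjunct2, THEN conjunct2])
qed

lemma ap_relates:
  assumes "x \<in> hom C T X" "y \<in> hom C T X" "z \<in> hom C T X" "relates C R x y" "relates C S y z"
  shows "relates C S x (ap x y z)" "relates C R (ap x y z) z"
  using connector_laws(1)[OF hom_Obj(1)[OF assms(1)], rule_format, OF assms(1-3)] assms(4,5)
  unfolding composable_def by simp_all

lemma ap_left:
  assumes "x \<in> hom C T X" "y \<in> hom C T X" "relates C S x y"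
  shows "ap x x y = y"
  using connector_laws(2)[OF hom_Obj(1)[OF assms(1)], rule_format, OF assms(1,2)] assms(3)
    eqrel_refl[OF R assms(1)]
  unfolding composable_def by simp

lemma ap_right:
  assumes "x \<in> hom C T X" "y \<in> hom C T X" "relates C R x y"
  shows "ap x y y = x"
  using connector_laws(3)[OF hom_Obj(1)[OF assms(1)], rule_format, OF assms(1,2)] assms(3)
    eqrel_refl[OF S assms(2)]
  unfolding composable_def by simp

text \<open>Two of the four composability conditions in the axiom follow along the chain, from
  \<open>y S z S p(z,u,v)\<close> and from \<open>p(x,y,z) R z R u\<close>.\<close>

lemma ap_assoc:
  assumes h: "x \<in> hom C T X" "y \<in> hom C T X" "z \<in> hom C T X" "u \<in> hom C T X" "v \<in> hom C T X"
    and r: "relates C R x y" "relates C S y z" "relates C R z u" "relates C S u v"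
  shows "ap x y (ap z u v) = ap (ap x y z) u v"
proof -
  have 1: "relates C S y (ap z u v)"
    by (rule eqrel_trans[OF S h(2,3) r(2) ap_relates(1)[OF h(3-5) r(3,4)]])
  have 2: "relates C R (ap x y z) u"
    by (rule eqrel_trans[OF R ap_hom[OF h(1,2) r(1,2)] h(3) ap_relates(2)[OF h(1-3) r(1,2)] r(3)])
  show ?thesis
    using connector_laws(4)[OF hom_Obj(1)[OF h(1)], rule_format, OF h] r 1 2
      unfolding composable_def by simp
qed

end

context eq_pair
begin

text \<open>Associativity has to be checked only on chains \<open>x R y S z R u S v\<close>, the
  shape that can be lifted along a quotient map.\<close>

lemma connectorI:
  assumes p: "p \<in> hom C P X"
    and rel: "\<And>T x y z. x \<in> hom C T X \<Longrightarrow> y \<in> hom C T X \<Longrightarrow> z \<in> hom C T X \<Longrightarrow>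
      relates C R x y \<Longrightarrow> relates C S y z \<Longrightarrow>
      relates C S x (p \<cdot> triple C R S x y z) \<and> relates C R (p \<cdot> triple C R S x y z) z"
    and left: "\<And>T x y. x \<in> hom C T X \<Longrightarrow> y \<in> hom C T X \<Longrightarrow> relates C S x y \<Longrightarrow> p \<cdot> triple C R S x x y = y"
    and right: "\<And>T x y. x \<in> hom C T X \<Longrightarrow> y \<in> hom C T X \<Longrightarrow> relates C R x y \<Longrightarrow> p \<cdot> triple C R S x y y = x"
    and assoc: "\<And>T x y z u v. x \<in> hom C T X \<Longrightarrow> y \<in> hom C T X \<Longrightarrow> z \<in> hom C T X \<Longrightarrow> u \<in> hom C T X \<Longrightarrow>
      v \<in> hom C T X \<Longrightarrow> relates C R x y \<Longrightarrow> relates C S y z \<Longrightarrow> relates C R z u \<Longrightarrow> relates C S u v \<Longrightarrow>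
      p \<cdot> triple C R S x y (p \<cdot> triple C R S z u v) = p \<cdot> triple C R S (p \<cdot> triple C R S x y z) u v"
  shows "connector C X R S p"
  unfolding connector_def Let_def
proof (intro conjI ballI impI)
  fix T x y assume "x \<in> hom C T X" "y \<in> hom C T X" "composable C R S x x y"
  then show "p \<cdot> triple C R S x x y = y" unfolding composable_def using left by blast
next
  fix T x y assume "x \<in> hom C T X" "y \<in> hom C T X" "composable C R S x y y"
  then show "p \<cdot> triple C R S x y y = x" unfolding composable_def using right by blast
next
  fix T x y z assume "x \<in> hom C T X" "y \<in> hom C T X" "z \<in> hom C T X" "composable C R S x y z"
  then show "relates C S x (p \<cdot> triple C R S x y z)" "relates C R (p \<cdot> triple C R S x y z) z"
    unfolding composable_def using rel by blast+
next
  fix T x y z u v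
  assume h: "x \<in> hom C T X" "y \<in> hom C T X" "z \<in> hom C T X" "u \<in> hom C T X" "v \<in> hom C T X"
    and "composable C R S z u v \<and> composable C R S x y (p \<cdot> triple C R S z u v) \<and>
      composable C R S x y z \<and> composable C R S (p \<cdot> triple C R S x y z) u v"
  then show "p \<cdot> triple C R S x y (p \<cdot> triple C R S z u v) = p \<cdot> triple C R S (p \<cdot> triple C R S x y z) u v"
    unfolding composable_def using assoc[OF h] by simp
qed (rule p)

end

section \<open>Morphisms of pairs and the induced map between the pullbacks\<close>

locale eq2_arrow = goursat_cat C + A: eq_pair C X R S + B: eq_pair C X' R' S'
  for C :: "('o, 'm) cat" (structure) and X R S X' R' S' +
  fixes fR fS f :: 'm
  assumes arrow: "is_eq2_arrow C (Eq2 R S X) (Eq2 R' S' X') fR fS f"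
begin

abbreviation "F \<equiv> induced C (Eq2 R S X) (Eq2 R' S' X') fR fS"

lemma f_hom: "f \<in> hom C X X'" "fR \<in> hom C (apex R) (apex R')" "fS \<in> hom C (apex S) (apex S')"
  and f_comm: "lft R' \<cdot> fR = f \<cdot> lft R" "rgt R' \<cdot> fR = f \<cdot> rgt R" "lft S' \<cdot> fS = f \<cdot> lft S"
    "rgt S' \<cdot> fS = f \<cdot> rgt S"
  using arrow unfolding is_eq2_arrow_def by simp_all

lemma relates_R:
  assumes x: "x \<in> hom C T X" and xy: "relates C R x y"
  shows "relates C R' (f \<cdot> x) (f \<cdot> y)"
proof -
  obtain r where r: "r \<in> hom C T (apex R)" "lft R \<cdot> r = x" "rgt R \<cdot> r = y"
    using xy relates_iff[OF x] by blast
  show ?thesis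
    using relatesI[OF B.Rr comp_hom[OF f_hom(2) r(1)]] whisker[OF f_comm(1) f_hom(2) B.Rs(4) r(1)]
      whisker[OF f_comm(2) f_hom(2) B.Rs(5) r(1)] hom_assoc[OF r(1) A.Rs(4) f_hom(1)]
      hom_assoc[OF r(1) A.Rs(5) f_hom(1)] r by simp
qed

lemma relates_S:
  assumes x: "x \<in> hom C T X" and xy: "relates C S x y"
  shows "relates C S' (f \<cdot> x) (f \<cdot> y)"
proof -
  obtain r where r: "r \<in> hom C T (apex S)" "lft S \<cdot> r = x" "rgt S \<cdot> r = y"
    using xy relates_iff[OF x] by blast
  show ?thesis
    using relatesI[OF B.Sr comp_hom[OF f_hom(3) r(1)]] whisker[OF f_comm(3) f_hom(3) B.Ss(4) r(1)]
      whisker[OF f_comm(4) f_hom(3) B.Ss(5) r(1)] hom_assoc[OF r(1) A.Ss(4) f_hom(1)]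
      hom_assoc[OF r(1) A.Ss(5) f_hom(1)] r by simp
qed

lemma F_eq: "F = triple C R' S' (f \<cdot> A.px) (f \<cdot> A.py) (f \<cdot> A.pz)"
  and F_hom: "F \<in> hom C A.P B.P"
proof -
  have "rgt R' \<cdot> (fR \<cdot> A.\<pi>1) = lft S' \<cdot> (fS \<cdot> A.\<pi>2)"
    using whisker[OF f_comm(2) f_hom(2) B.Rs(5) A.rs_pb_hom(2)]
      whisker[OF f_comm(3) f_hom(3) B.Ss(4) A.rs_pb_hom(3)]
      hom_assoc[OF A.rs_pb_hom(2) A.Rs(5) f_hom(1)] hom_assoc[OF A.rs_pb_hom(3) A.Ss(4) f_hom(1)]
        A.rs_pb_hom(4)
    by simp
  from pb_ex1[OF B.Rs(5) B.Ss(4) comp_hom[OF f_hom(2) A.rs_pb_hom(2)] comp_hom[OF f_hom(3) A.rs_pb_hom(3)] this]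
  have "\<exists>!h. h \<in> hom C A.P B.P \<and> B.\<pi>1 \<cdot> h = fR \<cdot> A.\<pi>1 \<and> B.\<pi>2 \<cdot> h = fS \<cdot> A.\<pi>2"
    unfolding rs_pb_def .
  from theI'[OF this]
  have F: "F \<in> hom C A.P B.P" "B.\<pi>1 \<cdot> F = fR \<cdot> A.\<pi>1" "B.\<pi>2 \<cdot> F = fS \<cdot> A.\<pi>2"
    unfolding induced_def Let_def by simp_all
  show "F \<in> hom C A.P B.P" by (rule F(1))
  have "B.px \<cdot> F = f \<cdot> A.px" "B.py \<cdot> F = f \<cdot> A.py" "B.pz \<cdot> F = f \<cdot> A.pz"
    using B.proj_comp[OF F(1)] F whisker[OF f_comm(1) f_hom(2) B.Rs(4) A.rs_pb_hom(2)]
      whisker[OF f_comm(2) f_hom(2) B.Rs(5) A.rs_pb_hom(2)]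
        whisker[OF f_comm(4) f_hom(3) B.Ss(5) A.rs_pb_hom(3)]
      hom_assoc[OF A.rs_pb_hom(2) A.Rs(4) f_hom(1)] hom_assoc[OF A.rs_pb_hom(2) A.Rs(5) f_hom(1)]
      hom_assoc[OF A.rs_pb_hom(3) A.Ss(5) f_hom(1)]
    unfolding A.px_def A.py_def A.pz_def by simp_all
  then show "F = triple C R' S' (f \<cdot> A.px) (f \<cdot> A.py) (f \<cdot> A.pz)"
    by (rule B.triple_unique[OF F(1), symmetric])
qed

lemma proj_F:
  assumes t: "t \<in> hom C T A.P"
  shows "B.px \<cdot> (F \<cdot> t) = f \<cdot> (A.px \<cdot> t)" "B.py \<cdot> (F \<cdot> t) = f \<cdot> (A.py \<cdot> t)"
    "B.pz \<cdot> (F \<cdot> t) = f \<cdot> (A.pz \<cdot> t)"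
proof -
  have r: "relates C R' (f \<cdot> A.px) (f \<cdot> A.py)" "relates C S' (f \<cdot> A.py) (f \<cdot> A.pz)"
    using relates_R relates_S A.proj_relates A.proj_hom by blast+
  note tr
    = B.triple[OF comp_hom[OF f_hom(1) A.proj_hom(1)] comp_hom[OF f_hom(1) A.proj_hom(2)] r, folded F_eq]
  show "B.px \<cdot> (F \<cdot> t) = f \<cdot> (A.px \<cdot> t)" "B.py \<cdot> (F \<cdot> t) = f \<cdot> (A.py \<cdot> t)"
    "B.pz \<cdot> (F \<cdot> t) = f \<cdot> (A.pz \<cdot> t)"
    using whisker[OF tr(2,1) B.proj_hom(1) t] whisker[OF tr(3,1) B.proj_hom(2) t]
      whisker[OF tr(4,1) B.proj_hom(3) t]
      hom_assoc[OF t A.proj_hom(1) f_hom(1)] hom_assoc[OF t A.proj_hom(2) f_hom(1)]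
        hom_assoc[OF t A.proj_hom(3) f_hom(1)]
    by simp_all
qed

lemma F_triple:
  assumes x: "x \<in> hom C T X" and y: "y \<in> hom C T X" and xy: "relates C R x y"
    and yz: "relates C S y z"
  shows "F \<cdot> triple C R S x y z = triple C R' S' (f \<cdot> x) (f \<cdot> y) (f \<cdot> z)"
proof -
  note t = A.triple[OF x y xy yz]
  show ?thesis
    by (rule B.triple_unique[symmetric, OF comp_hom[OF F_hom t(1)]])
      (simp_all add: proj_F[OF t(1)] t)
qed

end

section \<open>Naturality and descent of connectors\<close>

context eq2_arrow
begin

text \<open>Writing \<open>q\<close> for the target connector, the Shifting Lemma gives
  \<open>q(f y, f x, f p(x, y, z)) = f z\<close> from its evident instances at \<open>(x, y, y)\<close>, \<open>(y, y, y)\<close> and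
  \<open>(y, y, z)\<close>; applying \<open>q(f x, f y, -)\<close> to both sides yields the claim.\<close>

lemma preserves_connector:
  assumes p: "connector C X R S p" and q: "connector C X' R' S' q"
  shows "f \<cdot> p = q \<cdot> F"
proof -
  interpret P: connected_pair C X R S p by unfold_locales (rule p)
  interpret Q: connected_pair C X' R' S' q by unfold_locales (rule q)
  note x = A.proj_hom(1) and y = A.proj_hom(2) and z = A.proj_hom(3) and ph = P.p_hom
  note fx = comp_hom[OF f_hom(1) x] and fy = comp_hom[OF f_hom(1) y] and fz
    = comp_hom[OF f_hom(1) z]
    and fp = comp_hom[OF f_hom(1) ph]
  note pr = P.ap_relates[OF x y z A.proj_relates, unfolded P.ap_proj_Idt]
  note yy = eqrel_refl[OF A.R y] eqrel_refl[OF A.S y]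
  have r1: "relates C R' (f \<cdot> A.py) (f \<cdot> A.px)"
    by (rule relates_R[OF y eqrel_sym[OF A.R x A.proj_relates(1)]])
  have r1': "relates C R' (f \<cdot> A.px) (f \<cdot> A.py)" by (rule relates_R[OF x A.proj_relates(1)])
  have r2: "relates C S' (f \<cdot> A.px) (f \<cdot> p)" by (rule relates_S[OF x pr(1)])
  have r3: "relates C S' (f \<cdot> A.py) (f \<cdot> A.pz)" by (rule relates_S[OF y A.proj_relates(2)])
  \<comment> \<open>The value of \<open>k\<close> is known wherever a law of \<open>p\<close>
    applies: at \<open>(x,y,y)\<close> and \<open>(y,y,y)\<close> it is \<open>f y\<close>, and at
    \<open>(y,y,z)\<close> it is \<open>f z\<close>.\<close>
  define k where "k = Q.ap (f \<cdot> A.py) (f \<cdot> A.px) (f \<cdot> p)"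
  have k: "k \<in> hom C A.P X'" unfolding k_def by (rule Q.ap_hom[OF fy fx r1 r2])
  have kt: "k \<cdot> t = Q.ap (f \<cdot> (A.py \<cdot> t)) (f \<cdot> (A.px \<cdot> t)) (f \<cdot> (p \<cdot> t))" if t: "t \<in> hom C T A.P"
    for T t
    unfolding k_def
    using Q.ap_comp[OF fy fx r1 r2 t] hom_assoc[OF t x f_hom(1)] hom_assoc[OF t y f_hom(1)]
      hom_assoc[OF t ph f_hom(1)]
    by simp
  let ?a = "Idt C A.P" and ?b = "triple C R S A.px A.py A.py" and ?c = "triple C R S A.py A.py A.py"
    and ?d = "triple C R S A.py A.py A.pz"
  have a: "?a \<in> hom C A.P A.P" by (rule Idt_hom[OF A.rs_pb_hom(1)])
  have pa: "A.px \<cdot> ?a = A.px" "A.py \<cdot> ?a = A.py" "A.pz \<cdot> ?a = A.pz" using x y z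
    by (simp_all add: hom_def)
  note b = A.triple[OF x y A.proj_relates(1) yy(2)] and c = A.triple[OF y y yy]
    and d = A.triple[OF y y yy(1) A.proj_relates(2)]
  \<comment> \<open>The corners \<open>(x,y,z)\<close>, \<open>(x,y,y)\<close>,
    \<open>(y,y,y)\<close>, \<open>(y,y,z)\<close> form a rectangle, as \<open>A.\<pi>1\<close>
    records the first two entries and \<open>A.\<pi>2\<close> the last two. A triple is determined
    by both, so the side condition is immediate.\<close>
  have "k \<cdot> ?a = k \<cdot> ?d"
  proof (rule kernel_shifting[OF A.rs_pb_hom(3,2) k a b(1) c(1) d(1)])
    show "A.\<pi>1 \<cdot> ?a = A.\<pi>1 \<cdot> ?b" by (rule A.\<pi>1_eqI[OF a b(1)]) (simp_all add: b pa)
    show "A.\<pi>2 \<cdot> ?b = A.\<pi>2 \<cdot> ?c" by (rule A.\<pi>2_eqI[OF b(1) c(1)]) (simp_all add: b c)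
    show "A.\<pi>1 \<cdot> ?c = A.\<pi>1 \<cdot> ?d" by (rule A.\<pi>1_eqI[OF c(1) d(1)]) (simp_all add: c d)
    show "A.\<pi>2 \<cdot> ?a = A.\<pi>2 \<cdot> ?d" by (rule A.\<pi>2_eqI[OF a d(1)]) (simp_all add: d pa)
    have "p \<cdot> ?b = A.px" using P.ap_right[OF x y A.proj_relates(1)] by (simp add: P.ap_def)
    moreover have "p \<cdot> ?c = A.py" using P.ap_right[OF y y yy(1)] by (simp add: P.ap_def)
    ultimately show "k \<cdot> ?b = k \<cdot> ?c"
      unfolding kt[OF b(1)] kt[OF c(1)] b c
      using Q.ap_right[OF fy fx r1] Q.ap_right[OF fy fy eqrel_refl[OF B.R fy]] by simp
    show "k \<cdot> u = k \<cdot> v" if "u \<in> hom C T A.P" "v \<in> hom C T A.P" "A.\<pi>2 \<cdot> u = A.\<pi>2 \<cdot> v"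
      "A.\<pi>1 \<cdot> u = A.\<pi>1 \<cdot> v" for T u v
      using A.\<pi>_joint_mono[OF that(1,2,4,3)] by simp
  qed
  moreover have "p \<cdot> ?d = A.pz" using P.ap_left[OF y z A.proj_relates(2)] by (simp add: P.ap_def)
  ultimately have kz: "k = f \<cdot> A.pz"
    using k Q.ap_left[OF fy fz r3] unfolding kt[OF d(1)] d by (simp add: hom_def)
  \<comment> \<open>Expanding one \<open>f x\<close> as \<open>q(f x, f y, f y)\<close> makes room
    for associativity, which regroups the term around \<open>k\<close>.\<close>
  have "f \<cdot> p = Q.ap (f \<cdot> A.px) (f \<cdot> A.px) (f \<cdot> p)" by (rule Q.ap_left[OF fx fp r2, symmetric])
  also have "\<dots> = Q.ap (Q.ap (f \<cdot> A.px) (f \<cdot> A.py) (f \<cdot> A.py)) (f \<cdot> A.px) (f \<cdot> p)"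
    using Q.ap_right[OF fx fy r1'] by simp
  also have "\<dots> = Q.ap (f \<cdot> A.px) (f \<cdot> A.py) k"
    unfolding k_def
      by (rule Q.ap_assoc[OF fx fy fy fx fp r1' eqrel_refl[OF B.S fy] r1 r2, symmetric])
  also have "\<dots> = q \<cdot> F" unfolding kz Q.ap_def F_eq ..
  finally show ?thesis .
qed

text \<open>A triple \<open>x' R' y' S' z'\<close> is read as two elements \<open>(x', x')\<close>
  and \<open>(y', z')\<close> of \<open>S'\<close> whose left entries are related by
  \<open>R'\<close>. Applying \<open>lift_related\<close> to \<open>fS\<close>, with the diagonal of
  \<open>S\<close> as section, yields lifts \<open>s\<close> and \<open>t\<close> in
  \<open>S\<close> with left entries related by \<open>R\<close>, and these glue to a triple. Hence
  the generic triple of the target lifts locally.\<close>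

lemma F_cover:
  assumes fR: "fR \<in> cover (apex R) (apex R')" and fS: "fS \<in> cover (apex S) (apex S')"
  shows "F \<in> cover A.P B.P"
proof -
  have i: "Idt C X \<in> hom C X X" and i': "Idt C X' \<in> hom C X' X'" using A.Rs(1) B.Rs(1) by blast+
  obtain \<sigma> where \<sigma>: "\<sigma> \<in> hom C X (apex S)" "lft S \<cdot> \<sigma> = Idt C X" "rgt S \<cdot> \<sigma> = Idt C X"
    using eqrel_refl[OF A.S i] relates_iff[OF i] by blast
  obtain \<sigma>' where \<sigma>': "\<sigma>' \<in> hom C X' (apex S')" "lft S' \<cdot> \<sigma>' = Idt C X'" "rgt S' \<cdot> \<sigma>' = Idt C X'"
    using eqrel_refl[OF B.S i'] relates_iff[OF i'] by blast
  have "fS \<cdot> \<sigma> = \<sigma>' \<cdot> f"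
  proof (rule relation_joint_mono[OF B.Sr comp_hom[OF f_hom(3) \<sigma>(1)] comp_hom[OF \<sigma>'(1) f_hom(1)]])
    have "f \<cdot> Idt C X = f" "Idt C X' \<cdot> f = f" using f_hom(1) by (simp_all add: hom_def)
    then show "lft S' \<cdot> (fS \<cdot> \<sigma>) = lft S' \<cdot> (\<sigma>' \<cdot> f)" "rgt S' \<cdot> (fS \<cdot> \<sigma>) = rgt S' \<cdot> (\<sigma>' \<cdot> f)"
      using whisker[OF f_comm(3) f_hom(3) B.Ss(4) \<sigma>(1)] whisker[OF f_comm(4) f_hom(3) B.Ss(5) \<sigma>(1)]
        hom_assoc[OF \<sigma>(1) A.Ss(4) f_hom(1)] hom_assoc[OF \<sigma>(1) A.Ss(5) f_hom(1)]
        whisker[OF \<sigma>'(2,1) B.Ss(4) f_hom(1)] whisker[OF \<sigma>'(3,1) B.Ss(5) f_hom(1)] \<sigma>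
      by simp_all
  qed
  note \<sigma>\<sigma>' = \<sigma>'(1) this
  note x' = B.proj_hom(1) and y' = B.proj_hom(2) and z' = B.proj_hom(3)
  have a: "\<sigma>' \<cdot> B.px \<in> hom C B.P (apex S')" using \<sigma>'(1) x' by blast
  have la: "lft S' \<cdot> (\<sigma>' \<cdot> B.px) = B.px"
    using whisker[OF \<sigma>'(2,1) B.Ss(4) x'] x' by (simp add: hom_def)
  have lb: "lft S' \<cdot> B.\<pi>2 = B.py" "rgt S' \<cdot> B.\<pi>2 = B.pz"
    using B.rs_pb_hom(4) by (simp_all add: B.py_def B.pz_def)
  have "relates C R' (lft S' \<cdot> (\<sigma>' \<cdot> B.px)) (lft S' \<cdot> B.\<pi>2)" unfolding la lb
    by (rule B.proj_relates(1))
  from lift_related[OF A.R B.R f_hom(1) fR f_comm(1,2) A.Ss(4) B.Ss(4) fS f_comm(3) \<sigma>(1,2) \<sigma>\<sigma>' a B.rs_pb_hom(3) this]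
  obtain T c s t where c: "c \<in> cover T B.P" and s: "s \<in> hom C T (apex S)"
    and t: "t \<in> hom C T (apex S)"
    and fs: "fS \<cdot> s = (\<sigma>' \<cdot> B.px) \<cdot> c" and ft: "fS \<cdot> t = B.\<pi>2 \<cdot> c"
      and st: "relates C R (lft S \<cdot> s) (lft S \<cdot> t)" .
  have ch: "c \<in> hom C T B.P" using c by simp
  note ls = comp_hom[OF A.Ss(4) s] and lt = comp_hom[OF A.Ss(4) t] and rt = comp_hom[OF A.Ss(5) t]
  note tr = A.triple[OF ls lt st relatesI[OF A.Sr t]]
  let ?t = "triple C R S (lft S \<cdot> s) (lft S \<cdot> t) (rgt S \<cdot> t)"
  have "F \<cdot> ?t = c"
  proof (rule B.proj_joint_mono[OF comp_hom[OF F_hom tr(1)] ch])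
    have "f \<cdot> (lft S \<cdot> s) = lft S' \<cdot> (fS \<cdot> s)"
      using whisker[OF f_comm(3) f_hom(3) B.Ss(4) s] hom_assoc[OF s A.Ss(4) f_hom(1)] by simp
    also have "\<dots> = B.px \<cdot> c"
      unfolding fs using hom_assoc[OF ch a B.Ss(4)] la by simp
    finally show "B.px \<cdot> (F \<cdot> ?t) = B.px \<cdot> c" unfolding proj_F[OF tr(1)] tr .
    have "f \<cdot> (lft S \<cdot> t) = lft S' \<cdot> (fS \<cdot> t)"
      using whisker[OF f_comm(3) f_hom(3) B.Ss(4) t] hom_assoc[OF t A.Ss(4) f_hom(1)] by simp
    also have "\<dots> = B.py \<cdot> c" unfolding ft by (rule B.proj_comp(3)[OF ch])
    finally show "B.py \<cdot> (F \<cdot> ?t) = B.py \<cdot> c" unfolding proj_F[OF tr(1)] tr .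
    have "f \<cdot> (rgt S \<cdot> t) = rgt S' \<cdot> (fS \<cdot> t)"
      using whisker[OF f_comm(4) f_hom(3) B.Ss(5) t] hom_assoc[OF t A.Ss(5) f_hom(1)] by simp
    also have "\<dots> = B.pz \<cdot> c" unfolding ft by (rule B.proj_comp(4)[OF ch])
    finally show "B.pz \<cdot> (F \<cdot> ?t) = B.pz \<cdot> c" unfolding proj_F[OF tr(1)] tr .
  qed
  then show ?thesis by (rule cover_if_local_section[OF F_hom c tr(1)])
qed

text \<open>The gluing argument one level up: \<open>lift_related\<close> is applied to triples in
  place of pairs, with \<open>A.pz\<close> as projection, the diagonal triple as section, and
  \<open>F\<close> as the map along which triples lift. This needs \<open>F_cover\<close>
  first.\<close>

lemma lift_chain:
  assumes fR: "fR \<in> cover (apex R) (apex R')" and fS: "fS \<in> cover (apex S) (apex S')"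
    and h: "x' \<in> hom C T X'" "y' \<in> hom C T X'" "z' \<in> hom C T X'" "u' \<in> hom C T X'" "v' \<in> hom C T X'"
    and r: "relates C R' x' y'" "relates C S' y' z'" "relates C R' z' u'" "relates C S' u' v'"
  obtains U c x y z u v where "c \<in> cover U T"
    "x \<in> hom C U X" "y \<in> hom C U X" "z \<in> hom C U X" "u \<in> hom C U X" "v \<in> hom C U X"
    "relates C R x y" "relates C S y z" "relates C R z u" "relates C S u v"
    "f \<cdot> x = x' \<cdot> c" "f \<cdot> y = y' \<cdot> c" "f \<cdot> z = z' \<cdot> c" "f \<cdot> u = u' \<cdot> c" "f \<cdot> v = v' \<cdot> c"
proof -
  have i: "Idt C X \<in> hom C X X" and i': "Idt C X' \<in> hom C X' X'" using A.Rs(1) B.Rs(1) by blast+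
  let ?\<sigma> = "triple C R S (Idt C X) (Idt C X) (Idt C X)" and ?\<sigma>'
    = "triple C R' S' (Idt C X') (Idt C X') (Idt C X')"
  note \<sigma> = A.triple[OF i i eqrel_refl[OF A.R i] eqrel_refl[OF A.S i]]
    and \<sigma>' = B.triple[OF i' i' eqrel_refl[OF B.R i'] eqrel_refl[OF B.S i']]
  have "f \<cdot> Idt C X = f" "Idt C X' \<cdot> f = f" using f_hom(1) by (simp_all add: hom_def)
  then have F\<sigma>: "F \<cdot> ?\<sigma> = ?\<sigma>' \<cdot> f"
    using F_triple[OF i i eqrel_refl[OF A.R i] eqrel_refl[OF A.S i]]
      B.triple_comp[OF i' i' eqrel_refl[OF B.R i'] eqrel_refl[OF B.S i'] f_hom(1)] by simp
  have Fz: "B.pz \<cdot> F = f \<cdot> A.pz"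
    using proj_F(3)[OF Idt_hom[OF A.rs_pb_hom(1)]] F_hom A.proj_hom by (simp add: hom_def)
  \<comment> \<open>The second half of the chain is encoded backwards as the degenerate triple
    \<open>(v', v', u')\<close>, so that the link \<open>z' R' u'\<close> joins the last entries of
    both triples.\<close>
  note a = B.triple[OF h(1,2) r(1,2)]
    and b = B.triple[OF h(5,5) eqrel_refl[OF B.R h(5)] eqrel_sym[OF B.S h(4) r(4)]]
  have "relates C R' (B.pz \<cdot> triple C R' S' x' y' z') (B.pz \<cdot> triple C R' S' v' v' u')" unfolding a
    b by (rule r(3))
  from lift_related[OF A.R B.R f_hom(1) fR f_comm(1,2) A.proj_hom(3) B.proj_hom(3) F_cover[OF fR fS] Fz \<sigma>(1,4) \<sigma>'(1) F\<sigma>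
      a(1) b(1) this]
  obtain U c s t where c: "c \<in> cover U T" and s: "s \<in> hom C U A.P" and t: "t \<in> hom C U A.P"
    and Fs: "F \<cdot> s = triple C R' S' x' y' z' \<cdot> c" and Ft: "F \<cdot> t = triple C R' S' v' v' u' \<cdot> c"
    and st: "relates C R (A.pz \<cdot> s) (A.pz \<cdot> t)" .
  have ch: "c \<in> hom C U T" using c by simp
  show thesis
  proof (rule that[OF c])
    show "A.px \<cdot> s \<in> hom C U X" "A.py \<cdot> s \<in> hom C U X" "A.pz \<cdot> s \<in> hom C U X" "A.pz \<cdot> t \<in> hom C U X"
      "A.py \<cdot> t \<in> hom C U X"
      using A.proj_hom s t by blast+
    show "relates C R (A.px \<cdot> s) (A.py \<cdot> s)" "relates C S (A.py \<cdot> s) (A.pz \<cdot> s)"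
      by (rule A.composable_proj[OF s])+
    show "relates C R (A.pz \<cdot> s) (A.pz \<cdot> t)" by (rule st)
    show "relates C S (A.pz \<cdot> t) (A.py \<cdot> t)"
      by (rule eqrel_sym[OF A.S comp_hom[OF A.proj_hom(2) t] A.composable_proj(2)[OF t]])
    show "f \<cdot> (A.px \<cdot> s) = x' \<cdot> c" "f \<cdot> (A.py \<cdot> s) = y' \<cdot> c" "f \<cdot> (A.pz \<cdot> s) = z' \<cdot> c"
      using proj_F[OF s] whisker[OF a(2,1) B.proj_hom(1) ch] whisker[OF a(3,1) B.proj_hom(2) ch]
        whisker[OF a(4,1) B.proj_hom(3) ch] by (simp_all add: Fs)
    show "f \<cdot> (A.pz \<cdot> t) = u' \<cdot> c" "f \<cdot> (A.py \<cdot> t) = v' \<cdot> c"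
      using proj_F[OF t] whisker[OF b(3,1) B.proj_hom(2) ch] whisker[OF b(4,1) B.proj_hom(3) ch]
      by (simp_all add: Ft)
  qed
qed

text \<open>The Shifting Lemma is used twice: first for two triples with the same \<open>x\<close> and \<open>y\<close>, comparing
  \<open>(x, y, z)\<close> with \<open>(y, y, z)\<close>, then in general, comparing \<open>(x, y, z)\<close> with \<open>(x, y, y)\<close>.\<close>

lemma connector_respects_kernel:
  assumes p: "connector C X R S p" and u: "u \<in> hom C T A.P" and v: "v \<in> hom C T A.P"
    and Fuv: "F \<cdot> u = F \<cdot> v"
  shows "(f \<cdot> p) \<cdot> u = (f \<cdot> p) \<cdot> v"
proof -
  interpret P: connected_pair C X R S p by unfold_locales (rule p)
  note x = A.proj_hom(1) and y = A.proj_hom(2) and z = A.proj_hom(3) and ph = P.p_hom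
  note fx = comp_hom[OF f_hom(1) x] and fy = comp_hom[OF f_hom(1) y] and fz
    = comp_hom[OF f_hom(1) z]
    and fp = comp_hom[OF f_hom(1) ph]
  have fp_t: "(f \<cdot> p) \<cdot> t = f \<cdot> (p \<cdot> t)" if "t \<in> hom C U A.P" for U t
    using hom_assoc[OF that ph f_hom(1)] .
  have fz_t: "(f \<cdot> A.pz) \<cdot> t = f \<cdot> (A.pz \<cdot> t)" if "t \<in> hom C U A.P" for U t
    using hom_assoc[OF that z f_hom(1)] .
  have step: "(f \<cdot> p) \<cdot> s = (f \<cdot> p) \<cdot> t"
    if s: "s \<in> hom C U A.P" and t: "t \<in> hom C U A.P" and xy: "A.\<pi>1 \<cdot> s = A.\<pi>1 \<cdot> t"
      and zz: "f \<cdot> (A.pz \<cdot> s) = f \<cdot> (A.pz \<cdot> t)"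
    for U s t
  proof -
    note ys = comp_hom[OF y s] and yt = comp_hom[OF y t]
    let ?b = "triple C R S (A.py \<cdot> s) (A.py \<cdot> s) (A.pz \<cdot> s)" and ?c
      = "triple C R S (A.py \<cdot> t) (A.py \<cdot> t) (A.pz \<cdot> t)"
    note b = A.triple[OF ys ys eqrel_refl[OF A.R ys] A.composable_proj(2)[OF s]]
      and c = A.triple[OF yt yt eqrel_refl[OF A.R yt] A.composable_proj(2)[OF t]]
    have yst: "A.py \<cdot> s = A.py \<cdot> t" using A.proj_comp[OF s] A.proj_comp[OF t] xy by simp
    \<comment> \<open>Pairing \<open>A.\<pi>1\<close> with \<open>f A.pz\<close> makes the side
      condition trivial: triples that agree under this arrow and under \<open>A.\<pi>2\<close> are
      equal.\<close>
    note g = pairing(1)[OF A.rs_pb_hom(2) fz] and g_iff = pairing_eq_iff[OF A.rs_pb_hom(2) fz]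
    show ?thesis
    proof (rule kernel_shifting[OF g A.rs_pb_hom(3) fp s b(1) c(1) t])
      show "A.\<pi>2 \<cdot> s = A.\<pi>2 \<cdot> ?b" by (rule A.\<pi>2_eqI[OF s b(1)]) (simp_all add: b)
      show "A.\<pi>2 \<cdot> ?c = A.\<pi>2 \<cdot> t" by (rule A.\<pi>2_eqI[OF c(1) t]) (simp_all add: c)
      have "A.\<pi>1 \<cdot> ?b = A.\<pi>1 \<cdot> ?c"
        by (rule A.\<pi>1_eqI[OF b(1) c(1)]) (metis b(2) c(2) yst, metis b(3) c(3) yst)
      then show "pairing C A.\<pi>1 (f \<cdot> A.pz) \<cdot> ?b = pairing C A.\<pi>1 (f \<cdot> A.pz) \<cdot> ?c"
        unfolding g_iff[OF b(1) c(1)] fz_t[OF b(1)] fz_t[OF c(1)] b c using zz by simp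
      show "pairing C A.\<pi>1 (f \<cdot> A.pz) \<cdot> s = pairing C A.\<pi>1 (f \<cdot> A.pz) \<cdot> t"
        unfolding g_iff[OF s t] fz_t[OF s] fz_t[OF t] using xy zz by simp
      have "p \<cdot> ?b = A.pz \<cdot> s" "p \<cdot> ?c = A.pz \<cdot> t"
        using P.ap_left[OF ys comp_hom[OF z s] A.composable_proj(2)[OF s]]
          P.ap_left[OF yt comp_hom[OF z t] A.composable_proj(2)[OF t]] by (simp_all add: P.ap_def)
      then show "(f \<cdot> p) \<cdot> ?b = (f \<cdot> p) \<cdot> ?c" unfolding fp_t[OF b(1)] fp_t[OF c(1)] using zz by simp
      show "(f \<cdot> p) \<cdot> k = (f \<cdot> p) \<cdot> l"
        if "k \<in> hom C W A.P" "l \<in> hom C W A.P"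
          "pairing C A.\<pi>1 (f \<cdot> A.pz) \<cdot> k = pairing C A.\<pi>1 (f \<cdot> A.pz) \<cdot> l"
          "A.\<pi>2 \<cdot> k = A.\<pi>2 \<cdot> l" for W k l
        using A.\<pi>_joint_mono[OF that(1,2) _ that(4)] that(3) g_iff[OF that(1,2)] by simp
    qed
  qed
  note xu = comp_hom[OF x u] and yu = comp_hom[OF y u] and xv = comp_hom[OF x v] and yv
    = comp_hom[OF y v]
  note cu = A.composable_proj(1)[OF u] and cv = A.composable_proj(1)[OF v]
  let ?b = "triple C R S (A.px \<cdot> u) (A.py \<cdot> u) (A.py \<cdot> u)" and ?c
    = "triple C R S (A.px \<cdot> v) (A.py \<cdot> v) (A.py \<cdot> v)"
  note b = A.triple[OF xu yu cu eqrel_refl[OF A.S yu]] and c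
    = A.triple[OF xv yv cv eqrel_refl[OF A.S yv]]
  have fuv: "f \<cdot> (A.px \<cdot> u) = f \<cdot> (A.px \<cdot> v)" "f \<cdot> (A.py \<cdot> u) = f \<cdot> (A.py \<cdot> v)"
    using proj_F[OF u] proj_F[OF v] Fuv by simp_all
  show ?thesis
  proof (rule kernel_shifting[OF F_hom A.rs_pb_hom(2) fp u b(1) c(1) v _ _ _ _ Fuv])
    show "A.\<pi>1 \<cdot> u = A.\<pi>1 \<cdot> ?b" by (rule A.\<pi>1_eqI[OF u b(1)]) (simp_all add: b)
    show "A.\<pi>1 \<cdot> ?c = A.\<pi>1 \<cdot> v" by (rule A.\<pi>1_eqI[OF c(1) v]) (simp_all add: c)
    show "F \<cdot> ?b = F \<cdot> ?c"
      using F_triple[OF xu yu cu eqrel_refl[OF A.S yu]] F_triple[OF xv yv cv eqrel_refl[OF A.S yv]]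
        fuv by simp
    have "p \<cdot> ?b = A.px \<cdot> u" "p \<cdot> ?c = A.px \<cdot> v"
      using P.ap_right[OF xu yu cu] P.ap_right[OF xv yv cv] by (simp_all add: P.ap_def)
    then show "(f \<cdot> p) \<cdot> ?b = (f \<cdot> p) \<cdot> ?c" unfolding fp_t[OF b(1)] fp_t[OF c(1)] using fuv by simp
    \<comment> \<open>Here the side condition is no longer trivial: the triples share their first
      two entries, but their last entries agree only under \<open>f\<close>. This is the case
      settled by \<open>step\<close>.\<close>
    show "(f \<cdot> p) \<cdot> k = (f \<cdot> p) \<cdot> l"
      if "k \<in> hom C W A.P" "l \<in> hom C W A.P" "F \<cdot> k = F \<cdot> l" "A.\<pi>1 \<cdot> k = A.\<pi>1 \<cdot> l" for W k l
      using step[OF that(1,2,4)] proj_F(3)[OF that(1)] proj_F(3)[OF that(2)] that(3) by simp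
  qed
qed

text \<open>The new connector is the factor \<open>q\<close> of \<open>f p\<close> through
  \<open>F\<close>. Each axiom is verified over a cover on which the arguments lift to
  \<open>X\<close>, where \<open>val\<close> reduces \<open>q\<close> to \<open>p\<close>; the
  conclusion descends because covers are epic and relations are local.\<close>

lemma quotient_connector:
  assumes p: "connector C X R S p" and f: "f \<in> cover X X'"
    and fR: "fR \<in> cover (apex R) (apex R')" and fS: "fS \<in> cover (apex S) (apex S')"
  shows "\<exists>q. connector C X' R' S' q"
proof -
  interpret P: connected_pair C X R S p by unfold_locales (rule p)
  note fh = f_hom(1)
  have "(f \<cdot> p) \<cdot> u = (f \<cdot> p) \<cdot> v" if "u \<in> hom C U A.P" "v \<in> hom C U A.P" "F \<cdot> u = F \<cdot> v" for U u v
    by (rule connector_respects_kernel[OF p that])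
  then obtain q where q: "q \<in> hom C B.P X'" "q \<cdot> F = f \<cdot> p"
    using cover_factor[OF F_cover[OF fR fS] comp_hom[OF fh P.p_hom]] by metis
  have val: "q \<cdot> triple C R' S' (f \<cdot> x) (f \<cdot> y) (f \<cdot> z) = f \<cdot> P.ap x y z"
    if "x \<in> hom C T X" "y \<in> hom C T X" "relates C R x y" "relates C S y z" for T x y z
    using F_triple[OF that] whisker[OF q(2) F_hom q(1) A.triple(1)[OF that]]
      hom_assoc[OF A.triple(1)[OF that] P.p_hom fh]
    unfolding P.ap_def by simp
  have q_ap: "q \<cdot> triple C R' S' x y z \<in> hom C T X'"
    if "x \<in> hom C T X'" "y \<in> hom C T X'" "relates C R' x y" "relates C S' y z" for T x y z
    by (rule comp_hom[OF q(1) B.triple(1)[OF that]])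
  have "connector C X' R' S' q"
  proof (rule B.connectorI[OF q(1)])
    fix T x' y' z'
    assume h: "x' \<in> hom C T X'" "y' \<in> hom C T X'" "z' \<in> hom C T X'" and r: "relates C R' x' y'"
      "relates C S' y' z'"
    \<comment> \<open>Only the first two links matter; the chain is completed by reflexive links at
      \<open>z'\<close>.\<close>
    obtain U c x y z where c: "c \<in> cover U T" and xyz: "x \<in> hom C U X" "y \<in> hom C U X"
      "z \<in> hom C U X"
      and rs: "relates C R x y" "relates C S y z" and e: "f \<cdot> x = x' \<cdot> c" "f \<cdot> y = y' \<cdot> c"
        "f \<cdot> z = z' \<cdot> c"
      by (rule lift_chain[OF fR fS h h(3,3) r eqrel_refl[OF B.R h(3)] eqrel_refl[OF B.S h(3)]])
    have ch: "c \<in> hom C U T" using c by simp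
    have "(q \<cdot> triple C R' S' x' y' z') \<cdot> c = f \<cdot> P.ap x y z"
      using B.app_comp[OF q(1) h(1,2) r ch] val[OF xyz(1,2) rs] e by simp
    moreover have "relates C S' (f \<cdot> x) (f \<cdot> P.ap x y z)" "relates C R' (f \<cdot> P.ap x y z) (f \<cdot> z)"
      using relates_S[OF xyz(1) P.ap_relates(1)[OF xyz rs]]
        relates_R[OF P.ap_hom[OF xyz(1,2) rs] P.ap_relates(2)[OF xyz rs]] by simp_all
    ultimately show "relates C S' x' (q \<cdot> triple C R' S' x' y' z') \<and> relates C R' (q \<cdot> triple C R' S' x' y' z') z'"
      using relates_local[OF B.Sr h(1) q_ap[OF h(1,2) r] c]
        relates_local[OF B.Rr q_ap[OF h(1,2) r] h(3) c] e by simp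
  next
    fix T x' y' assume h: "x' \<in> hom C T X'" "y' \<in> hom C T X'" and r: "relates C S' x' y'"
    note rx = eqrel_refl[OF B.R h(1)]
    \<comment> \<open>The repeated entry needs one and the same lift in both places, which
      \<open>lift_chain\<close> would not provide; the pair is therefore lifted along
      \<open>fS\<close>. The other unit law is treated likewise along \<open>fR\<close>.\<close>
    obtain s' where s': "s' \<in> hom C T (apex S')" "lft S' \<cdot> s' = x'" "rgt S' \<cdot> s' = y'"
      using r relates_iff[OF h(1)] by blast
    obtain U c s where c: "c \<in> cover U T" and s: "s \<in> hom C U (apex S)" "fS \<cdot> s = s' \<cdot> c"
      using cover_lift[OF fS s'(1)] .
    have ch: "c \<in> hom C U T" using c by simp
    note x = comp_hom[OF A.Ss(4) s(1)] and y = comp_hom[OF A.Ss(5) s(1)]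
    have e: "f \<cdot> (lft S \<cdot> s) = x' \<cdot> c" "f \<cdot> (rgt S \<cdot> s) = y' \<cdot> c"
      using whisker[OF f_comm(3) f_hom(3) B.Ss(4) s(1)] hom_assoc[OF s(1) A.Ss(4) fh]
        whisker[OF f_comm(4) f_hom(3) B.Ss(5) s(1)] hom_assoc[OF s(1) A.Ss(5) fh]
        whisker[OF s'(2,1) B.Ss(4) ch] whisker[OF s'(3,1) B.Ss(5) ch] s(2) by simp_all
    have "(q \<cdot> triple C R' S' x' x' y') \<cdot> c = y' \<cdot> c"
      using B.app_comp[OF q(1) h(1,1) rx r ch]
        val[OF x x eqrel_refl[OF A.R x] relatesI[OF A.Sr s(1)]]
        P.ap_left[OF x y relatesI[OF A.Sr s(1)]] e by simp
    then show "q \<cdot> triple C R' S' x' x' y' = y'" by (rule cover_epi[OF c q_ap[OF h(1,1) rx r] h(2)])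
  next
    fix T x' y' assume h: "x' \<in> hom C T X'" "y' \<in> hom C T X'" and r: "relates C R' x' y'"
    note ry = eqrel_refl[OF B.S h(2)]
    obtain s' where s': "s' \<in> hom C T (apex R')" "lft R' \<cdot> s' = x'" "rgt R' \<cdot> s' = y'"
      using r relates_iff[OF h(1)] by blast
    obtain U c s where c: "c \<in> cover U T" and s: "s \<in> hom C U (apex R)" "fR \<cdot> s = s' \<cdot> c"
      using cover_lift[OF fR s'(1)] .
    have ch: "c \<in> hom C U T" using c by simp
    note x = comp_hom[OF A.Rs(4) s(1)] and y = comp_hom[OF A.Rs(5) s(1)]
    have e: "f \<cdot> (lft R \<cdot> s) = x' \<cdot> c" "f \<cdot> (rgt R \<cdot> s) = y' \<cdot> c"
      using whisker[OF f_comm(1) f_hom(2) B.Rs(4) s(1)] hom_assoc[OF s(1) A.Rs(4) fh]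
        whisker[OF f_comm(2) f_hom(2) B.Rs(5) s(1)] hom_assoc[OF s(1) A.Rs(5) fh]
        whisker[OF s'(2,1) B.Rs(4) ch] whisker[OF s'(3,1) B.Rs(5) ch] s(2) by simp_all
    have "(q \<cdot> triple C R' S' x' y' y') \<cdot> c = x' \<cdot> c"
      using B.app_comp[OF q(1) h r ry ch] val[OF x y relatesI[OF A.Rr s(1)] eqrel_refl[OF A.S y]]
        P.ap_right[OF x y relatesI[OF A.Rr s(1)]] e by simp
    then show "q \<cdot> triple C R' S' x' y' y' = x'" by (rule cover_epi[OF c q_ap[OF h r ry] h(1)])
  next
    fix T x' y' z' u' v'
    assume h: "x' \<in> hom C T X'" "y' \<in> hom C T X'" "z' \<in> hom C T X'" "u' \<in> hom C T X'"
      "v' \<in> hom C T X'"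
      and r: "relates C R' x' y'" "relates C S' y' z'" "relates C R' z' u'" "relates C S' u' v'"
    obtain U c x y z u v where c: "c \<in> cover U T"
      and g: "x \<in> hom C U X" "y \<in> hom C U X" "z \<in> hom C U X" "u \<in> hom C U X" "v \<in> hom C U X"
      and rs: "relates C R x y" "relates C S y z" "relates C R z u" "relates C S u v"
      and e: "f \<cdot> x = x' \<cdot> c" "f \<cdot> y = y' \<cdot> c" "f \<cdot> z = z' \<cdot> c" "f \<cdot> u = u' \<cdot> c" "f \<cdot> v = v' \<cdot> c"
      using lift_chain[OF fR fS h r] .
    have ch: "c \<in> hom C U T" using c by simp
    let ?l = "q \<cdot> triple C R' S' x' y' z'" and ?r = "q \<cdot> triple C R' S' z' u' v'"
    have lc: "?l \<cdot> c = f \<cdot> P.ap x y z" using B.app_comp[OF q(1) h(1,2) r(1,2) ch]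
      val[OF g(1,2) rs(1,2)] e by simp
    have rc: "?r \<cdot> c = f \<cdot> P.ap z u v" using B.app_comp[OF q(1) h(3,4) r(3,4) ch]
      val[OF g(3,4) rs(3,4)] e by simp
    have 1: "relates C S y (P.ap z u v)"
      by (rule eqrel_trans[OF A.S g(2,3) rs(2) P.ap_relates(1)[OF g(3-5) rs(3,4)]])
    have 2: "relates C R (P.ap x y z) u"
      by (rule eqrel_trans[OF A.R P.ap_hom[OF g(1,2) rs(1,2)] g(3) P.ap_relates(2)[OF g(1-3) rs(1,2)] rs(3)])
    \<comment> \<open>Composability of the nested terms in the quotient is local too: over
      \<open>c\<close> it is the image of facts 1 and 2.\<close>
    have 3: "relates C S' y' ?r"
      by (rule relates_local[OF B.Sr h(2) q_ap[OF h(3,4) r(3,4)] c])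
        (use relates_S[OF g(2) 1] rc e in simp)
    have 4: "relates C R' ?l u'"
      by (rule relates_local[OF B.Rr q_ap[OF h(1,2) r(1,2)] h(4) c])
        (use relates_R[OF P.ap_hom[OF g(1,2) rs(1,2)] 2] lc e in simp)
    have "(q \<cdot> triple C R' S' x' y' ?r) \<cdot> c = f \<cdot> P.ap x y (P.ap z u v)"
      using B.app_comp[OF q(1) h(1,2) r(1) 3 ch] val[OF g(1,2) rs(1) 1] rc e by simp
    also have "\<dots> = f \<cdot> P.ap (P.ap x y z) u v" using P.ap_assoc[OF g rs] by simp
    also have "\<dots> = (q \<cdot> triple C R' S' ?l u' v') \<cdot> c"
      using B.app_comp[OF q(1) q_ap[OF h(1,2) r(1,2)] h(4) 4 r(4) ch]
        val[OF P.ap_hom[OF g(1,2) rs(1,2)] g(4) 2 rs(4)] lc e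
      by simp
    finally show "q \<cdot> triple C R' S' x' y' ?r = q \<cdot> triple C R' S' ?l u' v'"
      by (rule cover_epi[OF c q_ap[OF h(1,2) r(1) 3] q_ap[OF q_ap[OF h(1,2) r(1,2)] h(4) 4 r(4)]])
  qed
  then show ?thesis by blast
qed

end

section \<open>The categories of pairs and of connectors\<close>

lemma two_Eq_simps:
  "Obj (two_Eq C) = {A. is_eq2 C A}" "Dom (two_Eq C) = src" "Cod (two_Eq C) = trg"
  "t \<in> Arr (two_Eq C) \<longleftrightarrow> is_eq2 C (src t) \<and> is_eq2 C (trg t) \<and>
     is_eq2_arrow C (src t) (trg t) (on1 t) (on2 t) (on_base t)"
  "Idt (two_Eq C) A = Tri A A (Idt C (apex (rel1 A))) (Idt C (apex (rel2 A))) (Idt C (base A))"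
  "t \<cdot>\<^bsub>two_Eq C\<^esub> s = Tri (src s) (trg t)
     (on1 t \<cdot>\<^bsub>C\<^esub> on1 s) (on2 t \<cdot>\<^bsub>C\<^esub> on2 s) (on_base t \<cdot>\<^bsub>C\<^esub> on_base s)"
  by (simp_all add: two_Eq_def)

lemma is_eq2D:
  assumes "is_eq2 C A"
  shows "base A \<in> Obj C" "apex (rel1 A) \<in> Obj C" "apex (rel2 A) \<in> Obj C"
    "lft (rel1 A) \<in> hom C (apex (rel1 A)) (base A)" "rgt (rel1 A) \<in> hom C (apex (rel1 A)) (base A)"
    "lft (rel2 A) \<in> hom C (apex (rel2 A)) (base A)" "rgt (rel2 A) \<in> hom C (apex (rel2 A)) (base A)"
  using assms unfolding is_eq2_def equivalence_rel_def relation_def is_span_def by auto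

context cat_struct
begin

lemma is_eq2_arrow_Idt:
  assumes "is_eq2 C A"
  shows "is_eq2_arrow C A A (Idt C (apex (rel1 A))) (Idt C (apex (rel2 A))) (Idt C (base A))"
  using is_eq2D[OF assms] unfolding is_eq2_arrow_def by (simp add: hom_def)

lemma is_eq2_arrow_comp:
  assumes A: "is_eq2 C A" and B: "is_eq2 C B" and D: "is_eq2 C D"
    and f: "is_eq2_arrow C A B fR fS f" and g: "is_eq2_arrow C B D gR gS g"
  shows "is_eq2_arrow C A D (gR \<cdot> fR) (gS \<cdot> fS) (g \<cdot> f)"
proof -
  note a = is_eq2D[OF A] and b = is_eq2D[OF B] and d = is_eq2D[OF D]
  have f: "fR \<in> hom C (apex (rel1 A)) (apex (rel1 B))" "fS \<in> hom C (apex (rel2 A)) (apex (rel2 B))"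
    "f \<in> hom C (base A) (base B)"
    "lft (rel1 B) \<cdot> fR = f \<cdot> lft (rel1 A)" "rgt (rel1 B) \<cdot> fR = f \<cdot> rgt (rel1 A)"
    "lft (rel2 B) \<cdot> fS = f \<cdot> lft (rel2 A)" "rgt (rel2 B) \<cdot> fS = f \<cdot> rgt (rel2 A)"
    using f unfolding is_eq2_arrow_def by simp_all
  have g: "gR \<in> hom C (apex (rel1 B)) (apex (rel1 D))" "gS \<in> hom C (apex (rel2 B)) (apex (rel2 D))"
    "g \<in> hom C (base B) (base D)"
    "lft (rel1 D) \<cdot> gR = g \<cdot> lft (rel1 B)" "rgt (rel1 D) \<cdot> gR = g \<cdot> rgt (rel1 B)"
    "lft (rel2 D) \<cdot> gS = g \<cdot> lft (rel2 B)" "rgt (rel2 D) \<cdot> gS = g \<cdot> rgt (rel2 B)"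
    using g unfolding is_eq2_arrow_def by simp_all
  show ?thesis
    unfolding is_eq2_arrow_def
    using comp_hom[OF g(1) f(1)] comp_hom[OF g(2) f(2)] comp_hom[OF g(3) f(3)]
      whisker[OF g(4,1) d(4) f(1)] whisker[OF g(5,1) d(5) f(1)] whisker[OF g(6,2) d(6) f(2)]
        whisker[OF g(7,2) d(7) f(2)]
      hom_assoc[OF f(1) b(4) g(3)] hom_assoc[OF f(1) b(5) g(3)] hom_assoc[OF f(2) b(6) g(3)]
        hom_assoc[OF f(2) b(7) g(3)]
      hom_assoc[OF a(4) f(3) g(3)] hom_assoc[OF a(5) f(3) g(3)] hom_assoc[OF a(6) f(3) g(3)]
        hom_assoc[OF a(7) f(3) g(3)] f
    by simp
qed

lemma category_two_Eq: "category (two_Eq C)"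
  unfolding category_def
proof (intro conjI ballI impI)
  fix t assume t: "t \<in> Arr (two_Eq C)"
  then show "Dom (two_Eq C) t \<in> Obj (two_Eq C)" "Cod (two_Eq C) t \<in> Obj (two_Eq C)"
    by (simp_all add: two_Eq_simps)
  have "on1 t \<in> hom C (apex (rel1 (src t))) (apex (rel1 (trg t)))"
    "on2 t \<in> hom C (apex (rel2 (src t))) (apex (rel2 (trg t)))"
    "on_base t \<in> hom C (base (src t)) (base (trg t))"
    using t unfolding two_Eq_simps is_eq2_arrow_def by simp_all
  then show "t \<cdot>\<^bsub>two_Eq C\<^esub> Idt (two_Eq C) (Dom (two_Eq C) t) = t"
    "Idt (two_Eq C) (Cod (two_Eq C) t) \<cdot>\<^bsub>two_Eq C\<^esub> t = t"
    unfolding two_Eq_simps by (intro tri.expand; simp add: hom_def)+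
next
  fix A assume "A \<in> Obj (two_Eq C)"
  then show "Idt (two_Eq C) A \<in> hom (two_Eq C) A A"
    using is_eq2_arrow_Idt unfolding hom_def by (simp add: two_Eq_simps)
next
  fix s t assume "s \<in> Arr (two_Eq C)" "t \<in> Arr (two_Eq C)" "Dom (two_Eq C) t = Cod (two_Eq C) s"
  then show "t \<cdot>\<^bsub>two_Eq C\<^esub> s \<in> hom (two_Eq C) (Dom (two_Eq C) s) (Cod (two_Eq C) t)"
    using is_eq2_arrow_comp[of "src s" "trg s" "trg t"] unfolding hom_def
      by (simp add: two_Eq_simps)
next
  fix r s t
  assume "r \<in> Arr (two_Eq C)" "s \<in> Arr (two_Eq C)" "t \<in> Arr (two_Eq C)"
    "Dom (two_Eq C) s = Cod (two_Eq C) r" "Dom (two_Eq C) t = Cod (two_Eq C) s"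
  then show "(t \<cdot>\<^bsub>two_Eq C\<^esub> s) \<cdot>\<^bsub>two_Eq C\<^esub> r = t \<cdot>\<^bsub>two_Eq C\<^esub> (s \<cdot>\<^bsub>two_Eq C\<^esub> r)"
    by (simp add: two_Eq_simps is_eq2_arrow_def hom_def)
qed

end

context regular_cat
begin

text \<open>After composition with the cover \<open>eR\<close> the pair required to lie in
  \<open>R'\<close> is the one witnessed by \<open>fR\<close>, so \<open>mR\<close> exists by
  locality. For monic \<open>m\<close>, an element of \<open>R1\<close> is determined by its two
  entries and these by their images under \<open>m\<close>, which makes \<open>mR\<close>
  monic.\<close>

lemma image_relation_factor:
  assumes e: "e \<in> cover X I" and m: "m \<in> hom C I X'"
    and R: "relation C X X R" and R1: "relation C I I R1" and R': "relation C X' X' R'"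
    and eR: "eR \<in> cover (apex R) (apex R1)" "lft R1 \<cdot> eR = e \<cdot> lft R" "rgt R1 \<cdot> eR = e \<cdot> rgt R"
    and fR: "fR \<in> hom C (apex R) (apex R')" "lft R' \<cdot> fR = (m \<cdot> e) \<cdot> lft R"
      "rgt R' \<cdot> fR = (m \<cdot> e) \<cdot> rgt R"
  obtains mR where "mR \<in> hom C (apex R1) (apex R')" "lft R' \<cdot> mR = m \<cdot> lft R1"
    "rgt R' \<cdot> mR = m \<cdot> rgt R1"
    "mR \<cdot> eR = fR" "is_mono C m \<Longrightarrow> is_mono C mR"
proof -
  note r = relation_span[OF R] and r1 = relation_span[OF R1] and r' = relation_span[OF R']
  have eh: "e \<in> hom C X I" and eRh: "eR \<in> hom C (apex R) (apex R1)" using e eR by auto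
  note ml = comp_hom[OF m r1(4)] and mr = comp_hom[OF m r1(5)]
  have l: "(m \<cdot> lft R1) \<cdot> eR = lft R' \<cdot> fR" "(m \<cdot> rgt R1) \<cdot> eR = rgt R' \<cdot> fR"
    using hom_assoc[OF eRh r1(4) m] hom_assoc[OF eRh r1(5) m] hom_assoc[OF r(4) eh m]
      hom_assoc[OF r(5) eh m] eR fR
    by simp_all
  have "relates C R' (m \<cdot> lft R1) (m \<cdot> rgt R1)"
    by (rule relates_local[OF R' ml mr eR(1)]) (unfold l, rule relatesI[OF R' fR(1)])
  then obtain mR where mR: "mR \<in> hom C (apex R1) (apex R')" "lft R' \<cdot> mR = m \<cdot> lft R1"
    "rgt R' \<cdot> mR = m \<cdot> rgt R1"
    using relates_iff[OF ml] by blast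
  have "mR \<cdot> eR = fR"
    by (rule relation_joint_mono[OF R' comp_hom[OF mR(1) eRh] fR(1)])
      (use whisker[OF mR(2,1) r'(4) eRh] whisker[OF mR(3,1) r'(5) eRh] l in simp_all)
  moreover have "is_mono C mR" if mono: "is_mono C m"
    unfolding is_mono_def
  proof (intro conjI ballI impI)
    show "mR \<in> Arr C" using mR by (simp add: hom_def)
    fix T a b assume "a \<in> hom C T (Dom C mR)" "b \<in> hom C T (Dom C mR)" and ab: "mR \<cdot> a = mR \<cdot> b"
    then have a: "a \<in> hom C T (apex R1)" and b: "b \<in> hom C T (apex R1)" using mR
      by (simp_all add: hom_def)
    show "a = b"
    proof (rule relation_joint_mono[OF R1 a b])
      show "lft R1 \<cdot> a = lft R1 \<cdot> b"
        by (rule mono_cancel[OF mono m comp_hom[OF r1(4) a] comp_hom[OF r1(4) b]])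
          (use whisker[OF mR(2,1) r'(4) a] whisker[OF mR(2,1) r'(4) b] hom_assoc[OF a r1(4) m] hom_assoc[OF b r1(4) m] ab in simp)
      show "rgt R1 \<cdot> a = rgt R1 \<cdot> b"
        by (rule mono_cancel[OF mono m comp_hom[OF r1(5) a] comp_hom[OF r1(5) b]])
          (use whisker[OF mR(3,1) r'(5) a] whisker[OF mR(3,1) r'(5) b] hom_assoc[OF a r1(5) m] hom_assoc[OF b r1(5) m] ab in simp)
    qed
  qed
  ultimately show thesis using that mR by blast
qed

end

section \<open>Naturality, uniqueness, fullness and closure under quotients\<close>

context goursat_cat
begin

lemma eq2_arrow_intro:
  assumes "is_eq2 C A" "is_eq2 C B" "is_eq2_arrow C A B fR fS f"
  shows "eq2_arrow C (base A) (rel1 A) (rel2 A) (base B) (rel1 B) (rel2 B) fR fS f"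
  by unfold_locales (use assms in \<open>simp_all add: is_eq2_def\<close>)

lemma connector_natural:
  assumes "is_eq2 C A" "is_eq2 C B" "is_eq2_arrow C A B fR fS f"
    and "connector C (base A) (rel1 A) (rel2 A) p" "connector C (base B) (rel1 B) (rel2 B) q"
  shows "f \<cdot> p = q \<cdot> induced C A B fR fS"
  using eq2_arrow.preserves_connector[OF eq2_arrow_intro[OF assms(1-3)] assms(4,5)] by simp

text \<open>This is naturality at the identity arrow of the pair, whose induced map on the pullback
  is the identity.\<close>

lemma connector_unique:
  assumes A: "is_eq2 C A" and p: "connector C (base A) (rel1 A) (rel2 A) p"
    and q: "connector C (base A) (rel1 A) (rel2 A) q"
  shows "p = q"
proof -
  interpret eq2_arrow C "base A" "rel1 A" "rel2 A" "base A" "rel1 A" "rel2 A"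
    "Idt C (apex (rel1 A))" "Idt C (apex (rel2 A))" "Idt C (base A)"
    by (rule eq2_arrow_intro[OF A A is_eq2_arrow_Idt[OF A]])
  have "F = triple C (rel1 A) (rel2 A) A.px A.py A.pz"
    using A.proj_hom unfolding F_eq by (simp add: hom_def)
  also have "\<dots> = Idt C A.P"
    by (rule A.triple_unique[OF Idt_hom[OF A.rs_pb_hom(1)]])
      (use A.proj_hom in \<open>simp_all add: hom_def\<close>)
  finally have "F = Idt C A.P" .
  moreover have "p \<in> hom C A.P (base A)" "q \<in> hom C A.P (base A)" using p q unfolding connector_def
    by simp_all
  ultimately show ?thesis using preserves_connector[OF p q] by (simp add: hom_def)
qed

text \<open>Compatibility with the connectors no longer appears in the description of arrows, since
  \<open>connector_natural\<close> provides it for every arrow of pairs; fullness amounts to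
  this.\<close>

lemma Conn_simps:
  "Obj (Conn C) = {A. is_conn_obj C A}" "Dom (Conn C) = src" "Cod (Conn C) = trg"
  "t \<in> Arr (Conn C) \<longleftrightarrow> is_conn_obj C (src t) \<and> is_conn_obj C (trg t) \<and>
     is_eq2_arrow C (pair_of (src t)) (pair_of (trg t)) (on1 t) (on2 t) (on_base t)"
  "Idt (Conn C) A = Tri A A (Idt C (apex (rel1 (pair_of A)))) (Idt C (apex (rel2 (pair_of A)))) (Idt C (base (pair_of A)))"
  "t \<cdot>\<^bsub>Conn C\<^esub> s = Tri (src s) (trg t) (on1 t \<cdot> on1 s) (on2 t \<cdot> on2 s) (on_base t \<cdot> on_base s)"
  using connector_natural by (auto simp: Conn_def is_conn_obj_def)

lemma category_Conn: "category (Conn C)"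
  unfolding category_def
proof (intro conjI ballI impI)
  fix t assume t: "t \<in> Arr (Conn C)"
  then show "Dom (Conn C) t \<in> Obj (Conn C)" "Cod (Conn C) t \<in> Obj (Conn C)"
    by (simp_all add: Conn_simps)
  have "on1 t \<in> hom C (apex (rel1 (pair_of (src t)))) (apex (rel1 (pair_of (trg t))))"
    "on2 t \<in> hom C (apex (rel2 (pair_of (src t)))) (apex (rel2 (pair_of (trg t))))"
    "on_base t \<in> hom C (base (pair_of (src t))) (base (pair_of (trg t)))"
    using t unfolding Conn_simps is_eq2_arrow_def by simp_all
  then show "t \<cdot>\<^bsub>Conn C\<^esub> Idt (Conn C) (Dom (Conn C) t) = t"
    "Idt (Conn C) (Cod (Conn C) t) \<cdot>\<^bsub>Conn C\<^esub> t = t"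
    unfolding Conn_simps by (intro tri.expand; simp add: hom_def)+
next
  fix A assume "A \<in> Obj (Conn C)"
  then show "Idt (Conn C) A \<in> hom (Conn C) A A"
    using is_eq2_arrow_Idt unfolding hom_def by (simp add: Conn_simps is_conn_obj_def)
next
  fix s t assume "s \<in> Arr (Conn C)" "t \<in> Arr (Conn C)" "Dom (Conn C) t = Cod (Conn C) s"
  then show "t \<cdot>\<^bsub>Conn C\<^esub> s \<in> hom (Conn C) (Dom (Conn C) s) (Cod (Conn C) t)"
    using is_eq2_arrow_comp[of "pair_of (src s)" "pair_of (trg s)" "pair_of (trg t)"]
      unfolding hom_def
    by (simp add: Conn_simps is_conn_obj_def)
next
  fix r s t
  assume "r \<in> Arr (Conn C)" "s \<in> Arr (Conn C)" "t \<in> Arr (Conn C)"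
    "Dom (Conn C) s = Cod (Conn C) r" "Dom (Conn C) t = Cod (Conn C) s"
  then show "(t \<cdot>\<^bsub>Conn C\<^esub> s) \<cdot>\<^bsub>Conn C\<^esub> r = t \<cdot>\<^bsub>Conn C\<^esub> (s \<cdot>\<^bsub>Conn C\<^esub> r)"
    by (simp add: Conn_simps is_eq2_arrow_def hom_def)
qed

text \<open>Injectivity on objects is uniqueness of connectors. On hom sets only the recorded domain
  and codomain change, and these are fixed within a given hom set.\<close>

lemma full_subcategory_Conn: "full_subcategory_via (Conn C) (two_Eq C) pair_of forget_arr"
  unfolding full_subcategory_via_def
proof (intro conjI ballI)
  show "is_functor (Conn C) (two_Eq C) pair_of forget_arr"
    unfolding is_functor_def using category_Conn category_two_Eq
    by (auto simp: Conn_simps two_Eq_simps is_conn_obj_def forget_arr_def hom_def)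
  show "inj_on pair_of (Obj (Conn C))"
  proof (rule inj_onI)
    fix A B assume "A \<in> Obj (Conn C)" "B \<in> Obj (Conn C)" "pair_of A = pair_of B"
    then show "A = B"
      using connector_unique[of "pair_of A" "conn_of A" "conn_of B"]
      by (intro conn_obj.expand) (simp add: Conn_simps is_conn_obj_def)
  qed
  fix A B assume A: "A \<in> Obj (Conn C)" and B: "B \<in> Obj (Conn C)"
  show "bij_betw forget_arr (hom (Conn C) A B) (hom (two_Eq C) (pair_of A) (pair_of B))"
    unfolding bij_betw_def
  proof
    show "inj_on forget_arr (hom (Conn C) A B)"
    proof (rule inj_onI)
      fix s t assume "s \<in> hom (Conn C) A B" "t \<in> hom (Conn C) A B" "forget_arr s = forget_arr t"
      then show "s = t"
        by (intro tri.expand) (simp add: forget_arr_def hom_def Conn_simps)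
    qed
    show "forget_arr ` hom (Conn C) A B = hom (two_Eq C) (pair_of A) (pair_of B)"
    proof
      show "forget_arr ` hom (Conn C) A B \<subseteq> hom (two_Eq C) (pair_of A) (pair_of B)"
        by (auto simp: Conn_simps two_Eq_simps is_conn_obj_def forget_arr_def hom_def)
      show "hom (two_Eq C) (pair_of A) (pair_of B) \<subseteq> forget_arr ` hom (Conn C) A B"
      proof
        fix t assume t: "t \<in> hom (two_Eq C) (pair_of A) (pair_of B)"
        let ?t = "Tri A B (on1 t) (on2 t) (on_base t)"
        have "t = forget_arr ?t" using t
          by (intro tri.expand) (simp add: forget_arr_def hom_def two_Eq_simps)
        moreover have "?t \<in> hom (Conn C) A B" using t A B
          by (auto simp: hom_def Conn_simps two_Eq_simps)
        ultimately show "t \<in> forget_arr ` hom (Conn C) A B" by (rule image_eqI)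
      qed
    qed
  qed
qed

text \<open>Factor \<open>q\<close> through the direct images of its two relations along the regular epimorphism part of
  its base component; as a monomorphism through which a regular epimorphism factors, the second
  factor is invertible.\<close>

lemma two_Eq_regular_epi:
  assumes q: "regular_epi (two_Eq C) q"
  shows "on_base q \<in> cover (base (src q)) (base (trg q))"
    "on1 q \<in> cover (apex (rel1 (src q))) (apex (rel1 (trg q)))"
    "on2 q \<in> cover (apex (rel2 (src q))) (apex (rel2 (trg q)))"
proof -
  \<comment> \<open>Nothing is known about limits in \<open>two_Eq C\<close>, so only those facts on
    regular epimorphisms are transferred that hold in any category.\<close>
  interpret T: cat_struct "two_Eq C" by unfold_locales (rule category_two_Eq)
  define A where "A = src q"
  define B where "B = trg q"
  have "q \<in> Arr (two_Eq C)" using q unfolding regular_epi_def is_coequaliser_def by blast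
  then have A: "is_eq2 C A" and B: "is_eq2 C B"
    and qa: "is_eq2_arrow C A B (on1 q) (on2 q) (on_base q)"
    and qh: "q \<in> hom (two_Eq C) A B"
    by (simp_all add: two_Eq_simps A_def B_def hom_def)
  have qc: "q \<in> T.cover A B" using q qh by simp
  have q_comm: "on1 q \<in> hom C (apex (rel1 A)) (apex (rel1 B))"
    "on2 q \<in> hom C (apex (rel2 A)) (apex (rel2 B))"
    "on_base q \<in> hom C (base A) (base B)"
    "lft (rel1 B) \<cdot> on1 q = on_base q \<cdot> lft (rel1 A)"
      "rgt (rel1 B) \<cdot> on1 q = on_base q \<cdot> rgt (rel1 A)"
    "lft (rel2 B) \<cdot> on2 q = on_base q \<cdot> lft (rel2 A)"
      "rgt (rel2 B) \<cdot> on2 q = on_base q \<cdot> rgt (rel2 A)"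
    using qa unfolding is_eq2_arrow_def by simp_all
  have eqA: "equivalence_rel C (base A) (rel1 A)" "equivalence_rel C (base A) (rel2 A)"
    and eqB: "equivalence_rel C (base B) (rel1 B)" "equivalence_rel C (base B) (rel2 B)"
    using A B unfolding is_eq2_def by simp_all
  obtain I e m where e: "e \<in> cover (base A) I" and m: "m \<in> hom C I (base B)" "is_mono C m"
    and me: "on_base q = m \<cdot> e"
    using ex_image[OF q_comm(3)] .
  have eh: "e \<in> hom C (base A) I" using e by simp
  obtain R1 eR where R1: "equivalence_rel C I R1" and eR: "eR \<in> cover (apex (rel1 A)) (apex R1)"
    "lft R1 \<cdot> eR = e \<cdot> lft (rel1 A)" "rgt R1 \<cdot> eR = e \<cdot> rgt (rel1 A)"
    using ex_direct_image[OF e eqA(1)] .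
  obtain S1 eS where S1: "equivalence_rel C I S1" and eS: "eS \<in> cover (apex (rel2 A)) (apex S1)"
    "lft S1 \<cdot> eS = e \<cdot> lft (rel2 A)" "rgt S1 \<cdot> eS = e \<cdot> rgt (rel2 A)"
    using ex_direct_image[OF e eqA(2)] .
  obtain mR where mR: "mR \<in> hom C (apex R1) (apex (rel1 B))" "lft (rel1 B) \<cdot> mR = m \<cdot> lft R1"
      "rgt (rel1 B) \<cdot> mR = m \<cdot> rgt R1" "mR \<cdot> eR = on1 q" "is_mono C mR"
    using image_relation_factor[OF e m(1) eqrel_relation[OF eqA(1)] eqrel_relation[OF R1] eqrel_relation[OF eqB(1)] eR
        q_comm(1) q_comm(4,5)[unfolded me]] m(2) by blast
  obtain mS where mS: "mS \<in> hom C (apex S1) (apex (rel2 B))" "lft (rel2 B) \<cdot> mS = m \<cdot> lft S1"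
      "rgt (rel2 B) \<cdot> mS = m \<cdot> rgt S1" "mS \<cdot> eS = on2 q" "is_mono C mS"
    using image_relation_factor[OF e m(1) eqrel_relation[OF eqA(2)] eqrel_relation[OF S1] eqrel_relation[OF eqB(2)] eS
        q_comm(2) q_comm(6,7)[unfolded me]] m(2) by blast
  define A' where "A' = Eq2 R1 S1 I"
  define t1 where "t1 = Tri A A' eR eS e"
  define t2 where "t2 = Tri A' B mR mS m"
  have A': "is_eq2 C A'" using R1 S1 by (simp add: is_eq2_def A'_def)
  have t1: "t1 \<in> hom (two_Eq C) A A'"
    using A A' eR eS eh
      by (simp add: hom_def[of "two_Eq C"] two_Eq_simps t1_def is_eq2_arrow_def A'_def)
  have t2: "t2 \<in> hom (two_Eq C) A' B"
    using B A' mR mS m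
      by (simp add: hom_def[of "two_Eq C"] two_Eq_simps t2_def is_eq2_arrow_def A'_def)
  have t21: "t2 \<cdot>\<^bsub>two_Eq C\<^esub> t1 = q"
    by (rule tri.expand) (simp add: two_Eq_simps t1_def t2_def me mR(4) mS(4) A_def B_def)
  \<comment> \<open>All components of \<open>t2\<close> are monic, so \<open>t1\<close> identifies
    whatever \<open>q = t2 t1\<close> identifies and descends along \<open>q\<close>.\<close>
  have "t1 \<cdot>\<^bsub>two_Eq C\<^esub> u = t1 \<cdot>\<^bsub>two_Eq C\<^esub> v"
    if u: "u \<in> hom (two_Eq C) U A" and v: "v \<in> hom (two_Eq C) U A"
      and quv: "q \<cdot>\<^bsub>two_Eq C\<^esub> u = q \<cdot>\<^bsub>two_Eq C\<^esub> v"
    for U u v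
  proof -
    have uv: "on1 w \<in> hom C (apex (rel1 U)) (apex (rel1 A))"
      "on2 w \<in> hom C (apex (rel2 U)) (apex (rel2 A))"
      "on_base w \<in> hom C (base U) (base A)" "src w = U" if "w = u \<or> w = v" for w
      using u v that unfolding hom_def[of "two_Eq C"] two_Eq_simps is_eq2_arrow_def by auto
    note u' = uv[OF disjI1[OF refl]] and v' = uv[OF disjI2[OF refl]]
    have q': "on1 q \<cdot> on1 u = on1 q \<cdot> on1 v" "on2 q \<cdot> on2 u = on2 q \<cdot> on2 v"
      "on_base q \<cdot> on_base u = on_base q \<cdot> on_base v"
      using quv by (simp_all add: two_Eq_simps)
    have eRh: "eR \<in> hom C (apex (rel1 A)) (apex R1)" and eSh: "eS \<in> hom C (apex (rel2 A)) (apex S1)"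
      using eR eS by auto
    have "eR \<cdot> on1 u = eR \<cdot> on1 v"
      by (rule mono_cancel[OF mR(5,1) comp_hom[OF eRh u'(1)] comp_hom[OF eRh v'(1)]])
        (use whisker[OF mR(4) eRh mR(1)] u' v' q' in simp)
    moreover have "eS \<cdot> on2 u = eS \<cdot> on2 v"
      by (rule mono_cancel[OF mS(5,1) comp_hom[OF eSh u'(2)] comp_hom[OF eSh v'(2)]])
        (use whisker[OF mS(4) eSh mS(1)] u' v' q' in simp)
    moreover have "e \<cdot> on_base u = e \<cdot> on_base v"
      by (rule mono_cancel[OF m(2,1) comp_hom[OF eh u'(3)] comp_hom[OF eh v'(3)]])
        (use whisker[OF me[symmetric] eh m(1)] u' v' q' in simp)
    ultimately show ?thesis using u'(4) v'(4) by (simp add: two_Eq_simps t1_def)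
  qed
  then obtain k where k: "k \<in> hom (two_Eq C) B A'" "k \<cdot>\<^bsub>two_Eq C\<^esub> q = t1"
    using T.cover_factor[OF qc t1] by metis
  have Bo: "B \<in> Obj (two_Eq C)" using B by (simp add: two_Eq_simps)
  \<comment> \<open>Cancelling \<open>q\<close> shows that \<open>k\<close> is a section of
    \<open>t2\<close>. Its components are sections of the monomorphisms \<open>mR\<close>,
    \<open>mS\<close>, \<open>m\<close>, so each component of \<open>q\<close> is a regular
    epimorphism followed by an isomorphism.\<close>
  have "t2 \<cdot>\<^bsub>two_Eq C\<^esub> k = Idt (two_Eq C) B"
  proof (rule T.cover_epi[OF qc T.comp_hom[OF t2 k(1)] T.Idt_hom[OF Bo]])
    have "Idt (two_Eq C) B \<cdot>\<^bsub>two_Eq C\<^esub> q = q"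
      by (rule T.Idt_comp) (use qh in \<open>simp_all add: hom_def\<close>)
    then show "(t2 \<cdot>\<^bsub>two_Eq C\<^esub> k) \<cdot>\<^bsub>two_Eq C\<^esub> q = Idt (two_Eq C) B \<cdot>\<^bsub>two_Eq C\<^esub> q"
      using T.hom_assoc[OF qh k(1) t2] k(2) t21 by simp
  qed
  then have id: "mR \<cdot> on1 k = Idt C (apex (rel1 B))" "mS \<cdot> on2 k = Idt C (apex (rel2 B))"
    "m \<cdot> on_base k = Idt C (base B)"
    by (simp_all add: two_Eq_simps t2_def)
  have kh: "on1 k \<in> hom C (apex (rel1 B)) (apex R1)" "on2 k \<in> hom C (apex (rel2 B)) (apex S1)"
    "on_base k \<in> hom C (base B) I"
    using k(1) unfolding hom_def[of "two_Eq C"] two_Eq_simps is_eq2_arrow_def by (auto simp: A'_def)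
  show "on_base q \<in> cover (base (src q)) (base (trg q))"
    using cover_split_mono[OF e m kh(3) id(3)] unfolding me A_def B_def .
  show "on1 q \<in> cover (apex (rel1 (src q))) (apex (rel1 (trg q)))"
    using cover_split_mono[OF eR(1) mR(1,5) kh(1) id(1)] unfolding mR(4) A_def B_def .
  show "on2 q \<in> cover (apex (rel2 (src q))) (apex (rel2 (trg q)))"
    using cover_split_mono[OF eS(1) mS(1,5) kh(2) id(2)] unfolding mS(4) A_def B_def .
qed

lemma closed_under_quotients_Conn: "closed_under_quotients (two_Eq C) (pair_of ` Obj (Conn C))"
  unfolding closed_under_quotients_def
proof (intro allI impI)
  fix q assume *: "regular_epi (two_Eq C) q \<and> Dom (two_Eq C) q \<in> pair_of ` Obj (Conn C)"
  then have q: "regular_epi (two_Eq C) q" by simp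
  have "q \<in> Arr (two_Eq C)" using q unfolding regular_epi_def is_coequaliser_def by blast
  then have A: "is_eq2 C (src q)" and B: "is_eq2 C (trg q)"
    and qa: "is_eq2_arrow C (src q) (trg q) (on1 q) (on2 q) (on_base q)"
    by (simp_all add: two_Eq_simps)
  obtain p where "connector C (base (src q)) (rel1 (src q)) (rel2 (src q)) p"
    using * by (auto simp: two_Eq_simps Conn_simps is_conn_obj_def)
  then obtain p' where "connector C (base (trg q)) (rel1 (trg q)) (rel2 (trg q)) p'"
    using eq2_arrow.quotient_connector[OF eq2_arrow_intro[OF A B qa]] two_Eq_regular_epi[OF q]
      by blast
  then have "ConnObj (trg q) p' \<in> Obj (Conn C)" using B by (simp add: Conn_simps is_conn_obj_def)
  then have "pair_of (ConnObj (trg q) p') \<in> pair_of ` Obj (Conn C)" by (rule imageI)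
  then show "Cod (two_Eq C) q \<in> pair_of ` Obj (Conn C)" by (simp add: two_Eq_simps)
qed

end

theorem proposition3p8:
  fixes C :: "('o, 'm) cat"
  assumes "regular_category C"
    and "goursat_category C"
  shows "full_subcategory_via (Conn C) (two_Eq C) pair_of forget_arr \<and>
         closed_under_quotients (two_Eq C) (pair_of ` Obj (Conn C))"
proof -
  interpret goursat_cat C
    by unfold_locales (use assms in \<open>auto simp: regular_category_def\<close>)
  show ?thesis using full_subcategory_Conn closed_under_quotients_Conn ..
qed

end
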